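(* Let $\underline C$ be a row contraction on $\mathcal H_C$, let $\underline E$ be a minimal contractive lifting of $\underline C$ by $\underline A$ on $\mathcal H_E=\mathcal H_C\oplus\mathcal H_A$, and let $\underline E'$ be a minimal contractive lifting of $\underline E$ by $\underline A'$ on $\mathcal H_{E'}=\mathcal H_E\oplus\mathcal H_{A'}$. With respect to $\mathcal H_{E'}=\mathcal H_C\oplus\mathcal H_A\oplus\mathcal H_{A'}$ write $$E'_i=\begin{bmatrix}C_i&0&0\\ B_i&A_i&0\\ (B_1')_i&(B_2')_i&A'_i\end{bmatrix}=\begin{bmatrix}C_i&0\\ \hat B_i&\hat A_i\end{bmatrix},\qquad \hat A_i=\begin{bmatrix}A_i&0\\ (B_2')_i&A_i'\end{bmatrix},\qquad \hat B_i=\begin{bmatrix}B_i\\ (B_1')_i\end{bmatrix}\qquad(1\le i\le d),$$ so that $\underline{\hat A}$ is a contractive lifting of $\underline A$ by $\underline A'$ on $\mathcal H_{\hat A}=\mathcal H_A\oplus\mathcal H_{A'}$ and $\underline E'$ is a contractive lifting of $\underline C$ by $\underline{\hat A}$. Let $\delta:\mathcal D_{*,A'}\to\mathcal D_A$ and $\hat\gamma:\mathcal D_{*,\hat A}\to\mathcal D_C$ be the contractions with $\underline{B_2'}=D_{*,A'}\delta^*D_A$ and $\underline{\hat B}=D_{*,\hat A}\hat\gamma^*D_C$. Let $\sigma_{\hat A}:\mathcal D_{\hat A}\to\mathcal D_{*,\delta}\oplus\mathcal D_{A'}$, $\sigma'_{\hat A}:\mathcal D_{*,\hat A}\to\mathcal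 D_{*,A}\oplus\mathcal D_\delta$ and $\sigma_{E'}:\mathcal D_{E'}\to\mathcal D_{*,\hat\gamma}\oplus\mathcal D_{\hat A}$ be the unitaries determined by $$\sigma_{\hat A}D_{\hat A}=\begin{bmatrix}D_{*,\delta}D_A&0\\ -\underline A'^*\delta^*D_A&D_{A'}\end{bmatrix},\quad \sigma'_{\hat A}D_{*,\hat A}=\begin{bmatrix}D_{*,A}&-\underline A\,\delta D_{*,A'}\\ 0&D_\delta D_{*,A'}\end{bmatrix},\quad \sigma_{E'}D_{E'}=\begin{bmatrix}D_{*,\hat\gamma}D_C&0\\ -\underline{\hat A}^*\hat\gamma^*D_C&D_{\hat A}\end{bmatrix}.$$ Then, as operators from $\Gamma\otimes\mathcal H_{E'}^d$ to $\Gamma\otimes\mathcal D_C$, $$M_{C,E'}(I_\Gamma\otimes D_{E'})=\begin{bmatrix}I_\Gamma\otimes D_{*,\hat\gamma}&I_\Gamma\otimes\hat\gamma\end{bmatrix}\begin{bmatrix}I_{\Gamma\otimes\mathcal D_C}&0\\0&I_\Gamma\otimes(\sigma'_{\hat A})^{-1}\end{bmatrix}\begin{bmatrix}I_{\Gamma\otimes\mathcal D_C}&0&0\\0&M_A&0\\0&0&I_{\Gamma\otimes\mathcal D_{*,A'}}\end{bmatrix}\left(I_\Gamma\otimes\begin{bmatrix}I_{\mathcal D_C}&0&0\\0&D_{*,\delta}&\delta\\0&-\delta^*&D_\delta\end{bmatrix}\right)$$ $$\qquad\cdot\begin{bmatrix}I_{\Gamma\otimes\mathcal D_C}&0&0\\0&I_{\Gamma\otimes\mathcal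 D_A}&0\\0&0&M_{A'}\end{bmatrix}\begin{bmatrix}I_{\Gamma\otimes\mathcal D_C}&0\\0&I_\Gamma\otimes\sigma_{\hat A}\end{bmatrix}(I_\Gamma\otimes\sigma_{E'}D_{E'}).$$
   Context: Fix an integer $d\ge2$. $\Gamma=\mathbb C\oplus\mathbb C^d\oplus(\mathbb C^d)^{\otimes2}\oplus\cdots$ is the full Fock space over $\mathbb C^d$, with vacuum vector $e_0=1\oplus0\oplus\cdots$. $\{e_1,\dots,e_d\}$ is the standard basis of $\mathbb C^d$; $\tilde\Lambda=\bigcup_{n\ge0}\{1,\dots,d\}^n$ is the set of words (including the empty word), $e_\alpha=e_{\alpha_1}\otimes\cdots\otimes e_{\alpha_n}$ (and $e_0$ for the empty word), $S_\alpha=S_{\alpha_1}\cdots S_{\alpha_n}$ (and $I$ for the empty word). $R_i$ is the right creation operator $R_ix=x\otimes e_i$ on $\Gamma$. A row contraction on a Hilbert space $\mathcal H$ is a tuple $\underline S=(S_1,\dots,S_d)$ of bounded operators on $\mathcal H$ with $\sum_iS_iS_i^*\le I$; it is also regarded as the row operator $\underline S:\mathcal H^d\to\mathcal H$ (similarly $\underline B:\mathcal H_C^d\to\mathcal H_A$ for a tuple of operators $B_i:\mathcal H_C\to\mathcal H_A$). Its defect operators are $D_S=(I-\underline S^*\underline S)^{1/2}=(\delta_{ij}I-S_i^*S_j)^{1/2}$ on $\mathcal H^d$ and $D_{*,S}=(I-\underline S\,\underline S^* )^{1/2}$ on $\mathcal H$; defect spaces $\mathcal D_S=\overline{\mathrm{ran}}\,D_S$,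 $\mathcal D_{*,S}=\overline{\mathrm{ran}}\,D_{*,S}$. For $h\in\mathcal H$, $(D_S)_jh=D_S(0,\dots,h,\dots,0)$ with $h$ in the $j$-th place. For a contraction $T:\mathcal X\to\mathcal Y$ between Hilbert spaces, $D_T=(I-T^*T)^{1/2}$ on $\mathcal X$, $D_{*,T}=(I-TT^* )^{1/2}$ on $\mathcal Y$, $\mathcal D_T=\overline{\mathrm{ran}}\,D_T$, $\mathcal D_{*,T}=\overline{\mathrm{ran}}\,D_{*,T}$. A lifting of $\underline C$ (on $\mathcal H_C$) by $\underline A$ (on $\mathcal H_A$) is a tuple $\underline E$ on $\mathcal H_E=\mathcal H_C\oplus\mathcal H_A$ with $E_i=\begin{bmatrix}C_i&0\\ B_i&A_i\end{bmatrix}$; it is contractive if $\underline E$ is a row contraction. It is known that $\underline E$ is a row contraction iff $\underline C,\underline A$ are row contractions and there is a (necessarily unique) contraction $\gamma:\mathcal D_{*,A}\to\mathcal D_C$ with $\underline B^*=D_C\gamma D_{*,A}$. A contractive lifting $\underline E$ of $\underline C$ is minimal if $\mathcal H_E=\overline{\mathrm{span}}\{E_\alpha x:x\in\mathcal H_C,\alpha\in\tilde\Lambda\}$. Block operators on $\mathcal H_E^d$ refer to the identification $\mathcal H_E^d=\mathcal H_C^d\oplus\mathcal H_A^d$ (and similarly for other direct sums). The minimal isometric dilation $\underline V^S$ of a row contraction $\underline S$ on $\mathcal H_S$ acts on $\hat{\mathcal H}_S=\mathcal H_S\oplus(\Gamma\otimes\mathcal D_S)$ by $V_j^S(h\oplus\sum_\alpha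 e_\alpha\otimes d_\alpha)=S_jh\oplus\big(e_0\otimes(D_S)_jh+e_j\otimes\sum_\alpha e_\alpha\otimes d_\alpha\big)$. Characteristic function of a contractive lifting $\underline E$ of $\underline C$: $\overline{\mathrm{span}}\{V^E_\alpha h:h\in\mathcal H_C\}$ is a reducing subspace of $\underline V^E$ on which $\underline V^E$ is a copy of $\underline V^C$. Let $\mathcal K$ be its orthogonal complement in $\hat{\mathcal H}_E$ and $\underline Y=\underline V^E|_{\mathcal K}$. There is a unitary $W:\hat{\mathcal H}_E\to\hat{\mathcal H}_C\oplus\mathcal K$ with $W|_{\mathcal H_C}=I$ and $WV_i^E=(V^C_i\oplus Y_i)W$ for all $i$. Then $M_{C,E}=P_{\Gamma\otimes\mathcal D_C}W|_{\Gamma\otimes\mathcal D_E}:\Gamma\otimes\mathcal D_E\to\Gamma\otimes\mathcal D_C$. Characteristic function of a row contraction $\underline A$ on $\mathcal H$: $M_A:\Gamma\otimes\mathcal D_A\to\Gamma\otimes\mathcal D_{*,A}$ is the strong-operator limit as $r\to1^-$ of $M_A(rR)=-I_\Gamma\otimes\underline A+(I_\Gamma\otimes D_{*,A})\big(I-r\sum_iR_i\otimes A_i^*\big)^{-1}r\,\underline R\,(I_\Gamma\otimes D_A)$ (restricted to $\Gamma\otimes\mathcal D_A$), where $\underline R=(R_1\otimes I_{\mathcal H},\dots,R_d\otimes I_{\mathcal H}):\Gamma\otimes\mathcal H^d\to\Gamma\otimes\mathcal H$. Convention in the factorization: $\mathcal D_{*,\delta}\subseteq\mathcal D_A$, $\mathcal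 D_\delta\subseteq\mathcal D_{*,A'}$ and $\mathcal D_{*,\hat\gamma}\subseteq\mathcal D_C$ are regarded as subspaces; the factors are composed via these inclusions (at each stage the vectors produced lie in the domain of the next factor, in particular in $\Gamma\otimes(\mathcal D_{*,A}\oplus\mathcal D_\delta)$ before $(\sigma'_{\hat A})^{-1}$ is applied). *)

theory Defs
  imports "HOL-Analysis.Analysis"
begin

section \<open>Complex Hilbert spaces\<close>

text \<open>A complex inner product space is a real one, with compatible complex structure:
  the real inner product is the real part of the complex one, so that both induce the same norm.
  The complex inner product is linear in the first argument.\<close>

class complex_inner = real_inner +
  fixes scaleC :: "complex \<Rightarrow> 'a \<Rightarrow> 'a"  (infixr "*\<^sub>C" 75)
    and cinner :: "'a \<Rightarrow> 'a \<Rightarrow> complex"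
  assumes scaleC_add_right: "c *\<^sub>C (x + y) = c *\<^sub>C x + c *\<^sub>C y"
    and scaleC_add_left: "(b + c) *\<^sub>C x = b *\<^sub>C x + c *\<^sub>C x"
    and scaleC_scaleC: "b *\<^sub>C c *\<^sub>C x = (b * c) *\<^sub>C x"
    and scaleC_of_real: "complex_of_real r *\<^sub>C x = r *\<^sub>R x"
    and cinner_add_left: "cinner (x + y) z = cinner x z + cinner y z"
    and cinner_scaleC_left: "cinner (c *\<^sub>C x) y = c * cinner x y"
    and cinner_commute: "cinner x y = cnj (cinner y x)"
    and Re_cinner: "Re (cinner x y) = inner x y"

class complex_hilbert = complex_inner + complete_space

interpretation complex_vector: vector_space "scaleC :: complex \<Rightarrow> 'a \<Rightarrow> 'a::complex_inner"
proof
  show "1 *\<^sub>C x = x" for x :: 'a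
    using scaleC_of_real[of 1 x] by simp
qed (simp_all add: scaleC_add_right scaleC_add_left scaleC_scaleC)

lemma cinner_self: "cinner x x = complex_of_real ((norm x)\<^sup>2)"
proof -
  have "Im (cinner x x) = 0"
    using arg_cong[OF cinner_commute[of x x], of Im] by simp
  then show ?thesis
    by (simp add: complex_eq_iff Re_cinner power2_norm_eq_inner)
qed

lemma norm_scaleC: "norm (c *\<^sub>C x) = cmod c * norm (x::'a::complex_inner)"
proof -
  have "cinner (c *\<^sub>C x) (c *\<^sub>C x) = c * cnj c * cinner x x"
    by (metis cinner_commute cinner_scaleC_left complex_cnj_mult mult.assoc mult.commute)
  then have "complex_of_real ((norm (c *\<^sub>C x))\<^sup>2) = complex_of_real ((cmod c * norm x)\<^sup>2)"
    by (simp add: cinner_self complex_norm_square[symmetric] power_mult_distrib del: of_real_power)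
  then have "(norm (c *\<^sub>C x))\<^sup>2 = (cmod c * norm x)\<^sup>2"
    using of_real_eq_iff by blast
  then show ?thesis
    by (simp add: power2_eq_iff_nonneg)
qed

lemma norm_cinner_le: "cmod (cinner x y) \<le> norm x * norm (y::'a::complex_inner)"
proof (cases "cinner x y = 0")
  case False
  define z where "z = cinner x y"
  define u where "u = cnj z / complex_of_real (cmod z)"
  have "z \<noteq> 0" using False by (simp add: z_def)
  have "u * z = complex_of_real (cmod z) * complex_of_real (cmod z) / complex_of_real (cmod z)"
    using complex_norm_square[of z] by (simp add: u_def power2_eq_square mult.commute)
  then have "cinner (u *\<^sub>C x) y = complex_of_real (cmod (cinner x y))"
    using \<open>z \<noteq> 0\<close> by (simp add: cinner_scaleC_left flip: z_def)
  then have "cmod (cinner x y) = inner (u *\<^sub>C x) y"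
    by (metis Re_cinner Re_complex_of_real)
  also have "\<dots> \<le> norm (u *\<^sub>C x) * norm y"
    by (rule norm_cauchy_schwarz)
  also have "\<dots> = norm x * norm y"
    using \<open>z \<noteq> 0\<close> by (simp add: norm_scaleC u_def norm_divide)
  finally show ?thesis .
qed simp

instantiation prod :: (complex_inner, complex_inner) complex_inner
begin

definition "c *\<^sub>C x = (c *\<^sub>C fst x, c *\<^sub>C snd x)"
definition "cinner x y = cinner (fst x) (fst y) + cinner (snd x) (snd y)"

instance
proof
  fix x y :: "'a \<times> 'b"
  show "cinner x y = cnj (cinner y x)"
    by (simp add: cinner_prod_def cinner_commute[of "fst x"] cinner_commute[of "snd x"])
qed (simp_all add: scaleC_prod_def cinner_prod_def scaleC_add_right scaleC_add_left scaleC_scaleC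
    scaleC_of_real cinner_add_left cinner_scaleC_left Re_cinner algebra_simps inner_prod_def
    scaleR_prod_def)

end

instance prod :: (complex_hilbert, complex_hilbert) complex_hilbert ..

instantiation vec :: (complex_inner, finite) complex_inner
begin

definition "c *\<^sub>C x = (\<chi> i. c *\<^sub>C (x $ i))"
definition "cinner x y = (\<Sum>i\<in>UNIV. cinner (x $ i) (y $ i))"

instance
proof
  fix x y :: "'a ^ 'b"
  show "cinner x y = cnj (cinner y x)"
    unfolding cinner_vec_def cnj_sum by (rule sum.cong[OF refl cinner_commute])
qed (simp_all add: scaleC_vec_def cinner_vec_def scaleC_add_right scaleC_add_left scaleC_scaleC
    scaleC_of_real cinner_add_left cinner_scaleC_left Re_cinner sum.distrib sum_distrib_left
    inner_vec_def vec_eq_iff)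

end

instance vec :: (complex_hilbert, finite) complex_hilbert ..


section \<open>The Hilbert space of square summable families\<close>

typedef (overloaded) ('i, 'a) ell2 =
  "{f :: 'i \<Rightarrow> 'a::complex_inner. (\<lambda>i. (norm (f i))\<^sup>2) summable_on UNIV}"
  morphisms coord Abs_ell2
  by (rule exI[of _ "\<lambda>_. 0"]) simp

lemma summable_coord: "(\<lambda>i. (norm (coord f i))\<^sup>2) summable_on UNIV"
  using coord by auto

lemma ell2_eqI: "(\<And>i. coord f i = coord g i) \<Longrightarrow> f = g"
  by (simp add: coord_inject[symmetric] fun_eq_iff)

lemma summable_norm_mult:
  fixes f g :: "'i \<Rightarrow> 'a::complex_inner"
  assumes "(\<lambda>i. (norm (f i))\<^sup>2) summable_on UNIV" "(\<lambda>i. (norm (g i))\<^sup>2) summable_on UNIV"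
  shows "(\<lambda>i. norm (f i) * norm (g i)) summable_on UNIV"
proof (rule summable_on_comparison_test)
  show "(\<lambda>i. (norm (f i))\<^sup>2 + (norm (g i))\<^sup>2) summable_on UNIV"
    using assms by (rule summable_on_add)
  show "norm (f i) * norm (g i) \<le> (norm (f i))\<^sup>2 + (norm (g i))\<^sup>2" for i
  proof -
    have "2 * (norm (f i) * norm (g i)) \<le> (norm (f i))\<^sup>2 + (norm (g i))\<^sup>2"
      using sum_squares_bound[of "norm (f i)" "norm (g i)"] by (simp add: mult.assoc)
    moreover have "0 \<le> norm (f i) * norm (g i)" by simp
    ultimately show ?thesis by linarith
  qed
qed simp_all

lemma square_summable_add:
  fixes f g :: "'i \<Rightarrow> 'a::complex_inner"
  assumes "(\<lambda>i. (norm (f i))\<^sup>2) summable_on UNIV" "(\<lambda>i. (norm (g i))\<^sup>2) summable_on UNIV"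
  shows "(\<lambda>i. (norm (f i + g i))\<^sup>2) summable_on UNIV"
proof (rule summable_on_comparison_test)
  show "(\<lambda>i. (norm (f i))\<^sup>2 + (norm (g i))\<^sup>2 + 2 * (norm (f i) * norm (g i))) summable_on UNIV"
    by (intro summable_on_add summable_on_cmult_right summable_norm_mult assms)
  show "(norm (f i + g i))\<^sup>2 \<le> (norm (f i))\<^sup>2 + (norm (g i))\<^sup>2 + 2 * (norm (f i) * norm (g i))" for i
    using power_mono[OF norm_triangle_ineq[of "f i" "g i"], of 2]
    by (simp add: power2_sum mult.assoc)
qed simp_all

lemma square_summable_scaleC:
  fixes f :: "'i \<Rightarrow> 'a::complex_inner"
  assumes "(\<lambda>i. (norm (f i))\<^sup>2) summable_on UNIV"
  shows "(\<lambda>i. (norm (c *\<^sub>C f i))\<^sup>2) summable_on UNIV"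
  using summable_on_cmult_right[OF assms, of "(cmod c)\<^sup>2"]
  by (simp add: norm_scaleC power_mult_distrib)

lemma summable_cinner:
  fixes f g :: "'i \<Rightarrow> 'a::complex_inner"
  assumes "(\<lambda>i. (norm (f i))\<^sup>2) summable_on UNIV" "(\<lambda>i. (norm (g i))\<^sup>2) summable_on UNIV"
  shows "(\<lambda>i. cinner (f i) (g i)) summable_on UNIV"
  by (rule abs_summable_summable,
      rule summable_on_comparison_test[OF summable_norm_mult[OF assms]])
    (simp_all add: norm_cinner_le)

instantiation ell2 :: (type, complex_inner) complex_inner
begin

definition "0 = Abs_ell2 (\<lambda>_. 0)"
definition "f + g = Abs_ell2 (\<lambda>i. coord f i + coord g i)"
definition "f - g = Abs_ell2 (\<lambda>i. coord f i - coord g i)"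
definition "- f = Abs_ell2 (\<lambda>i. - coord f i)"
definition "r *\<^sub>R f = Abs_ell2 (\<lambda>i. r *\<^sub>R coord f i)" for f :: "('a, 'b) ell2"
definition "c *\<^sub>C f = Abs_ell2 (\<lambda>i. c *\<^sub>C coord f i)" for f :: "('a, 'b) ell2"
definition "cinner f g = (\<Sum>\<^sub>\<infinity>i. cinner (coord f i) (coord g i))" for f g :: "('a, 'b) ell2"
definition "inner f g = Re (cinner f g)" for f g :: "('a, 'b) ell2"
definition "norm f = sqrt (inner f f)" for f :: "('a, 'b) ell2"
definition "dist f g = norm (f - g)" for f g :: "('a, 'b) ell2"
definition "sgn f = inverse (norm f) *\<^sub>R f" for f :: "('a, 'b) ell2"
definition "uniformity = (INF e\<in>{0<..}. principal {(f :: ('a, 'b) ell2, g). dist f g < e})"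
definition "open U = (\<forall>f\<in>U. \<forall>\<^sub>F (f', g) in uniformity. f' = f \<longrightarrow> g \<in> U)"
  for U :: "('a, 'b) ell2 set"

lemma coord_zero: "coord 0 i = 0"
  by (simp add: zero_ell2_def Abs_ell2_inverse)

lemma coord_add: "coord (f + g) i = coord f i + coord g i"
  by (simp add: plus_ell2_def Abs_ell2_inverse square_summable_add summable_coord)

lemma coord_scaleC: "coord (c *\<^sub>C f) i = c *\<^sub>C coord f i"
  by (simp add: scaleC_ell2_def Abs_ell2_inverse square_summable_scaleC summable_coord)

lemma coord_scaleR: "coord (r *\<^sub>R f) i = r *\<^sub>R coord f i"
  using square_summable_scaleC[OF summable_coord, of "complex_of_real r" f]
  by (simp add: scaleR_ell2_def Abs_ell2_inverse scaleC_of_real del: norm_scaleR)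

lemma coord_uminus: "coord (- f) i = - coord f i"
  using summable_coord[of f] by (simp add: uminus_ell2_def Abs_ell2_inverse)

lemma coord_diff: "coord (f - g) i = coord f i - coord g i"
  using square_summable_add[OF summable_coord[of f], of "\<lambda>i. - coord g i"] summable_coord[of g]
  by (simp add: minus_ell2_def Abs_ell2_inverse)

lemmas coord_simps = coord_zero coord_add coord_diff coord_uminus coord_scaleC coord_scaleR

lemma cinner_self_ell2:
  "cinner f f = complex_of_real (\<Sum>\<^sub>\<infinity>i. (norm (coord f i))\<^sup>2)" for f :: "('a, 'b) ell2"
  using infsumI[OF has_sum_of_real[OF has_sum_infsum[OF summable_coord[of f]], where ?'a = complex]]
  by (simp add: cinner_ell2_def cinner_self del: of_real_power)

instance
proof
  fix f g h :: "('a, 'b) ell2" and r s :: real and b c :: complex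
  note [simp] = coord_simps
  show add_left: "cinner (f + g) h = cinner f h + cinner g h" for f g h :: "('a, 'b) ell2"
    by (simp add: cinner_ell2_def cinner_add_left infsum_add summable_cinner summable_coord)
  show scale_left: "cinner (c *\<^sub>C f) g = c * cinner f g" for c and f g :: "('a, 'b) ell2"
    by (simp add: cinner_ell2_def cinner_scaleC_left infsum_cmult_right')
  show commute: "cinner f g = cnj (cinner g f)" for f g :: "('a, 'b) ell2"
    unfolding cinner_ell2_def infsum_cnj[symmetric]
    by (rule infsum_cong) (rule cinner_commute)
  show of_real: "complex_of_real r *\<^sub>C f = r *\<^sub>R f" for r and f :: "('a, 'b) ell2"
    by (rule ell2_eqI) (simp add: scaleC_of_real)
  show "dist f g = norm (f - g)" by (rule dist_ell2_def)
  show "sgn f = inverse (norm f) *\<^sub>R f" by (rule sgn_ell2_def)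
  show "uniformity = (INF e\<in>{0<..}. principal {(f :: ('a, 'b) ell2, g). dist f g < e})"
    by (rule uniformity_ell2_def)
  show "open U = (\<forall>f\<in>U. \<forall>\<^sub>F (f', g) in uniformity. f' = f \<longrightarrow> g \<in> U)"
    for U :: "('a, 'b) ell2 set"
    by (rule open_ell2_def)
  show "Re (cinner f g) = inner f g" by (simp add: inner_ell2_def)
  show "norm f = sqrt (inner f f)" by (rule norm_ell2_def)
  show "inner f g = inner g f"
    unfolding inner_ell2_def by (subst commute) simp
  show "inner (f + g) h = inner f h + inner g h"
    by (simp add: inner_ell2_def add_left)
  show "inner (r *\<^sub>R f) g = r * inner f g"
    by (simp add: inner_ell2_def of_real[symmetric] scale_left)
  show "0 \<le> inner f f"
    by (simp add: inner_ell2_def cinner_self_ell2 infsum_nonneg)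
  show "inner f f = 0 \<longleftrightarrow> f = 0"
  proof
    assume "inner f f = 0"
    then have "(norm (coord f i))\<^sup>2 = 0" for i
      using nonneg_infsum_le_0D[of "\<lambda>i. (norm (coord f i))\<^sup>2" UNIV i]
      by (simp add: inner_ell2_def cinner_self_ell2 summable_coord)
    then show "f = 0"
      by (intro ell2_eqI) simp
  qed (simp add: inner_ell2_def cinner_self_ell2)
qed (rule ell2_eqI; simp add: coord_simps algebra_simps scaleC_add_right scaleC_add_left
    scaleC_scaleC)+

end

lemma norm_ell2_square: "(norm f)\<^sup>2 = (\<Sum>\<^sub>\<infinity>i. (norm (coord f i))\<^sup>2)"
  for f :: "('i, 'a::complex_inner) ell2"
  by (simp add: power2_norm_eq_inner inner_ell2_def cinner_self_ell2)

lemma sum_coord_le: "finite F \<Longrightarrow> (\<Sum>i\<in>F. (norm (coord f i))\<^sup>2) \<le> (norm f)\<^sup>2"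
  for f :: "('i, 'a::complex_inner) ell2"
  unfolding norm_ell2_square by (rule finite_sum_le_infsum) (simp_all add: summable_coord)

instance ell2 :: (type, complex_hilbert) complex_hilbert
proof
  fix X :: "nat \<Rightarrow> ('a, 'b) ell2"
  assume X: "Cauchy X"
  have le: "norm (coord f i) \<le> norm f" for f :: "('a, 'b) ell2" and i
    using sum_coord_le[of "{i}" f] by (simp add: power_mono_iff)
  have "Cauchy (\<lambda>n. coord (X n) i)" for i
  proof (rule CauchyI)
    fix e :: real assume "e > 0"
    then obtain N where "\<forall>m\<ge>N. \<forall>n\<ge>N. norm (X m - X n) < e"
      using CauchyD[OF X] by blast
    then show "\<exists>N. \<forall>m\<ge>N. \<forall>n\<ge>N. norm (coord (X m) i - coord (X n) i) < e"
      using le[of "X _ - X _" i] unfolding coord_diff by (meson order.strict_trans1)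
  qed
  then have "\<forall>i. \<exists>l. (\<lambda>n. coord (X n) i) \<longlonglongrightarrow> l"
    using Cauchy_convergent_iff convergent_def by blast
  then obtain L where L: "\<And>i. (\<lambda>n. coord (X n) i) \<longlonglongrightarrow> L i"
    by metis
  have bound: "(\<Sum>i\<in>F. (norm (coord (X n) i - L i))\<^sup>2) \<le> e\<^sup>2"
    if "\<forall>m\<ge>N. norm (X n - X m) \<le> e" "finite F" for n N e F
  proof (rule LIMSEQ_le_const2)
    show "(\<lambda>m. \<Sum>i\<in>F. (norm (coord (X n) i - coord (X m) i))\<^sup>2)
        \<longlonglongrightarrow> (\<Sum>i\<in>F. (norm (coord (X n) i - L i))\<^sup>2)"
      by (intro tendsto_intros L)
    show "\<exists>N. \<forall>m\<ge>N. (\<Sum>i\<in>F. (norm (coord (X n) i - coord (X m) i))\<^sup>2) \<le> e\<^sup>2"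
    proof (intro exI allI impI)
      fix m assume "m \<ge> N"
      have "(\<Sum>i\<in>F. (norm (coord (X n) i - coord (X m) i))\<^sup>2) \<le> (norm (X n - X m))\<^sup>2"
        using sum_coord_le[OF that(2), of "X n - X m"] by (simp add: coord_diff)
      also have "\<dots> \<le> e\<^sup>2"
        using that(1) \<open>m \<ge> N\<close> by (intro power_mono) auto
      finally show "(\<Sum>i\<in>F. (norm (coord (X n) i - coord (X m) i))\<^sup>2) \<le> e\<^sup>2" .
    qed
  qed
  have summ: "(\<lambda>i. (norm (coord (X n) i - L i))\<^sup>2) summable_on UNIV"
    if "\<forall>m\<ge>N. norm (X n - X m) \<le> e" for n N e
    using bound[OF that] by (intro nonneg_bdd_above_summable_on) (auto intro!: bdd_aboveI)
  obtain N where N: "\<forall>m\<ge>N. \<forall>n\<ge>N. norm (X m - X n) < 1"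
    using CauchyD[OF X, of 1] by auto
  have "(\<lambda>i. (norm (L i))\<^sup>2) summable_on UNIV"
    using square_summable_add[OF summable_coord[of "X N"], of "\<lambda>i. - (coord (X N) i - L i)"]
      summ[of N N 1] N
    by (force simp: norm_minus_commute less_imp_le)
  then have cL: "coord (Abs_ell2 L) = L"
    by (simp add: Abs_ell2_inverse)
  have "X \<longlonglongrightarrow> Abs_ell2 L"
  proof (rule LIMSEQ_I)
    fix e :: real assume "e > 0"
    then obtain N where N: "\<forall>m\<ge>N. \<forall>n\<ge>N. norm (X m - X n) < e / 2"
      using CauchyD[OF X, of "e/2"] by auto
    have "norm (X n - Abs_ell2 L) < e" if "n \<ge> N" for n
    proof -
      have *: "\<forall>m\<ge>N. norm (X n - X m) \<le> e / 2"
        using N that by (simp add: less_imp_le)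
      have "(norm (X n - Abs_ell2 L))\<^sup>2 \<le> (e / 2)\<^sup>2"
        unfolding norm_ell2_square coord_diff cL
        by (rule infsum_le_finite_sums[OF summ[OF *] bound[OF *]])
      then have "norm (X n - Abs_ell2 L) \<le> e / 2"
        using \<open>e > 0\<close> by (simp add: power_mono_iff)
      then show ?thesis using \<open>e > 0\<close> by simp
    qed
    then show "\<exists>N. \<forall>n\<ge>N. norm (X n - Abs_ell2 L) < e" by blast
  qed
  then show "convergent X" by (rule convergentI)
qed


section \<open>Operators between closed subspaces\<close>

text \<open>Operators are total functions which matter only on their domain, a closed subspace
  \<open>X\<close> of the ambient type; \<open>X = UNIV\<close> for operators defined on the whole space.\<close>

definition bounded_op ::
    "'a::complex_inner set \<Rightarrow> 'b::complex_inner set \<Rightarrow> ('a \<Rightarrow> 'b) \<Rightarrow> bool" where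
  "bounded_op X Y T \<longleftrightarrow> (\<forall>x\<in>X. T x \<in> Y) \<and>
     (\<forall>x\<in>X. \<forall>y\<in>X. T (x + y) = T x + T y) \<and> (\<forall>c. \<forall>x\<in>X. T (c *\<^sub>C x) = c *\<^sub>C T x) \<and>
     (\<exists>K. \<forall>x\<in>X. norm (T x) \<le> K * norm x)"

definition contraction ::
    "'a::complex_inner set \<Rightarrow> 'b::complex_inner set \<Rightarrow> ('a \<Rightarrow> 'b) \<Rightarrow> bool" where
  "contraction X Y T \<longleftrightarrow> bounded_op X Y T \<and> (\<forall>x\<in>X. norm (T x) \<le> norm x)"

definition unitary_op ::
    "'a::complex_inner set \<Rightarrow> 'b::complex_inner set \<Rightarrow> ('a \<Rightarrow> 'b) \<Rightarrow> bool" where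
  "unitary_op X Y U \<longleftrightarrow> bounded_op X Y U \<and> U ` X = Y \<and>
     (\<forall>x\<in>X. \<forall>y\<in>X. cinner (U x) (U y) = cinner x y)"

definition positive_op :: "'a::complex_inner set \<Rightarrow> ('a \<Rightarrow> 'a) \<Rightarrow> bool" where
  "positive_op X T \<longleftrightarrow> bounded_op X X T \<and>
     (\<forall>x\<in>X. Im (cinner (T x) x) = 0 \<and> 0 \<le> Re (cinner (T x) x))"

definition adj :: "'a::complex_inner set \<Rightarrow> ('a \<Rightarrow> 'b::complex_inner) \<Rightarrow> 'b \<Rightarrow> 'a" where
  "adj X T y = (THE x. x \<in> X \<and> (\<forall>z\<in>X. cinner (T z) y = cinner z x))"

text \<open>The positive square root is unique as an operator on \<open>X\<close>, but not as a total function.\<close>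

definition sqrt_op :: "'a::complex_inner set \<Rightarrow> ('a \<Rightarrow> 'a) \<Rightarrow> 'a \<Rightarrow> 'a" where
  "sqrt_op X T = (SOME P. positive_op X P \<and> (\<forall>x\<in>X. P (P x) = T x))"

text \<open>For a contraction \<open>T : X \<rightarrow> Y\<close>: the defect operators \<open>D\<^sub>T = (I - T\<^sup>*T)\<^sup>1\<^sup>/\<^sup>2\<close> on \<open>X\<close> and
  \<open>D\<^sub>*\<^sub>,\<^sub>T = (I - TT\<^sup>*)\<^sup>1\<^sup>/\<^sup>2\<close> on \<open>Y\<close>, and the closures of their ranges.\<close>

definition defect :: "'a::complex_inner set \<Rightarrow> ('a \<Rightarrow> 'b::complex_inner) \<Rightarrow> 'a \<Rightarrow> 'a" where
  "defect X T = sqrt_op X (\<lambda>x. x - adj X T (T x))"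

definition codefect ::
    "'a::complex_inner set \<Rightarrow> 'b::complex_inner set \<Rightarrow> ('a \<Rightarrow> 'b) \<Rightarrow> 'b \<Rightarrow> 'b" where
  "codefect X Y T = sqrt_op Y (\<lambda>y. y - T (adj X T y))"

definition defect_space :: "'a::complex_inner set \<Rightarrow> ('a \<Rightarrow> 'b::complex_inner) \<Rightarrow> 'a set" where
  "defect_space X T = closure (defect X T ` X)"

definition codefect_space ::
    "'a::complex_inner set \<Rightarrow> 'b::complex_inner set \<Rightarrow> ('a \<Rightarrow> 'b) \<Rightarrow> 'b set" where
  "codefect_space X Y T = closure (codefect X Y T ` Y)"


section \<open>Row contractions and liftings\<close>

definition row_op :: "('d::finite \<Rightarrow> 'h \<Rightarrow> 'k) \<Rightarrow> 'h ^ 'd \<Rightarrow> 'k::comm_monoid_add" where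
  "row_op S x = (\<Sum>i\<in>UNIV. S i (x $ i))"

definition row_contraction :: "('d::finite \<Rightarrow> 'h \<Rightarrow> 'h::complex_hilbert) \<Rightarrow> bool" where
  "row_contraction S \<longleftrightarrow> (\<forall>i. bounded_op UNIV UNIV (S i)) \<and>
     positive_op UNIV (\<lambda>x. x - (\<Sum>i\<in>UNIV. S i (adj UNIV (S i) x)))"

abbreviation row_defect :: "('d::finite \<Rightarrow> 'h \<Rightarrow> 'h) \<Rightarrow> 'h ^ 'd \<Rightarrow> 'h::complex_hilbert ^ 'd" where
  "row_defect S \<equiv> defect UNIV (row_op S)"

abbreviation row_codefect :: "('d::finite \<Rightarrow> 'h \<Rightarrow> 'h) \<Rightarrow> 'h \<Rightarrow> 'h::complex_hilbert" where
  "row_codefect S \<equiv> codefect UNIV UNIV (row_op S)"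

abbreviation row_defect_space :: "('d::finite \<Rightarrow> 'h \<Rightarrow> 'h) \<Rightarrow> ('h::complex_hilbert ^ 'd) set" where
  "row_defect_space S \<equiv> defect_space UNIV (row_op S)"

abbreviation row_codefect_space :: "('d::finite \<Rightarrow> 'h \<Rightarrow> 'h) \<Rightarrow> 'h::complex_hilbert set" where
  "row_codefect_space S \<equiv> codefect_space UNIV UNIV (row_op S)"

text \<open>The tuple of block operators \<open>E\<^sub>i = [C\<^sub>i, 0; B\<^sub>i, A\<^sub>i]\<close>.\<close>

definition lifting ::
    "('d \<Rightarrow> 'c \<Rightarrow> 'c) \<Rightarrow> ('d \<Rightarrow> 'c \<Rightarrow> 'a) \<Rightarrow> ('d \<Rightarrow> 'a \<Rightarrow> 'a) \<Rightarrow> 'd \<Rightarrow> 'c \<times> 'a \<Rightarrow> 'c \<times> 'a::plus" where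
  "lifting C B A i = (\<lambda>(x, y). (C i x, B i x + A i y))"

definition contractive_lifting ::
    "('d::finite \<Rightarrow> 'c \<Rightarrow> 'c::complex_hilbert) \<Rightarrow> ('d \<Rightarrow> 'c \<Rightarrow> 'a) \<Rightarrow>
     ('d \<Rightarrow> 'a \<Rightarrow> 'a::complex_hilbert) \<Rightarrow> bool" where
  "contractive_lifting C B A \<longleftrightarrow>
     (\<forall>i. bounded_op UNIV UNIV (C i) \<and> bounded_op UNIV UNIV (B i) \<and> bounded_op UNIV UNIV (A i)) \<and>
     row_contraction (lifting C B A)"

text \<open>\<open>word_op S \<alpha> = S\<^sub>\<alpha>\<^sub>1 \<circ> \<dots> \<circ> S\<^sub>\<alpha>\<^sub>n\<close>\<close>

definition word_op :: "('d \<Rightarrow> 'h \<Rightarrow> 'h) \<Rightarrow> 'd list \<Rightarrow> 'h \<Rightarrow> 'h" where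
  "word_op S w = foldr S w"

definition minimal_lifting ::
    "('d::finite \<Rightarrow> 'c \<Rightarrow> 'c::complex_hilbert) \<Rightarrow> ('d \<Rightarrow> 'c \<Rightarrow> 'a) \<Rightarrow>
     ('d \<Rightarrow> 'a \<Rightarrow> 'a::complex_hilbert) \<Rightarrow> bool" where
  "minimal_lifting C B A \<longleftrightarrow> contractive_lifting C B A \<and>
     closure (complex_vector.span {word_op (lifting C B A) w (x, 0) | w x. True}) = UNIV"


section \<open>Fock spaces\<close>

text \<open>\<open>\<Gamma> \<otimes> H\<close> is the space of square summable families \<open>(x\<^sub>\<alpha>)\<close> in \<open>H\<close> indexed by words, standing for
  \<open>\<Sum>\<^sub>\<alpha> e\<^sub>\<alpha> \<otimes> x\<^sub>\<alpha>\<close>; \<open>fock_sub X\<close> is \<open>\<Gamma> \<otimes> X\<close>. The families passed to \<open>Abs_ell2\<close> below are square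
  summable for all arguments of interest.\<close>

type_synonym ('d, 'h) fock = "('d list, 'h) ell2"

definition fock_sub :: "'h set \<Rightarrow> ('d, 'h::complex_inner) fock set" where
  "fock_sub X = {f. \<forall>w. coord f w \<in> X}"

text \<open>\<open>I \<otimes> T\<close>\<close>

definition amp :: "('h \<Rightarrow> 'k) \<Rightarrow> ('d, 'h::complex_inner) fock \<Rightarrow> ('d, 'k::complex_inner) fock" where
  "amp T f = Abs_ell2 (\<lambda>w. T (coord f w))"

text \<open>\<open>S \<oplus> T\<close>, under the identification \<open>\<Gamma> \<otimes> (H \<oplus> K) = (\<Gamma> \<otimes> H) \<oplus> (\<Gamma> \<otimes> K)\<close>\<close>

definition fock_diag ::
    "(('d, 'h) fock \<Rightarrow> ('d, 'h') fock) \<Rightarrow> (('d, 'k) fock \<Rightarrow> ('d, 'k') fock) \<Rightarrow>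
     ('d, 'h::complex_inner \<times> 'k::complex_inner) fock \<Rightarrow>
     ('d, 'h'::complex_inner \<times> 'k'::complex_inner) fock" where
  "fock_diag S T f = Abs_ell2 (\<lambda>w. (coord (S (amp fst f)) w, coord (T (amp snd f)) w))"

text \<open>\<open>R\<^sub>i \<otimes> I\<close> and the row operator formed by these\<close>

definition right_create :: "'d \<Rightarrow> ('d, 'h::complex_inner) fock \<Rightarrow> ('d, 'h) fock" where
  "right_create i f =
     Abs_ell2 (\<lambda>w. if w \<noteq> [] \<and> last w = i then coord f (butlast w) else 0)"

definition row_create :: "('d::finite, 'h::complex_inner ^ 'd) fock \<Rightarrow> ('d, 'h) fock" where
  "row_create f = (\<Sum>i\<in>UNIV. right_create i (amp (\<lambda>x. x $ i) f))"


section \<open>The characteristic function of a row contraction\<close>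

definition char_fun_r ::
    "real \<Rightarrow> ('d::finite \<Rightarrow> 'h \<Rightarrow> 'h) \<Rightarrow> ('d, 'h::complex_hilbert ^ 'd) fock \<Rightarrow> ('d, 'h) fock" where
  "char_fun_r r A f = - amp (row_op A) f +
     amp (row_codefect A)
       (inv (\<lambda>g. g - r *\<^sub>R (\<Sum>i\<in>UNIV. right_create i (amp (adj UNIV (A i)) g)))
         (r *\<^sub>R row_create (amp (row_defect A) f)))"

definition char_fun ::
    "('d::finite \<Rightarrow> 'h \<Rightarrow> 'h) \<Rightarrow> ('d, 'h::complex_hilbert ^ 'd) fock \<Rightarrow> ('d, 'h) fock" where
  "char_fun A f = Lim (at_left 1) (\<lambda>r. char_fun_r r A f)"


section \<open>The characteristic function of a lifting\<close>

text \<open>The minimal isometric dilation of \<open>S\<close>, on \<open>H \<oplus> (\<Gamma> \<otimes> D\<^sub>S)\<close>\<close>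

definition dilation_space ::
    "('d::finite \<Rightarrow> 'h \<Rightarrow> 'h) \<Rightarrow> ('h \<times> ('d, 'h::complex_hilbert ^ 'd) fock) set" where
  "dilation_space S = UNIV \<times> fock_sub (row_defect_space S)"

definition dilation ::
    "('d::finite \<Rightarrow> 'h \<Rightarrow> 'h) \<Rightarrow> 'd \<Rightarrow> 'h \<times> ('d, 'h::complex_hilbert ^ 'd) fock \<Rightarrow>
     'h \<times> ('d, 'h ^ 'd) fock" where
  "dilation S j = (\<lambda>(h, f).
     (S j h, Abs_ell2 (\<lambda>w. case w of
         [] \<Rightarrow> row_defect S (axis j h)
       | i # v \<Rightarrow> if i = j then coord f v else 0)))"

text \<open>For a tuple \<open>E\<close> on \<open>H\<^sub>C \<oplus> H\<^sub>A\<close>: the orthogonal complement in the dilation space of \<open>E\<close> of the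
  closed span of all \<open>V\<^sup>E\<^sub>\<alpha> h\<close> with \<open>h \<in> H\<^sub>C\<close>\<close>

definition lifting_complement ::
    "('d::finite \<Rightarrow> 'c \<times> 'a \<Rightarrow> 'c \<times> 'a) \<Rightarrow>
     (('c::complex_hilbert \<times> 'a::complex_hilbert) \<times> ('d, ('c \<times> 'a) ^ 'd) fock) set" where
  "lifting_complement E = {z \<in> dilation_space E.
     \<forall>y \<in> closure (complex_vector.span {word_op (dilation E) w ((x, 0), 0) | w x. True}).
       cinner y z = 0}"

definition lifting_unitary ::
    "('d::finite \<Rightarrow> 'c \<Rightarrow> 'c) \<Rightarrow> ('d \<Rightarrow> 'c \<times> 'a \<Rightarrow> 'c \<times> 'a) \<Rightarrow>
     (('c::complex_hilbert \<times> 'a::complex_hilbert) \<times> ('d, ('c \<times> 'a) ^ 'd) fock \<Rightarrow>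
       ('c \<times> ('d, 'c ^ 'd) fock) \<times> (('c \<times> 'a) \<times> ('d, ('c \<times> 'a) ^ 'd) fock)) \<Rightarrow> bool" where
  "lifting_unitary C E W \<longleftrightarrow>
     unitary_op (dilation_space E) (dilation_space C \<times> lifting_complement E) W \<and>
     (\<forall>x. W ((x, 0), 0) = ((x, 0), 0)) \<and>
     (\<forall>i. \<forall>z \<in> dilation_space E.
        W (dilation E i z) = map_prod (dilation C i) (dilation E i) (W z))"

text \<open>\<open>W\<close> exists and is determined up to a unitary of the complement, to which the following
  operator \<open>P W\<close> restricted to \<open>\<Gamma> \<otimes> D\<^sub>E\<close> is insensitive.\<close>

definition char_lifting ::
    "('d::finite \<Rightarrow> 'c \<Rightarrow> 'c) \<Rightarrow> ('d \<Rightarrow> 'c \<times> 'a \<Rightarrow> 'c \<times> 'a) \<Rightarrow>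
     ('d, ('c::complex_hilbert \<times> 'a::complex_hilbert) ^ 'd) fock \<Rightarrow> ('d, 'c ^ 'd) fock" where
  "char_lifting C E f = snd (fst ((SOME W. lifting_unitary C E W) (0, f)))"

text \<open>The identification \<open>(H \<oplus> K)\<^sup>d = H\<^sup>d \<oplus> K\<^sup>d\<close>\<close>

definition vec_split :: "('h \<times> 'k) ^ 'd \<Rightarrow> ('h ^ 'd) \<times> ('k ^ 'd::finite)" where
  "vec_split x = (\<chi> i. fst (x $ i), \<chi> i. snd (x $ i))"

end

theory Submission
  imports Defs
begin

text \<open>
  The formula is a statement about discrete linear systems. For a row contraction \<open>A\<close> with row
  operator \<open>T\<close> and an input \<open>f\<close>, a family indexed by words, consider the states and responses
  \[ s_\emptyset = 0, \quad s_{uj} = (T^* s_u + D_A f_u)_j, \qquad y_w = D_{*,A} s_w - T f_w . \]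
  The coordinates of \<open>M\<^sub>A f\<close> are the responses \<open>y\<^sub>w\<close> (\<open>coord_char_fun\<close>). For \<open>r < 1\<close> the resolvent in
  \<open>M\<^sub>A(rR)\<close> solves the same recursion with an additional factor \<open>r\<close>. Since the Julia operator
  \<open>[T\<^sup>*, D\<^sub>A; D\<^sub>*\<^sub>,\<^sub>A, -T]\<close> is isometric, \<open>M\<^sub>A(rR)\<close> is a contraction, and homogeneity in the word length
  yields the strong limit.

  The same states describe the adjoints of words in the minimal isometric dilation
  (\<open>inner_word_dilation\<close>). The unitary \<open>W\<close> of a lifting \<open>E\<close> of \<open>C\<close> is prescribed on the vectors
  \<open>V\<^sup>E\<^sub>\<alpha> h\<close> with \<open>h\<close> in \<open>H\<^sub>C\<close>, and \<open>e\<^sub>w \<otimes> D\<^sub>C x\<close> is a combination of the corresponding \<open>V\<^sup>C\<^sub>\<alpha> h\<close>. Hence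
  the coordinates of \<open>M\<^sub>C\<^sub>,\<^sub>E f\<close> are inner products of \<open>f\<close> with explicit vectors of the dilation space of
  \<open>E\<close>, that is, they are expressed by the states of \<open>E\<close> (\<open>char_lifting_weak\<close>).

  Both reductions leave the algebra of a lifting \<open>E\<close> of \<open>C\<close> by \<open>A\<close> with parameter \<open>\<gamma>\<close>. Write
  \<open>\<sigma> f\<^sub>w = (p\<^sub>w, q\<^sub>w)\<close>. Taking the adjoint of the formula for \<open>\<sigma> D\<^sub>E\<close> shows that the system of \<open>E\<close> is
  a cascade: its lower component is the system of \<open>A\<close> with input \<open>q\<close>, and its upper component is the
  system of \<open>C\<close> with input \<open>D\<^sub>*\<^sub>,\<^sub>\<gamma> p + \<gamma> m\<close>, where \<open>m\<close> is the response of the lower one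
  (\<open>state_lifting\<close>). The responses are therefore related by
  \<open>\<sigma>' y\<^sup>E = (y\<^sup>C, - \<gamma>\<^sup>* p + D\<^sub>\<gamma> m)\<close> (\<open>response_lifting\<close>), and \<open>M\<^sub>C\<^sub>,\<^sub>E f\<close> has the coordinates
  \<open>D\<^sub>*\<^sub>,\<^sub>\<gamma> p + \<gamma> m\<close> (\<open>coord_char_lifting\<close>). The theorem is the second identity for the lifting of \<open>C\<close>
  by the two-step tuple, followed by the first one for the lifting of \<open>A\<close> by \<open>A'\<close>.

  The Hilbert space theory behind this consists of the Riesz representation theorem and of the square
  roots of \<open>I - T\<^sup>*T\<close> and \<open>I - TT\<^sup>*\<close>, with their uniqueness and the relation \<open>T D\<^sub>T = D\<^sub>*\<^sub>,\<^sub>T T\<close>.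
\<close>

section \<open>Riesz representation and adjoints\<close>

definition closed_csubspace :: "'a::complex_inner set \<Rightarrow> bool" where
  "closed_csubspace X \<longleftrightarrow> complex_vector.subspace X \<and> closed X"

lemma closed_csubspace_UNIV [simp]: "closed_csubspace UNIV"
  by (simp add: closed_csubspace_def complex_vector.subspace_UNIV)

context
  fixes X :: "'a::complex_inner set"
  assumes X: "closed_csubspace X"
begin

lemma csub_0: "0 \<in> X"
  using X by (simp add: closed_csubspace_def complex_vector.subspace_0)

lemma csub_add: "x \<in> X \<Longrightarrow> y \<in> X \<Longrightarrow> x + y \<in> X"
  using X by (simp add: closed_csubspace_def complex_vector.subspace_add)

lemma csub_scaleC: "x \<in> X \<Longrightarrow> c *\<^sub>C x \<in> X"
  using X by (simp add: closed_csubspace_def complex_vector.subspace_scale)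

lemma csub_scaleR: "x \<in> X \<Longrightarrow> r *\<^sub>R x \<in> X"
  using csub_scaleC[of x "complex_of_real r"] by (simp add: scaleC_of_real)

lemma csub_minus: "x \<in> X \<Longrightarrow> - x \<in> X"
  using csub_scaleR[of x "-1"] by simp

lemma csub_diff: "x \<in> X \<Longrightarrow> y \<in> X \<Longrightarrow> x - y \<in> X"
  using csub_add[of x "- y"] csub_minus by simp

lemma csub_closed: "closed X"
  using X by (simp add: closed_csubspace_def)

lemma op_0: "bounded_op X Y T \<Longrightarrow> T 0 = 0"
  unfolding bounded_op_def by (metis add_cancel_right_right csub_0)

lemma op_scaleR: "bounded_op X Y T \<Longrightarrow> x \<in> X \<Longrightarrow> T (r *\<^sub>R x) = r *\<^sub>R T x"
  unfolding bounded_op_def by (metis scaleC_of_real)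

lemma op_diff: "bounded_op X Y T \<Longrightarrow> x \<in> X \<Longrightarrow> y \<in> X \<Longrightarrow> T (x - y) = T x - T y"
  using op_scaleR[of Y T y "-1"] csub_minus[of y] unfolding bounded_op_def
  by (metis (no_types, lifting) add_uminus_conv_diff scaleR_minus1_left)

end

lemma op_in: "bounded_op X Y T \<Longrightarrow> x \<in> X \<Longrightarrow> T x \<in> Y"
  and op_add: "bounded_op X Y T \<Longrightarrow> x \<in> X \<Longrightarrow> y \<in> X \<Longrightarrow> T (x + y) = T x + T y"
  and op_scaleC: "bounded_op X Y T \<Longrightarrow> x \<in> X \<Longrightarrow> T (c *\<^sub>C x) = c *\<^sub>C T x"
  by (simp_all add: bounded_op_def)

lemma op_mono: "bounded_op X Y T \<Longrightarrow> Y \<subseteq> Z \<Longrightarrow> bounded_op X Z T"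
  by (auto simp: bounded_op_def)

lemma op_bound:
  assumes "bounded_op X Y T"
  obtains K where "K \<ge> 0" "\<And>x. x \<in> X \<Longrightarrow> norm (T x) \<le> K * norm x"
proof -
  obtain K where K: "\<And>x. x \<in> X \<Longrightarrow> norm (T x) \<le> K * norm x"
    using assms unfolding bounded_op_def by blast
  have "norm (T x) \<le> \<bar>K\<bar> * norm x" if "x \<in> X" for x
    using K[OF that] mult_right_mono[OF abs_ge_self norm_ge_zero, of K x] by linarith
  then show thesis using that[of "\<bar>K\<bar>"] by simp
qed

lemma op_intro:
  assumes "\<And>x. x \<in> X \<Longrightarrow> T x \<in> Y"
    and "\<And>x y. x \<in> X \<Longrightarrow> y \<in> X \<Longrightarrow> T (x + y) = T x + T y"
    and "\<And>c x. x \<in> X \<Longrightarrow> T (c *\<^sub>C x) = c *\<^sub>C T x"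
    and "\<And>x. x \<in> X \<Longrightarrow> norm (T x) \<le> K * norm x"
  shows "bounded_op X Y T"
  unfolding bounded_op_def using assms by blast

lemma op_comp:
  assumes S: "bounded_op X Y S" and T: "bounded_op Y Z T"
  shows "bounded_op X Z (\<lambda>x. T (S x))"
proof -
  obtain K where K: "K \<ge> 0" "\<And>x. x \<in> X \<Longrightarrow> norm (S x) \<le> K * norm x" using op_bound[OF S] by blast
  obtain L where L: "L \<ge> 0" "\<And>y. y \<in> Y \<Longrightarrow> norm (T y) \<le> L * norm y" using op_bound[OF T] by blast
  show ?thesis
  proof (rule op_intro)
    show "norm (T (S x)) \<le> L * K * norm x" if "x \<in> X" for x
      using L(2)[OF op_in[OF S that]] mult_left_mono[OF K(2)[OF that] L(1)] by simp
  qed (simp_all add: op_in[OF S] op_in[OF T] op_add[OF S] op_add[OF T] op_scaleC[OF S] op_scaleC[OF T])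
qed

lemma op_plus:
  assumes S: "bounded_op X UNIV S" and T: "bounded_op X UNIV T"
  shows "bounded_op X UNIV (\<lambda>x. S x + T x)"
proof -
  obtain K where K: "\<And>x. x \<in> X \<Longrightarrow> norm (S x) \<le> K * norm x" using op_bound[OF S] by blast
  obtain L where L: "\<And>x. x \<in> X \<Longrightarrow> norm (T x) \<le> L * norm x" using op_bound[OF T] by blast
  show ?thesis
  proof (rule op_intro)
    show "norm (S x + T x) \<le> (K + L) * norm x" if "x \<in> X" for x
      using norm_triangle_ineq[of "S x" "T x"] K[OF that] L[OF that] by (simp add: algebra_simps)
  qed (simp_all add: op_add[OF S] op_add[OF T] op_scaleC[OF S] op_scaleC[OF T] scaleC_add_right)
qed

lemma op_uminus:
  assumes T: "bounded_op X UNIV T"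
  shows "bounded_op X UNIV (\<lambda>x. - T x)"
proof -
  obtain L where L: "\<And>x. x \<in> X \<Longrightarrow> norm (T x) \<le> L * norm x" using op_bound[OF T] by blast
  show ?thesis
    by (rule op_intro[where K=L])
      (simp_all add: L op_add[OF T] op_scaleC[OF T] complex_vector.scale_minus_right)
qed

lemma op_Pair:
  assumes S: "bounded_op X UNIV S" and T: "bounded_op X UNIV T"
  shows "bounded_op X UNIV (\<lambda>x. (S x, T x))"
proof -
  obtain K where K: "\<And>x. x \<in> X \<Longrightarrow> norm (S x) \<le> K * norm x" using op_bound[OF S] by blast
  obtain L where L: "\<And>x. x \<in> X \<Longrightarrow> norm (T x) \<le> L * norm x" using op_bound[OF T] by blast
  show ?thesis
  proof (rule op_intro)
    show "norm (S x, T x) \<le> (K + L) * norm x" if "x \<in> X" for x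
      using norm_Pair_le[of "S x" "T x"] K[OF that] L[OF that] by (simp add: algebra_simps)
  qed (simp_all add: op_add[OF S] op_add[OF T] op_scaleC[OF S] op_scaleC[OF T] scaleC_prod_def)
qed

lemma op_fst: "bounded_op (X \<times> Y) X fst" and op_snd: "bounded_op (X \<times> Y) Y snd"
  by (rule op_intro[where K=1], auto simp: scaleC_prod_def norm_fst_le)
    (rule op_intro[where K=1], auto simp: scaleC_prod_def norm_snd_le)

lemma closed_csubspace_Times:
  "closed_csubspace X \<Longrightarrow> closed_csubspace Y \<Longrightarrow> closed_csubspace (X \<times> Y)"
  by (auto simp: closed_csubspace_def complex_vector.subspace_def closed_Times scaleC_prod_def
      zero_prod_def plus_prod_def)

lemma bounded_linear_op: "bounded_op UNIV Y T \<Longrightarrow> bounded_linear T"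
  using op_scaleR[OF closed_csubspace_UNIV, of Y T] op_add[of UNIV Y T] op_bound[of UNIV Y T]
  by (metis UNIV_I bounded_linear_intro mult.commute)

lemma op_continuous:
  assumes X: "closed_csubspace X" and T: "bounded_op X Y T"
  shows "continuous_on X T"
proof -
  obtain K where K: "K \<ge> 0" "\<And>x. x \<in> X \<Longrightarrow> norm (T x) \<le> K * norm x"
    using op_bound[OF T] by blast
  have "K-lipschitz_on X T"
    using K op_diff[OF X T] csub_diff[OF X] by (intro lipschitz_onI) (metis dist_norm, simp)
  then show ?thesis by (rule lipschitz_on_continuous_on)
qed

lemma cinner_eq_Complex: "cinner x y = Complex (inner x y) (inner x (\<i> *\<^sub>C y))"
proof -
  have "cinner x (\<i> *\<^sub>C y) = - \<i> * cinner x y"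
    by (metis cinner_commute cinner_scaleC_left complex_cnj_i complex_cnj_mult)
  then have "inner x (\<i> *\<^sub>C y) = Im (cinner x y)"
    by (simp add: Re_cinner[symmetric])
  then show ?thesis by (simp add: complex_eq_iff Re_cinner)
qed

lemma inner_scaleC_i: "inner (\<i> *\<^sub>C x) y = - inner x (\<i> *\<^sub>C y)"
proof -
  have "cinner (\<i> *\<^sub>C x) y = \<i> * cinner x y" by (rule cinner_scaleC_left)
  then show ?thesis by (simp add: cinner_eq_Complex complex_eq_iff)
qed

lemma inner_scaleC_left: "inner (c *\<^sub>C x) y = inner x (cnj c *\<^sub>C y)"
proof -
  have "cinner x (cnj c *\<^sub>C y) = c * cinner x y"
    by (metis cinner_commute cinner_scaleC_left complex_cnj_cnj complex_cnj_mult)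
  then show ?thesis by (metis Re_cinner cinner_scaleC_left)
qed

text \<open>A quadratic polynomial without constant term that is nowhere negative has no linear term:
  this turns the minimality of a quadratic functional into orthogonality.\<close>

lemma linear_coefficient_zero:
  fixes a b :: real
  assumes "\<And>t. 0 \<le> 2 * t * a + t\<^sup>2 * b"
  shows "a = 0"
proof (rule ccontr)
  assume "a \<noteq> 0"
  (* The step - a s along the parabola is so short that the quadratic term cannot compensate
     the linear one. *)
  define s where "s = 1 / (1 + \<bar>b\<bar>)"
  have s: "s > 0" "s * b \<le> 1" by (auto simp: s_def field_simps)
  have "0 \<le> 2 * (- a * s) * a + (- a * s)\<^sup>2 * b" by (rule assms)
  also have "\<dots> = s * a\<^sup>2 * (s * b - 2)" by (simp add: power2_eq_square algebra_simps)
  also have "\<dots> < 0" using s \<open>a \<noteq> 0\<close> by (intro mult_pos_neg) auto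
  finally show False by simp
qed

text \<open>The representing vector minimizes \<open>\<parallel>x\<parallel>\<^sup>2 - 2 \<phi> x\<close>; a minimizing sequence is Cauchy by the
  parallelogram law.\<close>

lemma riesz_representation:
  fixes \<phi> :: "'a::{real_inner, complete_space} \<Rightarrow> real"
  assumes X: "subspace X" "closed X"
    and add: "\<And>x y. x \<in> X \<Longrightarrow> y \<in> X \<Longrightarrow> \<phi> (x + y) = \<phi> x + \<phi> y"
    and scale: "\<And>r x. x \<in> X \<Longrightarrow> \<phi> (r *\<^sub>R x) = r * \<phi> x"
    and K: "\<And>x. x \<in> X \<Longrightarrow> \<bar>\<phi> x\<bar> \<le> K * norm x"
  obtains x where "x \<in> X" "\<And>z. z \<in> X \<Longrightarrow> \<phi> z = inner z x"
proof -
  define J where "J x = (norm x)\<^sup>2 - 2 * \<phi> x" for x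
  have low: "- K\<^sup>2 \<le> J x" if "x \<in> X" for x
  proof -
    have "2 * \<phi> x \<le> 2 * (K * norm x)" using K[OF that] by linarith
    also have "\<dots> \<le> K\<^sup>2 + (norm x)\<^sup>2" using sum_squares_bound[of K "norm x"] by simp
    finally show ?thesis by (simp add: J_def)
  qed
  define m where "m = (INF x\<in>X. J x)"
  have bdd: "bdd_below (J ` X)" using low by (auto intro!: bdd_belowI)
  have ne: "X \<noteq> {}" using subspace_0[OF X(1)] by auto
  have m_le: "m \<le> J x" if "x \<in> X" for x
    unfolding m_def using bdd that by (rule cINF_lower)
  have "\<exists>x\<in>X. J x < m + inverse (real (Suc n))" for n
    using cINF_less_iff[OF ne bdd, of "m + inverse (real (Suc n))"] by (simp add: m_def)
  then obtain s where s: "\<And>n. s n \<in> X" "\<And>n. J (s n) < m + inverse (real (Suc n))"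
    by metis
  have mid: "(norm (x - y))\<^sup>2 \<le> 2 * (J x - m) + 2 * (J y - m)" if "x \<in> X" "y \<in> X" for x y
  proof -
    have h: "(1/2) *\<^sub>R (x + y) \<in> X" using that X(1) by (simp add: subspace_add subspace_scale)
    have "J ((1/2) *\<^sub>R (x + y)) = (norm (x + y))\<^sup>2 / 4 - (\<phi> x + \<phi> y)"
      using scale[of "x + y" "1/2"] add[OF that] that X(1)
      by (simp add: J_def power_divide subspace_add)
    moreover have "(norm (x + y))\<^sup>2 + (norm (x - y))\<^sup>2 = 2 * (norm x)\<^sup>2 + 2 * (norm y)\<^sup>2"
      by (simp add: power2_norm_eq_inner algebra_simps inner_commute)
    ultimately show ?thesis using m_le[OF h] by (simp add: J_def)
  qed
  have "Cauchy s"
  proof (rule CauchyI)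
    fix e :: real assume "e > 0"
    obtain N where N: "inverse (real (Suc N)) < e\<^sup>2 / 4"
      using reals_Archimedean[of "e\<^sup>2 / 4"] \<open>e > 0\<close> by auto
    have "norm (s n - s k) < e" if "n \<ge> N" "k \<ge> N" for n k
    proof -
      have "inverse (real (Suc i)) \<le> inverse (real (Suc N))" if "i \<ge> N" for i
        using that by (simp add: le_imp_inverse_le)
      then have "J (s i) - m < e\<^sup>2 / 4" if "i \<ge> N" for i
        using s(2)[of i] N that by (smt (verit))
      from this[OF that(1)] this[OF that(2)] have "(norm (s n - s k))\<^sup>2 < e\<^sup>2"
        using mid[OF s(1)[of n] s(1)[of k]] by argo
      then show ?thesis using \<open>e > 0\<close> by (simp add: power_less_imp_less_base)
    qed
    then show "\<exists>M. \<forall>m\<ge>M. \<forall>n\<ge>M. norm (s m - s n) < e" by blast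
  qed
  then obtain x where lim: "s \<longlonglongrightarrow> x"
    using Cauchy_convergent_iff convergent_def by blast
  have x: "x \<in> X" using closed_sequentially[OF X(2) _ lim] s(1) by blast
  have \<phi>_lim: "(\<lambda>n. \<phi> (s n)) \<longlonglongrightarrow> \<phi> x"
  proof (rule LIM_zero_cancel, rule Lim_null_comparison)
    have "\<phi> (s n) - \<phi> x = \<phi> (s n - x)" for n
      using add[of "s n" "(-1) *\<^sub>R x"] scale[of x "-1"] s(1)[of n] x X(1)
      by (simp add: subspace_neg)
    then show "\<forall>\<^sub>F n in sequentially. norm (\<phi> (s n) - \<phi> x) \<le> K * norm (s n - x)"
      using K[OF subspace_diff[OF X(1) s(1) x]] by simp
    show "(\<lambda>n. K * norm (s n - x)) \<longlonglongrightarrow> 0"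
      using tendsto_mult[OF tendsto_const[of K] tendsto_norm[OF LIM_zero[OF lim]]] by simp
  qed
  have "J x \<le> m"
  proof (rule LIMSEQ_le)
    show "(\<lambda>n. J (s n)) \<longlonglongrightarrow> J x" unfolding J_def by (intro tendsto_intros lim \<phi>_lim)
    show "(\<lambda>n. m + inverse (real (Suc n))) \<longlonglongrightarrow> m"
      using LIMSEQ_inverse_real_of_nat_add[of m] by simp
    show "\<exists>N. \<forall>n\<ge>N. J (s n) \<le> m + inverse (real (Suc n))" using s(2) by (meson less_imp_le)
  qed
  have "inner z x - \<phi> z = 0" if z: "z \<in> X" for z
  proof (rule linear_coefficient_zero)
    fix t :: real
    have le: "J x \<le> J (x + t *\<^sub>R z)"
      using \<open>J x \<le> m\<close> m_le[of "x + t *\<^sub>R z"] x z X(1) by (simp add: subspace_add subspace_scale)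
    have "(norm (x + t *\<^sub>R z))\<^sup>2 = (norm x)\<^sup>2 + 2 * t * inner z x + t\<^sup>2 * (norm z)\<^sup>2"
      unfolding power2_norm_eq_inner
      by (simp add: inner_add_left inner_add_right inner_commute power2_eq_square algebra_simps)
    then have "J (x + t *\<^sub>R z) = J x + (2 * t * (inner z x - \<phi> z) + t\<^sup>2 * (norm z)\<^sup>2)"
      using add[of x "t *\<^sub>R z"] scale[OF z, of t] x z X(1)
      by (simp add: J_def subspace_scale algebra_simps)
    then show "0 \<le> 2 * t * (inner z x - \<phi> z) + t\<^sup>2 * (norm z)\<^sup>2" using le by simp
  qed
  then show thesis using that[OF x] by simp
qed

lemma adj_exists:
  fixes T :: "'a::complex_hilbert \<Rightarrow> 'b::complex_inner"
  assumes X: "closed_csubspace X" and T: "bounded_op X Y T"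
  obtains x where "x \<in> X" "\<And>z. z \<in> X \<Longrightarrow> inner (T z) y = inner z x"
proof -
  obtain K where K: "K \<ge> 0" "\<And>x. x \<in> X \<Longrightarrow> norm (T x) \<le> K * norm x"
    using op_bound[OF T] by blast
  show thesis
  proof (rule riesz_representation[of X "\<lambda>z. inner (T z) y" "K * norm y"])
    show "subspace X"
      by (simp add: subspace_def csub_0[OF X] csub_add[OF X] csub_scaleR[OF X])
    show "\<bar>inner (T x) y\<bar> \<le> K * norm y * norm x" if "x \<in> X" for x
    proof -
      have "\<bar>inner (T x) y\<bar> \<le> norm (T x) * norm y" by (rule Cauchy_Schwarz_ineq2)
      also have "\<dots> \<le> K * norm x * norm y" using K(2)[OF that] by (simp add: mult_right_mono)
      finally show ?thesis by (simp add: ac_simps)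
    qed
  qed (use that csub_closed[OF X] op_add[OF T] op_scaleR[OF X T] in \<open>auto simp: inner_add_left\<close>)
qed

context
  fixes X :: "'a::complex_hilbert set" and Y :: "'b::complex_inner set" and T
  assumes X: "closed_csubspace X" and T: "bounded_op X Y T"
begin

text \<open>For a complex linear map the real inner product determines the adjoint.\<close>

lemma adj_unique:
  assumes x: "x \<in> X" "\<And>z. z \<in> X \<Longrightarrow> inner (T z) y = inner z x"
  shows "adj X T y = x"
  unfolding adj_def
proof (rule the_equality)
  have "cinner (T z) y = cinner z x" if z: "z \<in> X" for z
  proof -
    have "inner (T (\<i> *\<^sub>C z)) y = inner (\<i> *\<^sub>C z) x" using x csub_scaleC[OF X z] by blast
    then show ?thesis using x(2)[OF z]
      by (simp add: op_scaleC[OF T z] inner_scaleC_i cinner_eq_Complex)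
  qed
  then show "x \<in> X \<and> (\<forall>z\<in>X. cinner (T z) y = cinner z x)" using x by blast
  fix x' assume x': "x' \<in> X \<and> (\<forall>z\<in>X. cinner (T z) y = cinner z x')"
  have "x' - x \<in> X" using x x' csub_diff[OF X] by blast
  then have "inner (x' - x) x' = inner (x' - x) x"
    using x(2) x' by (metis Re_cinner)
  then have "inner (x' - x) (x' - x) = 0" by (simp add: inner_diff_right)
  then show "x' = x" by simp
qed

lemma adj_in: "adj X T y \<in> X"
  and adj_inner: "z \<in> X \<Longrightarrow> inner (T z) y = inner z (adj X T y)"
proof -
  obtain x where "x \<in> X" "\<And>z. z \<in> X \<Longrightarrow> inner (T z) y = inner z x"
    using adj_exists[OF X T] by blast
  then show "adj X T y \<in> X" "z \<in> X \<Longrightarrow> inner (T z) y = inner z (adj X T y)"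
    using adj_unique by metis+
qed

lemma adj_inner_left: "z \<in> X \<Longrightarrow> inner (adj X T y) z = inner y (T z)"
  using adj_inner[of z y] by (simp add: inner_commute)

text \<open>The bound is inherited because \<open>\<parallel>T\<^sup>* y\<parallel>\<^sup>2 = \<langle>T T\<^sup>* y, y\<rangle>\<close>.\<close>

lemma adj_norm:
  assumes K: "K \<ge> 0" "\<And>x. x \<in> X \<Longrightarrow> norm (T x) \<le> K * norm x"
  shows "norm (adj X T y) \<le> K * norm y"
proof (cases "adj X T y = 0")
  case False
  have "norm (adj X T y) * norm (adj X T y) = inner (T (adj X T y)) y"
    using adj_inner[OF adj_in] by (simp add: dot_square_norm power2_eq_square)
  also have "\<dots> \<le> norm (T (adj X T y)) * norm y" by (rule norm_cauchy_schwarz)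
  also have "\<dots> \<le> K * norm (adj X T y) * norm y" using K(2)[OF adj_in] by (simp add: mult_right_mono)
  also have "\<dots> = norm (adj X T y) * (K * norm y)" by simp
  finally show ?thesis using False by (simp add: mult_le_cancel_left)
qed (use K in simp)

lemma adj_op: "bounded_op UNIV X (adj X T)"
proof -
  obtain K where K: "K \<ge> 0" "\<And>x. x \<in> X \<Longrightarrow> norm (T x) \<le> K * norm x"
    using op_bound[OF T] by blast
  have "adj X T (x + y) = adj X T x + adj X T y" for x y
    by (rule adj_unique) (auto simp: csub_add[OF X] adj_in adj_inner inner_add_right)
  moreover have "adj X T (c *\<^sub>C x) = c *\<^sub>C adj X T x" for c x
  proof (rule adj_unique)
    fix z assume z: "z \<in> X"
    show "inner (T z) (c *\<^sub>C x) = inner z (c *\<^sub>C adj X T x)"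
      using adj_inner[OF csub_scaleC[OF X z], of "cnj c" x]
      by (simp add: op_scaleC[OF T z] inner_scaleC_left)
  qed (simp add: csub_scaleC[OF X] adj_in)
  ultimately show ?thesis
    using adj_in adj_norm[OF K] by (auto simp: bounded_op_def)
qed

end

text \<open>The adjoint of an inclusion is the orthogonal projection.\<close>

abbreviation proj :: "'a::complex_hilbert set \<Rightarrow> 'a \<Rightarrow> 'a" where
  "proj X \<equiv> adj X (\<lambda>x. x)"

lemma inclusion_op: "bounded_op X X (\<lambda>x. x)"
  by (auto simp: bounded_op_def intro: exI[of _ 1])

context
  fixes X :: "'a::complex_hilbert set"
  assumes X: "closed_csubspace X"
begin

lemmas proj_in = adj_in[OF X inclusion_op]
  and proj_inner = adj_inner[OF X inclusion_op, symmetric]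
  and proj_op = adj_op[OF X inclusion_op]

lemma proj_id: "x \<in> X \<Longrightarrow> proj X x = x"
  by (rule adj_unique[OF X inclusion_op]) auto

lemma proj_orth: "z \<in> X \<Longrightarrow> inner z (v - proj X v) = 0"
  by (simp add: inner_diff_right proj_inner)

lemma proj_norm: "norm (proj X v) \<le> norm v"
  using adj_norm[OF X inclusion_op, of 1] by simp

end

section \<open>Square roots and defect operators\<close>

lemma op_restrict: "bounded_op X Y T \<Longrightarrow> Z \<subseteq> X \<Longrightarrow> bounded_op Z Y T"
  unfolding bounded_op_def by (meson subsetD)

instance complex_hilbert \<subseteq> banach ..

text \<open>A fixed point \<open>Y\<close> of this iteration satisfies \<open>(I - Y)\<^sup>2 = I - K\<close>. It arises from
  \<open>K\<close> by sums, products and norm limits, so it commutes with whatever \<open>K\<close> commutes with.\<close>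

primrec root_iter :: "('a::real_normed_vector \<Rightarrow>\<^sub>L 'a) \<Rightarrow> nat \<Rightarrow> 'a \<Rightarrow>\<^sub>L 'a" where
  "root_iter K 0 = 0"
| "root_iter K (Suc n) = (1/2) *\<^sub>R (K + (root_iter K n o\<^sub>L root_iter K n))"

definition root_lim :: "('a::real_normed_vector \<Rightarrow>\<^sub>L 'a) \<Rightarrow> 'a \<Rightarrow>\<^sub>L 'a" where
  "root_lim K = lim (root_iter K)"

text \<open>The same iteration with the number 1 in place of \<open>K\<close> majorizes both the iterates
  and their increments, and it increases towards 1.\<close>

primrec root_bound :: "nat \<Rightarrow> real" where
  "root_bound 0 = 0"
| "root_bound (Suc n) = (1 + (root_bound n)\<^sup>2) / 2"

lemma root_bound_range: "0 \<le> root_bound n \<and> root_bound n \<le> 1"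
  by (induction n) (auto simp: power_le_one)

lemma root_bound_Suc: "root_bound n \<le> root_bound (Suc n)"
proof -
  have "root_bound (Suc n) - root_bound n = (1 - root_bound n)\<^sup>2 / 2"
    by (simp add: power2_eq_square field_simps)
  then show ?thesis by (smt (verit) zero_le_power2 divide_nonneg_nonneg)
qed

lemma Cauchy_root_bound: "Cauchy root_bound"
proof -
  have "incseq root_bound" by (rule incseq_SucI) (rule root_bound_Suc)
  then have "convergent root_bound"
    using incseq_convergent[of root_bound 1] root_bound_range by (metis convergentI)
  then show ?thesis by (simp add: Cauchy_convergent_iff)
qed

context
  fixes K :: "'a::banach \<Rightarrow>\<^sub>L 'a"
  assumes K: "norm K \<le> 1"
begin

lemma norm_root_iter: "norm (root_iter K n) \<le> root_bound n"
proof (induction n)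
  case (Suc n)
  have "norm (root_iter K n o\<^sub>L root_iter K n) \<le> (root_bound n)\<^sup>2"
    using norm_blinfun_compose[of "root_iter K n" "root_iter K n"]
      mult_mono[OF Suc Suc] root_bound_range[of n] by (simp add: power2_eq_square)
  then show ?case
    using norm_triangle_ineq[of K "root_iter K n o\<^sub>L root_iter K n"] K by simp
qed simp

lemma norm_root_iter_Suc:
  "norm (root_iter K (Suc n) - root_iter K n) \<le> root_bound (Suc n) - root_bound n"
proof (induction n)
  case (Suc n)
  define Y Z where "Y = root_iter K (Suc n)" and "Z = root_iter K n"
  define b c where "b = root_bound (Suc n)" and "c = root_bound n"
  have IH: "norm (Y - Z) \<le> b - c" using Suc by (simp add: Y_def Z_def b_def c_def)
  have n: "norm Y \<le> b" "norm Z \<le> c" "0 \<le> b" "0 \<le> c"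
    unfolding Y_def Z_def b_def c_def using norm_root_iter root_bound_range by blast+
  have "root_iter K (Suc (Suc n)) - root_iter K (Suc n)
      = (1/2) *\<^sub>R ((K + (Y o\<^sub>L Y)) - (K + (Z o\<^sub>L Z)))"
    unfolding Y_def Z_def scaleR_diff_right by simp
  also have "\<dots> = (1/2) *\<^sub>R ((Y o\<^sub>L (Y - Z)) + ((Y - Z) o\<^sub>L Z))"
    by (rule blinfun_eqI) (simp add: blinfun.bilinear_simps)
  finally have "norm (root_iter K (Suc (Suc n)) - root_iter K (Suc n))
      \<le> (norm (Y o\<^sub>L (Y - Z)) + norm ((Y - Z) o\<^sub>L Z)) / 2"
    using norm_triangle_ineq[of "Y o\<^sub>L (Y - Z)" "(Y - Z) o\<^sub>L Z"] by simp
  also have "\<dots> \<le> (norm Y * norm (Y - Z) + norm (Y - Z) * norm Z) / 2"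
    using norm_blinfun_compose[of Y "Y - Z"] norm_blinfun_compose[of "Y - Z" Z] by simp
  also have "\<dots> \<le> (b * (b - c) + (b - c) * c) / 2"
    using mult_mono[OF n(1) IH n(3)] mult_mono[OF IH n(2)] IH n norm_ge_zero[of "Y - Z"]
    by (smt (verit) divide_right_mono norm_ge_zero)
  also have "\<dots> = (b\<^sup>2 - c\<^sup>2) / 2" by (simp add: power2_eq_square algebra_simps)
  also have "\<dots> = root_bound (Suc (Suc n)) - root_bound (Suc n)"
    unfolding root_bound.simps(2)[of "Suc n"] root_bound.simps(2)[of n] b_def[symmetric]
      c_def[symmetric] by (simp add: b_def c_def field_simps)
  finally show ?case .
qed (use K in simp)

lemma root_iter_lim: "root_iter K \<longlonglongrightarrow> root_lim K"
proof -
  have step: "norm (root_iter K (n + k) - root_iter K n) \<le> root_bound (n + k) - root_bound n" for n k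
  proof (induction k)
    case (Suc k)
    show ?case
      using norm_root_iter_Suc[of "n + k"] Suc
        norm_triangle_ineq[of "root_iter K (Suc (n + k)) - root_iter K (n + k)"
          "root_iter K (n + k) - root_iter K n"]
      by (simp del: root_iter.simps root_bound.simps)
  qed simp
  have le: "dist (root_iter K m) (root_iter K n) \<le> dist (root_bound m) (root_bound n)" for m n
  proof (cases "n \<le> m")
    case True
    then show ?thesis using step[of n "m - n"] by (auto simp: dist_norm)
  next
    case False
    then show ?thesis using step[of m "n - m"] by (auto simp: dist_norm norm_minus_commute)
  qed
  have "Cauchy (root_iter K)"
    using Cauchy_root_bound unfolding Cauchy_def by (metis le order.strict_trans1)
  then show ?thesis
    unfolding root_lim_def using Cauchy_convergent_iff convergent_LIMSEQ_iff by metis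
qed

lemma norm_root_lim: "norm (root_lim K) \<le> 1"
  by (rule LIMSEQ_le_const2[OF tendsto_norm[OF root_iter_lim]])
    (meson norm_root_iter root_bound_range order_trans)

lemma root_iter_apply_lim: "(\<lambda>n. root_iter K n x) \<longlonglongrightarrow> root_lim K x"
  by (intro blinfun.tendsto root_iter_lim tendsto_const)

lemma root_lim_fixpoint: "root_lim K (root_lim K x) = 2 *\<^sub>R root_lim K x - K x"
proof (rule LIMSEQ_unique)
  show "(\<lambda>n. root_iter K n (root_iter K n x)) \<longlonglongrightarrow> root_lim K (root_lim K x)"
    by (intro blinfun.tendsto root_iter_lim tendsto_const)
  have "root_iter K n (root_iter K n x) = 2 *\<^sub>R root_iter K (Suc n) x - K x" for n
    by (simp add: blinfun.bilinear_simps)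
  then show "(\<lambda>n. root_iter K n (root_iter K n x)) \<longlonglongrightarrow> 2 *\<^sub>R root_lim K x - K x"
    using tendsto_diff[OF tendsto_scaleR[OF tendsto_const[of 2]
      LIMSEQ_Suc[OF root_iter_apply_lim[of x]]] tendsto_const[of "K x"]] by (simp only:)
qed

end

text \<open>The root inherits every commutation relation, since all iterates do.\<close>

lemma root_lim_intertwine:
  fixes K :: "'a::banach \<Rightarrow>\<^sub>L 'a"
    and K' :: "'b::banach \<Rightarrow>\<^sub>L 'b"
  assumes K: "norm K \<le> 1" "norm K' \<le> 1"
    and T: "bounded_linear T" "\<And>x. T (K x) = K' (T x)"
  shows "T (root_lim K x) = root_lim K' (T x)"
proof (rule LIMSEQ_unique)
  have "T (root_iter K n x) = root_iter K' n (T x)" for n x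
    by (induction n arbitrary: x)
      (simp_all add: T bounded_linear.linear[OF T(1)] linear_0 linear_add linear_scale
        blinfun.bilinear_simps)
  then show "(\<lambda>n. root_iter K' n (T x)) \<longlonglongrightarrow> T (root_lim K x)"
    using bounded_linear.tendsto[OF T(1) root_iter_apply_lim[OF K(1)]] by simp
qed (rule root_iter_apply_lim[OF K(2)])

lemma root_lim_symmetric:
  fixes K :: "'a::{real_inner, banach} \<Rightarrow>\<^sub>L 'a"
  assumes K: "norm K \<le> 1" and sym: "\<And>x y. inner (K x) y = inner x (K y)"
  shows "inner (root_lim K x) y = inner x (root_lim K y)"
proof (rule LIMSEQ_unique)
  have "inner (root_iter K n x) y = inner x (root_iter K n y)" for n x y
    by (induction n arbitrary: x y) (simp_all add: sym blinfun.bilinear_simps inner_simps)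
  then show "(\<lambda>n. inner x (root_iter K n y)) \<longlonglongrightarrow> inner (root_lim K x) y"
    using tendsto_inner[OF root_iter_apply_lim[OF K] tendsto_const, of x y] by simp
qed (intro tendsto_intros root_iter_apply_lim[OF K])

lemma bounded_linear_scaleC: "bounded_linear (\<lambda>x::'a::complex_inner. c *\<^sub>C x)"
  by (rule bounded_linear_intro[of _ "cmod c"])
    (simp_all add: scaleC_add_right norm_scaleC scaleC_scaleC mult.commute flip: scaleC_of_real)

text \<open>Polarization: a real quadratic form belongs to a symmetric operator.\<close>

lemma positive_op_symmetric:
  assumes X: "closed_csubspace X" and P: "positive_op X P" and x: "x \<in> X" and y: "y \<in> X"
  shows "inner (P x) y = inner x (P y)"
proof -
  have op: "bounded_op X X P" using P by (simp add: positive_op_def)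
  have Im: "inner (P z) (\<i> *\<^sub>C z) = 0" if "z \<in> X" for z
    using P that by (simp add: positive_op_def cinner_eq_Complex)
  define y' where "y' = \<i> *\<^sub>C y"
  have y': "y' \<in> X" "\<i> *\<^sub>C y' = - y"
    using csub_scaleC[OF X y] scaleC_of_real[of "-1" y] by (simp_all add: y'_def scaleC_scaleC)
  have "inner (P (x + y')) (\<i> *\<^sub>C (x + y')) = 0" by (intro Im csub_add[OF X] x y')
  then have "inner (P x) (\<i> *\<^sub>C y') + inner (P y') (\<i> *\<^sub>C x) = 0"
    using Im[OF x] Im[OF y'(1)] by (simp add: op_add[OF op x y'(1)] scaleC_add_right inner_simps)
  then have "inner (P x) y = inner (P y') (\<i> *\<^sub>C x)" by (simp add: y')
  also have "P y' = \<i> *\<^sub>C P y" unfolding y'_def by (rule op_scaleC[OF op y])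
  also have "inner (\<i> *\<^sub>C P y) (\<i> *\<^sub>C x) = inner (P y) x"
    by (simp add: inner_scaleC_left scaleC_scaleC scaleC_of_real[of 1, simplified])
  finally show ?thesis by (simp add: inner_commute)
qed

text \<open>This is the Cauchy-Schwarz inequality for the semidefinite form of \<open>P\<close>, in its degenerate case.\<close>

lemma positive_op_kernel:
  assumes X: "closed_csubspace X" and P: "positive_op X P" and y: "y \<in> X" "inner (P y) y = 0"
  shows "P y = 0"
proof -
  have op: "bounded_op X X P" using P by (simp add: positive_op_def)
  have Py: "P y \<in> X" by (rule op_in[OF op y(1)])
  have "inner (P y) (P y) = 0"
  proof (rule linear_coefficient_zero)
    fix t :: real
    have t: "t *\<^sub>R P y \<in> X" by (rule csub_scaleR[OF X Py])
    have "0 \<le> inner (P (y + t *\<^sub>R P y)) (y + t *\<^sub>R P y)"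
      using P csub_add[OF X y(1) t] by (simp add: positive_op_def Re_cinner)
    also have "\<dots> = 2 * t * inner (P y) (P y) + t\<^sup>2 * inner (P (P y)) (P y)"
      using positive_op_symmetric[OF X P Py y(1)] y(2)
      by (simp add: op_add[OF op y(1) t] op_scaleR[OF X op Py] inner_simps power2_eq_square
          algebra_simps)
    finally show "0 \<le> 2 * t * inner (P y) (P y) + t\<^sup>2 * inner (P (P y)) (P y)" .
  qed
  then show ?thesis by simp
qed

definition defect_root :: "'a::complex_inner set \<Rightarrow> ('a \<Rightarrow> 'a) \<Rightarrow> ('a \<Rightarrow> 'a) \<Rightarrow> bool" where
  "defect_root X K P \<longleftrightarrow> positive_op X P \<and> (\<forall>x\<in>X. P (P x) = x - K x)"

text \<open>The root of \<open>I - K\<close> on a subspace is obtained from the iteration on the whole space, applied to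
  \<open>K\<close> composed with the projection onto that subspace.\<close>

locale symmetric_contraction =
  fixes X :: "'a::complex_hilbert set" and K
  assumes X: "closed_csubspace X" and op: "bounded_op X X K"
    and sym: "\<And>x y. x \<in> X \<Longrightarrow> y \<in> X \<Longrightarrow> inner (K x) y = inner x (K y)"
    and contr: "\<And>x. x \<in> X \<Longrightarrow> norm (K x) \<le> norm x"
begin

definition "ext = Blinfun (\<lambda>v. K (proj X v))"

lemma ext_apply: "ext v = K (proj X v)"
  using bounded_linear_op[OF op_comp[OF proj_op[OF X] op]]
  by (simp add: ext_def bounded_linear_Blinfun_apply)

lemma norm_ext: "norm ext \<le> 1"
  by (rule norm_blinfun_bound)
    (use order_trans[OF contr[OF proj_in[OF X]] proj_norm[OF X]] in \<open>simp_all add: ext_apply\<close>)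

definition "psqrt x = x - root_lim ext x"

lemma proj_symmetric: "inner (proj X x) y = inner x (proj X y)"
  using proj_inner[OF X proj_in[OF X, of x], of y] proj_inner[OF X proj_in[OF X, of y], of x]
  by (simp add: inner_commute)

lemma ext_symmetric: "inner (ext x) y = inner x (ext y)"
proof -
  have "inner (ext x) y = inner (K (proj X x)) (proj X y)"
    by (simp add: ext_apply proj_inner[OF X] op_in[OF op] proj_in[OF X])
  also have "\<dots> = inner (proj X x) (K (proj X y))" by (simp add: sym proj_in[OF X])
  also have "\<dots> = inner x (ext y)"
    by (simp add: ext_apply proj_symmetric proj_id[OF X] op_in[OF op] proj_in[OF X])
  finally show ?thesis .
qed

text \<open>The root commutes with the projection onto \<open>X\<close>, since the extension of \<open>K\<close> does.\<close>

lemma root_in: "x \<in> X \<Longrightarrow> psqrt x \<in> X"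
proof -
  assume x: "x \<in> X"
  have "proj X (root_lim ext x) = root_lim ext (proj X x)"
    by (rule root_lim_intertwine[OF norm_ext norm_ext])
      (simp_all add: bounded_linear_op[OF proj_op[OF X]] ext_apply proj_id[OF X] proj_in[OF X]
        op_in[OF op])
  then have "root_lim ext x \<in> X" using proj_in[OF X] by (metis proj_id[OF X x])
  then show ?thesis using x by (simp add: psqrt_def csub_diff[OF X])
qed

text \<open>The iteration is real linear; complex linearity is another commutation relation.\<close>

lemma root_scaleC: "psqrt (c *\<^sub>C x) = c *\<^sub>C psqrt x"
proof -
  have "c *\<^sub>C root_lim ext x = root_lim ext (c *\<^sub>C x)"
    by (rule root_lim_intertwine[OF norm_ext norm_ext bounded_linear_scaleC])
      (simp add: ext_apply op_scaleC[OF proj_op[OF X]] op_scaleC[OF op] proj_in[OF X])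
  then show ?thesis
    by (simp add: psqrt_def complex_vector.scale_right_diff_distrib)
qed

lemma root_op: "bounded_op X X psqrt"
proof -
  have "norm (psqrt x) \<le> 2 * norm x" for x
  proof -
    have "norm (root_lim ext x) \<le> norm (root_lim ext) * norm x" by (rule norm_blinfun)
    also have "\<dots> \<le> norm x" using norm_root_lim[OF norm_ext] by (simp add: mult_left_le_one_le)
    finally show ?thesis using norm_triangle_ineq4[of x "root_lim ext x"] by (simp add: psqrt_def)
  qed
  then show ?thesis
    by (auto simp: bounded_op_def root_in root_scaleC) (simp add: psqrt_def blinfun.bilinear_simps)
qed

lemma root_positive: "positive_op X psqrt"
proof -
  have "0 \<le> inner (psqrt x) x" for x
  proof -
    have "inner (root_lim ext x) x \<le> norm (root_lim ext x) * norm x" by (rule norm_cauchy_schwarz)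
    also have "\<dots> \<le> norm (root_lim ext) * norm x * norm x"
      by (intro mult_right_mono norm_blinfun) simp
    also have "\<dots> \<le> 1 * norm x * norm x"
      by (intro mult_right_mono norm_root_lim[OF norm_ext]) simp_all
    finally show ?thesis by (simp add: psqrt_def inner_diff_left dot_square_norm power2_eq_square)
  qed
  moreover have "inner (psqrt x) (\<i> *\<^sub>C x) = 0" for x
  proof -
    have "inner (psqrt x) (\<i> *\<^sub>C x) = - inner (psqrt (\<i> *\<^sub>C x)) x"
      by (simp add: root_scaleC inner_scaleC_i)
    also have "\<dots> = - inner (\<i> *\<^sub>C x) (psqrt x)"
      using root_lim_symmetric[OF norm_ext ext_symmetric, of "\<i> *\<^sub>C x" x]
      by (simp add: psqrt_def inner_simps)
    finally show ?thesis by (simp add: inner_commute)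
  qed
  ultimately show ?thesis
    by (simp add: positive_op_def root_op cinner_eq_Complex)
qed

lemma root_square: "x \<in> X \<Longrightarrow> psqrt (psqrt x) = x - K x"
  by (simp add: psqrt_def blinfun.bilinear_simps root_lim_fixpoint[OF norm_ext] ext_apply
      proj_id[OF X] scaleR_2)

text \<open>Any other positive root \<open>P\<close> commutes with \<open>I - P\<^sup>2\<close>, hence with \<open>psqrt\<close>. For
  \<open>y = P x - psqrt x\<close> this gives \<open>\<langle>P y, y\<rangle> + \<langle>psqrt y, y\<rangle> = \<langle>P\<^sup>2 x - psqrt\<^sup>2 x, y\<rangle> = 0\<close>, so \<open>y\<close> lies in both
  kernels, and \<open>\<parallel>y\<parallel>\<^sup>2 = \<langle>x, P y - psqrt y\<rangle> = 0\<close>.\<close>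

lemma root_unique:
  assumes P: "defect_root X K P" and x: "x \<in> X"
  shows "P x = psqrt x"
proof -
  have pos: "positive_op X P" and sq: "\<And>x. x \<in> X \<Longrightarrow> P (P x) = x - K x"
    using P by (auto simp: defect_root_def)
  have Pop: "bounded_op X X P" using pos by (simp add: positive_op_def)
  have PK: "P (K z) = K (P z)" if z: "z \<in> X" for z
  proof -
    have Pz: "P z \<in> X" by (rule op_in[OF Pop z])
    have "P (P (P z)) = P z - P (K z)"
      using op_diff[OF X Pop z op_in[OF op z]] by (simp add: sq[OF z])
    then show ?thesis using sq[OF Pz] by simp
  qed
  note lin = bounded_linear_op[OF op_comp[OF proj_op[OF X] Pop]]
  have comm: "P (psqrt x) = psqrt (P x)"
  proof -
    have "P (proj X (root_lim ext x)) = root_lim ext (P (proj X x))"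
      by (rule root_lim_intertwine[OF norm_ext norm_ext lin])
        (simp add: ext_apply proj_id[OF X] proj_in[OF X] op_in[OF op] op_in[OF Pop] PK)
    moreover have "root_lim ext x \<in> X"
      using csub_diff[OF X x root_in[OF x]] by (simp add: psqrt_def)
    ultimately show ?thesis
      using x by (simp add: psqrt_def proj_id[OF X] op_diff[OF X Pop])
  qed
  define y where "y = P x - psqrt x"
  have Px: "P x \<in> X" and rx: "psqrt x \<in> X" using x op_in[OF Pop] root_in by auto
  then have y: "y \<in> X" by (simp add: y_def csub_diff[OF X])
  have "P y + psqrt y = 0"
    using sq[OF x] root_square[OF x]
    by (simp add: y_def op_diff[OF X Pop Px rx] op_diff[OF X root_op Px rx] comm)
  then have "inner (P y) y + inner (psqrt y) y = 0"
    by (simp flip: inner_add_left)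
  moreover have "0 \<le> inner (P y) y" "0 \<le> inner (psqrt y) y"
    using pos root_positive y by (simp_all add: positive_op_def Re_cinner)
  ultimately have "inner (P y) y = 0" "inner (psqrt y) y = 0" by linarith+
  then have "P y = 0" "psqrt y = 0"
    using positive_op_kernel[OF X _ y] pos root_positive by blast+
  moreover have "inner y y = inner x (P y) - inner x (psqrt y)"
    using positive_op_symmetric[OF X pos x y] positive_op_symmetric[OF X root_positive x y]
    by (simp add: y_def inner_diff_left)
  ultimately have "y = 0" by simp
  then show ?thesis by (simp add: y_def)
qed

lemma defect_root_sqrt_op: "defect_root X K (sqrt_op X (\<lambda>x. x - K x))"
  unfolding sqrt_op_def defect_root_def
  by (rule someI[of _ psqrt]) (simp add: root_positive root_square)

end

lemma defect_root_intertwine: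
  assumes XY: "symmetric_contraction X K" "symmetric_contraction Y K'"
    and P: "defect_root X K P" "defect_root Y K' P'"
    and T: "bounded_op X Y T" "\<And>x. x \<in> X \<Longrightarrow> T (K x) = K' (T x)"
    and x: "x \<in> X"
  shows "T (P x) = P' (T x)"
proof -
  interpret X: symmetric_contraction X K by fact
  interpret Y: symmetric_contraction Y K' by fact
  note lin = bounded_linear_op[OF op_comp[OF proj_op[OF X.X] T(1)]]
  have "T (proj X (root_lim X.ext x)) = root_lim Y.ext (T (proj X x))"
    by (rule root_lim_intertwine[OF X.norm_ext Y.norm_ext lin])
      (simp add: X.ext_apply Y.ext_apply proj_id[OF X.X] proj_id[OF Y.X] proj_in[OF X.X]
        op_in[OF X.op] op_in[OF T(1)] T(2))
  moreover have "root_lim X.ext x \<in> X"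
    using csub_diff[OF X.X x X.root_in[OF x]] by (simp add: X.psqrt_def)
  ultimately have "T (X.psqrt x) = Y.psqrt (T x)"
    using x by (simp add: X.psqrt_def Y.psqrt_def proj_id[OF X.X] op_diff[OF X.X T(1)])
  then show ?thesis
    using X.root_unique[OF P(1) x] Y.root_unique[OF P(2) op_in[OF T(1) x]] by simp
qed

text \<open>The domain and the codomain are subspaces because the parameters \<open>\<gamma>\<close> of liftings act between defect
  spaces.\<close>

locale contraction_op =
  fixes X :: "'a::complex_hilbert set" and Y :: "'b::complex_hilbert set" and T
  assumes X: "closed_csubspace X" and Y: "closed_csubspace Y" and contraction: "contraction X Y T"
begin

lemma op: "bounded_op X Y T" and norm_le: "x \<in> X \<Longrightarrow> norm (T x) \<le> norm x"
  using contraction by (auto simp: contraction_def)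

abbreviation "Ta \<equiv> adj X T"
abbreviation "D \<equiv> defect X T"
abbreviation "Ds \<equiv> codefect X Y T"
abbreviation "DX \<equiv> defect_space X T"
abbreviation "DY \<equiv> codefect_space X Y T"

lemmas Ta_in = adj_in[OF X op]
  and Ta_inner = adj_inner[OF X op]
  and Ta_inner_left = adj_inner_left[OF X op]
  and Ta_op = adj_op[OF X op]

lemma Ta_norm: "norm (Ta y) \<le> norm y"
  using adj_norm[OF X op, of 1] norm_le by simp

lemma sc_X: "symmetric_contraction X (\<lambda>x. Ta (T x))"
proof -
  have le: "norm (Ta (T x)) \<le> norm x" if "x \<in> X" for x
    using Ta_norm[of "T x"] norm_le[OF that] by linarith
  have "bounded_op X X (\<lambda>x. Ta (T x))"
    using le by (auto simp: bounded_op_def Ta_in op_add[OF op] op_scaleC[OF op] op_add[OF Ta_op]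
        op_scaleC[OF Ta_op] intro!: exI[of _ 1])
  then show ?thesis
    using le by unfold_locales (simp_all add: X Ta_inner_left Ta_inner[symmetric])
qed

lemma sc_Y: "symmetric_contraction Y (\<lambda>y. T (Ta y))"
proof -
  have le: "norm (T (Ta y)) \<le> norm y" for y
    using Ta_norm[of y] norm_le[OF Ta_in, of y] by linarith
  have "bounded_op Y Y (\<lambda>y. T (Ta y))"
    using le by (auto simp: bounded_op_def Ta_in op_add[OF op] op_scaleC[OF op] op_add[OF Ta_op]
        op_scaleC[OF Ta_op] op_in[OF op] intro!: exI[of _ 1])
  then show ?thesis
    using le by unfold_locales (simp_all add: Y Ta_in Ta_inner Ta_inner_left[symmetric])
qed

lemma root_D: "defect_root X (\<lambda>x. Ta (T x)) D"
  unfolding defect_def by (rule symmetric_contraction.defect_root_sqrt_op[OF sc_X])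

lemma root_Ds: "defect_root Y (\<lambda>y. T (Ta y)) Ds"
  unfolding codefect_def by (rule symmetric_contraction.defect_root_sqrt_op[OF sc_Y])

lemma D_op: "bounded_op X X D" and D_square: "x \<in> X \<Longrightarrow> D (D x) = x - Ta (T x)"
  using root_D by (auto simp: defect_root_def positive_op_def)

lemma Ds_op: "bounded_op Y Y Ds" and Ds_square: "y \<in> Y \<Longrightarrow> Ds (Ds y) = y - T (Ta y)"
  using root_Ds by (auto simp: defect_root_def positive_op_def)

lemma D_sym: "x \<in> X \<Longrightarrow> z \<in> X \<Longrightarrow> inner (D x) z = inner x (D z)"
  using root_D positive_op_symmetric[OF X] by (auto simp: defect_root_def)

lemma Ds_sym: "x \<in> Y \<Longrightarrow> z \<in> Y \<Longrightarrow> inner (Ds x) z = inner x (Ds z)"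
  using root_Ds positive_op_symmetric[OF Y] by (auto simp: defect_root_def)

text \<open>\<open>T\<close> intertwines \<open>T\<^sup>*T\<close> with \<open>TT\<^sup>*\<close>, hence also the roots.\<close>

lemma T_D: "x \<in> X \<Longrightarrow> T (D x) = Ds (T x)"
  by (rule defect_root_intertwine[OF sc_X sc_Y root_D root_Ds op]) auto

lemma Ta_Ds: "y \<in> Y \<Longrightarrow> Ta (Ds y) = D (Ta y)"
  by (rule defect_root_intertwine[OF sc_Y sc_X root_Ds root_D op_restrict[OF Ta_op]]) auto

lemma norm_D: "x \<in> X \<Longrightarrow> (norm (D x))\<^sup>2 = (norm x)\<^sup>2 - (norm (T x))\<^sup>2"
  using D_sym[of x "D x"] D_square[of x] op_in[OF D_op, of x]
  by (simp add: power2_norm_eq_inner inner_diff_right Ta_inner[symmetric])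

lemma norm_Ds: "y \<in> Y \<Longrightarrow> (norm (Ds y))\<^sup>2 = (norm y)\<^sup>2 - (norm (Ta y))\<^sup>2"
  using Ds_sym[of y "Ds y"] Ds_square[of y] op_in[OF Ds_op, of y]
  by (simp add: power2_norm_eq_inner inner_diff_right Ta_inner_left[symmetric] Ta_in)

end

lemma closed_csubspace_closure:
  assumes X: "complex_vector.subspace X"
  shows "closed_csubspace (closure X)"
  unfolding closed_csubspace_def complex_vector.subspace_def
proof (intro conjI ballI allI)
  show "0 \<in> closure X"
    using complex_vector.subspace_0[OF X] closure_subset by blast
  fix x y assume x: "x \<in> closure X" and y: "y \<in> closure X"
  obtain s where s: "\<And>n. s n \<in> X" "s \<longlonglongrightarrow> x" using x closure_sequential by blast
  obtain t where t: "\<And>n. t n \<in> X" "t \<longlonglongrightarrow> y" using y closure_sequential by blast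
  show "x + y \<in> closure X"
    unfolding closure_sequential
    using tendsto_add[OF s(2) t(2)] complex_vector.subspace_add[OF X s(1) t(1)]
    by (intro exI[of _ "\<lambda>n. s n + t n"]) simp
next
  fix x c assume x: "x \<in> closure X"
  obtain s where s: "\<And>n. s n \<in> X" "s \<longlonglongrightarrow> x" using x closure_sequential by blast
  show "c *\<^sub>C x \<in> closure X"
    unfolding closure_sequential
    using bounded_linear.tendsto[OF bounded_linear_scaleC s(2)]
      complex_vector.subspace_scale[OF X s(1)]
    by (intro exI[of _ "\<lambda>n. c *\<^sub>C s n"]) simp
qed simp

lemma csubspace_range:
  assumes X: "closed_csubspace X" and T: "bounded_op X Y T"
  shows "complex_vector.subspace (T ` X)"
  unfolding complex_vector.subspace_def
proof (intro conjI ballI allI)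
  show "0 \<in> T ` X" using csub_0[OF X] op_0[OF X T] by (metis image_eqI)
  show "x + y \<in> T ` X" if "x \<in> T ` X" "y \<in> T ` X" for x y
    using that op_add[OF T] csub_add[OF X] by (metis (no_types, lifting) imageE image_eqI)
  show "c *\<^sub>C x \<in> T ` X" if "x \<in> T ` X" for c x
    using that op_scaleC[OF T] csub_scaleC[OF X] by (metis (no_types, lifting) imageE image_eqI)
qed

lemmas closed_csubspace_closure_range = closed_csubspace_closure[OF csubspace_range]

lemma eq_on_closure:
  fixes f g :: "'a::metric_space \<Rightarrow> 'b::t2_space"
  assumes cont: "continuous_on X f" "continuous_on X g" and S: "closure S \<subseteq> X"
    and eq: "\<And>x. x \<in> S \<Longrightarrow> f x = g x" and x: "x \<in> closure S"
  shows "f x = g x"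
proof -
  obtain s where s: "\<And>n. s n \<in> S" "s \<longlonglongrightarrow> x" using x closure_sequential by blast
  have X: "s n \<in> X" "x \<in> X" for n using s(1) S x closure_subset[of S] by auto
  have "(\<lambda>n. f (s n)) \<longlonglongrightarrow> f x" "(\<lambda>n. g (s n)) \<longlonglongrightarrow> g x"
    using cont s(2) X by (auto simp: continuous_on_sequentially comp_def)
  then show ?thesis using eq[OF s(1)] LIMSEQ_unique by simp
qed

lemma eq_if_inner_eq_dense:
  fixes p q :: "'a::real_inner"
  assumes "p - q \<in> closure S" and eq: "\<And>x. x \<in> S \<Longrightarrow> inner p x = inner q x"
  shows "p = q"
proof -
  have "inner (p - q) (p - q) = 0"
    using eq_on_closure[OF _ _ subset_UNIV _ assms(1), of "\<lambda>x. inner (p - q) x" "\<lambda>_. 0"] eq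
    by (simp add: continuous_intros inner_diff_left)
  then show ?thesis by simp
qed

context contraction_op
begin

lemma DX: "closed_csubspace DX" and DY: "closed_csubspace DY"
  unfolding defect_space_def codefect_space_def
  by (rule closed_csubspace_closure_range[OF X D_op] closed_csubspace_closure_range[OF Y Ds_op])+

lemma D_DX: "x \<in> X \<Longrightarrow> D x \<in> DX" and Ds_DY: "y \<in> Y \<Longrightarrow> Ds y \<in> DY"
  unfolding defect_space_def codefect_space_def by (auto intro: closure_subset[THEN subsetD])

lemma DX_subset: "DX \<subseteq> X" and DY_subset: "DY \<subseteq> Y"
  unfolding defect_space_def codefect_space_def
  by (rule closure_minimal[OF _ csub_closed[OF X]], use op_in[OF D_op] in blast)
    (rule closure_minimal[OF _ csub_closed[OF Y]], use op_in[OF Ds_op] in blast)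

text \<open>The range of \<open>D\<close> is dense in the defect space.\<close>

lemma DX_eqI:
  assumes "p \<in> DX" "q \<in> DX" "\<And>x. x \<in> X \<Longrightarrow> inner p (D x) = inner q (D x)"
  shows "p = q"
  using eq_if_inner_eq_dense[of p q "D ` X"] csub_diff[OF DX assms(1,2)] assms(3)
  by (auto simp: defect_space_def)

lemma T_DX: "p \<in> DX \<Longrightarrow> T p \<in> DY"
proof -
  assume "p \<in> DX"
  then obtain s where s: "\<And>n. s n \<in> D ` X" "s \<longlonglongrightarrow> p"
    unfolding defect_space_def closure_sequential by blast
  have "s n \<in> X" for n using s(1)[of n] op_in[OF D_op] by auto
  then have "(\<lambda>n. T (s n)) \<longlonglongrightarrow> T p"
    using op_continuous[OF X op] s(2) \<open>p \<in> DX\<close> DX_subset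
    by (auto simp: continuous_on_sequentially comp_def)
  moreover have "T (s n) \<in> Ds ` Y" for n
    using s(1)[of n] T_D op_in[OF op] by auto
  ultimately show ?thesis
    unfolding codefect_space_def closure_sequential by (intro exI[of _ "\<lambda>n. T (s n)"]) simp
qed

end

section \<open>Square summable families\<close>

lemma coord_Abs_ell2:
  assumes "\<And>i. norm (h i) \<le> K * norm (coord f i)"
  shows "coord (Abs_ell2 h) = h"
proof -
  have "(\<lambda>i. (norm (h i))\<^sup>2) summable_on UNIV"
  proof (rule summable_on_comparison_test)
    show "(\<lambda>i. K\<^sup>2 * (norm (coord f i))\<^sup>2) summable_on UNIV"
      by (intro summable_on_cmult_right summable_coord)
    show "(norm (h i))\<^sup>2 \<le> K\<^sup>2 * (norm (coord f i))\<^sup>2" for i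
      using power_mono[OF assms, of i 2] by (simp add: power_mult_distrib)
  qed simp_all
  then show ?thesis by (simp add: Abs_ell2_inverse)
qed

lemma coord_sum: "coord (sum f F) w = (\<Sum>i\<in>F. coord (f i) w)"
  by (induction F rule: infinite_finite_induct) (simp_all add: coord_simps)

lemma norm_coord_le: "norm (coord f i) \<le> norm f"
  for f :: "('i, 'a::complex_inner) ell2"
  using sum_coord_le[of "{i}" f] by (simp add: power_mono_iff)

lemma bounded_linear_coord: "bounded_linear (\<lambda>f :: ('i, 'a::complex_inner) ell2. coord f i)"
  by (rule bounded_linear_intro[of _ 1]) (simp_all add: coord_simps norm_coord_le)

lemma inner_ell2: "inner f g = (\<Sum>\<^sub>\<infinity>i. inner (coord f i) (coord g i))"
  for f g :: "('i, 'a::complex_inner) ell2"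
  using infsum_Re[OF summable_cinner[OF summable_coord[of f] summable_coord[of g]]]
  by (simp add: inner_ell2_def cinner_ell2_def Re_cinner)

lemma norm_ell2_le_finite:
  fixes f :: "('i, 'a::complex_inner) ell2"
  assumes "c \<ge> 0" "\<And>F. finite F \<Longrightarrow> (\<Sum>i\<in>F. (norm (coord f i))\<^sup>2) \<le> c\<^sup>2"
  shows "norm f \<le> c"
proof -
  have "(norm f)\<^sup>2 \<le> c\<^sup>2"
    unfolding norm_ell2_square
    by (rule infsum_le_finite_sums[OF summable_coord]) (use assms in auto)
  then show ?thesis using assms(1) by (rule power2_le_imp_le)
qed

subsection \<open>Transport along an injection of the index sets\<close>

text \<open>For injective \<open>\<phi>\<close> this is an isometry with adjoint \<open>pull\<close>. The left and the right creation operators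
  are of this form.\<close>

definition push :: "('i \<Rightarrow> 'j) \<Rightarrow> ('i, 'a::complex_inner) ell2 \<Rightarrow> ('j, 'a) ell2" where
  "push \<phi> f = Abs_ell2 (\<lambda>j. if j \<in> range \<phi> then coord f (inv \<phi> j) else 0)"

definition pull :: "('i \<Rightarrow> 'j) \<Rightarrow> ('j, 'a::complex_inner) ell2 \<Rightarrow> ('i, 'a) ell2" where
  "pull \<phi> f = Abs_ell2 (\<lambda>i. coord f (\<phi> i))"

definition single :: "'i \<Rightarrow> 'a::complex_inner \<Rightarrow> ('i, 'a) ell2" where
  "single i x = Abs_ell2 (\<lambda>j. if j = i then x else 0)"

lemma coord_single: "coord (single i x) j = (if j = i then x else 0)"
proof -
  have "(\<lambda>j. (norm (if j = i then x else 0))\<^sup>2) summable_on UNIV"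
    by (rule summable_on_cong_neutral[THEN iffD1, of _ "{i}", OF _ _ _ summable_on_finite]) auto
  then show ?thesis unfolding single_def by (subst Abs_ell2_inverse) auto
qed

lemma inner_single: "inner (single i x) f = inner x (coord f i)"
proof -
  have "inner (single i x) f = (\<Sum>\<^sub>\<infinity>j\<in>{i}. inner (coord (single i x) j) (coord f j))"
    unfolding inner_ell2 by (rule infsum_cong_neutral) (auto simp: coord_single)
  then show ?thesis by (simp add: coord_single)
qed

lemma norm_single: "norm (single i x) = norm x"
  by (simp add: norm_eq_sqrt_inner inner_single coord_single)

context
  fixes \<phi> :: "'i \<Rightarrow> 'j"
  assumes inj: "inj \<phi>"
begin

lemma coord_push: "coord (push \<phi> f) j = (if j \<in> range \<phi> then coord f (inv \<phi> j) else 0)"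
proof -
  have "(\<lambda>i. (norm (coord f (inv \<phi> (\<phi> i))))\<^sup>2) summable_on UNIV"
    by (simp add: inj summable_coord)
  then have "(\<lambda>j. (norm (coord f (inv \<phi> j)))\<^sup>2) summable_on range \<phi>"
    by (simp add: summable_on_reindex[OF inj] comp_def)
  then have "(\<lambda>j. (norm (if j \<in> range \<phi> then coord f (inv \<phi> j) else 0))\<^sup>2) summable_on UNIV"
    by (rule summable_on_cong_neutral[THEN iffD1, rotated -1]) auto
  then show ?thesis unfolding push_def by (subst Abs_ell2_inverse) auto
qed

lemma coord_push_image: "coord (push \<phi> f) (\<phi> i) = coord f i"
  by (simp add: coord_push inj)

lemma coord_pull: "coord (pull \<phi> f) i = coord f (\<phi> i)"
proof -
  have "(\<lambda>j. (norm (coord f j))\<^sup>2) summable_on range \<phi>"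
    using summable_coord[of f] by (rule summable_on_subset_banach) simp
  then have "(\<lambda>i. (norm (coord f (\<phi> i)))\<^sup>2) summable_on UNIV"
    by (simp add: summable_on_reindex[OF inj] comp_def)
  then show ?thesis unfolding pull_def by (subst Abs_ell2_inverse) auto
qed

lemma inner_push: "inner (push \<phi> f) g = inner f (pull \<phi> g)"
proof -
  have "inner (push \<phi> f) g = (\<Sum>\<^sub>\<infinity>j\<in>range \<phi>. inner (coord (push \<phi> f) j) (coord g j))"
    unfolding inner_ell2 by (rule infsum_cong_neutral) (auto simp: coord_push)
  also have "\<dots> = inner f (pull \<phi> g)"
    by (subst infsum_reindex[OF inj]) (simp add: inner_ell2 comp_def coord_push_image coord_pull)
  finally show ?thesis .
qed

lemma push_add: "push \<phi> (f + g) = push \<phi> f + push \<phi> g"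
  and push_scaleC: "push \<phi> (c *\<^sub>C f) = c *\<^sub>C push \<phi> f"
  by (auto intro!: ell2_eqI simp: coord_push coord_simps)

end

subsection \<open>Amplification and direct sums\<close>

lemma coord_amp:
  assumes "\<And>w. norm (T (coord f w)) \<le> K * norm (coord f w)"
  shows "coord (amp T f) w = T (coord f w)"
  unfolding amp_def by (subst coord_Abs_ell2[where f=f and K=K]) (use assms in auto)

lemma coord_amp_op:
  assumes "bounded_op X Y T" "f \<in> fock_sub X"
  shows "coord (amp T f) w = T (coord f w)"
proof -
  obtain K where "\<And>x. x \<in> X \<Longrightarrow> norm (T x) \<le> K * norm x" using op_bound[OF assms(1)] by blast
  then show ?thesis using assms(2) by (intro coord_amp[where K=K]) (auto simp: fock_sub_def)
qed

lemma coord_amp_UNIV: "bounded_op UNIV Y T \<Longrightarrow> coord (amp T f) w = T (coord f w)"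
  by (rule coord_amp_op) (auto simp: fock_sub_def)

lemma coord_amp_fst: "coord (amp fst f) w = fst (coord f w)"
  and coord_amp_snd: "coord (amp snd f) w = snd (coord f w)"
  by (rule coord_amp[where K=1], metis mult_1 norm_fst_le surjective_pairing)
    (rule coord_amp[where K=1], metis mult_1 norm_snd_le surjective_pairing)

lemma coord_fock_diag:
  "coord (fock_diag S T f) w = (coord (S (amp fst f)) w, coord (T (amp snd f)) w)"
proof -
  have "(\<lambda>w. (norm (coord (S (amp fst f)) w))\<^sup>2 + (norm (coord (T (amp snd f)) w))\<^sup>2)
      summable_on UNIV"
    by (intro summable_on_add summable_coord)
  then show ?thesis
    unfolding fock_diag_def by (subst Abs_ell2_inverse) (auto simp: norm_prod_def)
qed

lemma closed_csubspace_fock_sub: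
  fixes X :: "'a::complex_inner set"
  assumes X: "closed_csubspace X"
  shows "closed_csubspace (fock_sub X :: ('d, 'a) fock set)"
proof -
  have "closed ((\<lambda>f :: ('d, 'a) fock. coord f w) -` X)" for w
    by (intro closed_vimage csub_closed[OF X] bounded_linear_coord linear_continuous_on)
  then have "closed (\<Inter>w. (\<lambda>f :: ('d, 'a) fock. coord f w) -` X)" by blast
  also have "(\<Inter>w. (\<lambda>f :: ('d, 'a) fock. coord f w) -` X) = fock_sub X"
    by (auto simp: fock_sub_def)
  finally have "closed (fock_sub X :: ('d, 'a) fock set)" .
  then show ?thesis
    by (auto simp: closed_csubspace_def complex_vector.subspace_def fock_sub_def coord_simps
        csub_0[OF X] csub_add[OF X] csub_scaleC[OF X])
qed

subsection \<open>Damping\<close>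

definition damp :: "real \<Rightarrow> ('d, 'a::complex_inner) fock \<Rightarrow> ('d, 'a) fock" where
  "damp r f = Abs_ell2 (\<lambda>w. r ^ length w *\<^sub>R coord f w)"

lemma coord_damp:
  assumes "0 \<le> r" "r \<le> 1"
  shows "coord (damp r f) w = r ^ length w *\<^sub>R coord f w"
  unfolding damp_def using assms
  by (subst coord_Abs_ell2[where f=f and K=1]) (auto simp: power_le_one mult_left_le_one_le)

text \<open>A finite set of words carries almost all of the norm; on it the convergence is a matter of finitely
  many coordinates, and damping does not increase the rest.\<close>

lemma damp_tendsto: "((\<lambda>r. damp r f) \<longlongrightarrow> f) (at_left 1)"
proof (rule Lim_transform_eventually)
  show "((\<lambda>r. f - (f - damp r f)) \<longlongrightarrow> f) (at_left 1)"
  proof (rule tendsto_eq_intros)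
    show "((\<lambda>r. f - damp r f) \<longlongrightarrow> 0) (at_left 1)"
    proof (rule tendstoI)
      fix e :: real assume e: "e > 0"
      let ?n = "\<lambda>w. (norm (coord f w))\<^sup>2"
      obtain F where F: "finite F" "dist (sum ?n F) (infsum ?n UNIV) \<le> e\<^sup>2 / 2"
        using infsum_finite_approximation[OF summable_coord, of "e\<^sup>2 / 2" f] e by auto
      have "((\<lambda>r. \<Sum>w\<in>F. (1 - r ^ length w)\<^sup>2 * ?n w) \<longlongrightarrow> (\<Sum>w\<in>F. (1 - 1 ^ length w)\<^sup>2 * ?n w))
          (at_left (1::real))"
        by (intro tendsto_intros)
      then have "((\<lambda>r. \<Sum>w\<in>F. (1 - r ^ length w)\<^sup>2 * ?n w) \<longlongrightarrow> 0) (at_left (1::real))" by simp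
      then have "\<forall>\<^sub>F r in at_left (1::real). (\<Sum>w\<in>F. (1 - r ^ length w)\<^sup>2 * ?n w) < e\<^sup>2 / 2"
        by (rule order_tendstoD) (use e in simp)
      moreover have "\<forall>\<^sub>F r in at_left (1::real). 0 < r \<and> r < 1"
        using eventually_at_left_real[of 0 1] by (auto elim: eventually_mono)
      ultimately show "\<forall>\<^sub>F r in at_left 1. dist (f - damp r f) 0 < e"
      proof eventually_elim
        case (elim r)
        let ?g = "f - damp r f"
        have g: "(norm (coord ?g w))\<^sup>2 = (1 - r ^ length w)\<^sup>2 * ?n w" for w
        proof -
          have "coord ?g w = (1 - r ^ length w) *\<^sub>R coord f w"
            using elim by (simp add: coord_damp coord_simps algebra_simps)
          then show ?thesis by (simp add: power_mult_distrib)
        qed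
        have le: "(norm (coord ?g w))\<^sup>2 \<le> ?n w" for w
        proof -
          have "0 \<le> 1 - r ^ length w" "1 - r ^ length w \<le> 1" using elim by (auto simp: power_le_one)
          then have "(1 - r ^ length w)\<^sup>2 \<le> 1" by (simp add: power_le_one)
          then show ?thesis unfolding g by (simp add: mult_left_le_one_le)
        qed
        have split: "infsum h UNIV = sum h F + infsum h (- F)"
          if "h summable_on UNIV" for h :: "'a list \<Rightarrow> real"
          using infsum_Un_disjoint[of h F "- F"] F(1) summable_on_subset_banach[OF that, of "- F"]
          by simp
        have "(norm ?g)\<^sup>2 = (\<Sum>w\<in>F. (norm (coord ?g w))\<^sup>2) + (\<Sum>\<^sub>\<infinity>w\<in>-F. (norm (coord ?g w))\<^sup>2)"
          unfolding norm_ell2_square by (rule split[OF summable_coord])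
        also have "(\<Sum>\<^sub>\<infinity>w\<in>-F. (norm (coord ?g w))\<^sup>2) \<le> infsum ?n (-F)"
          by (intro infsum_mono le summable_on_subset_banach[OF summable_coord]) auto
        also have "infsum ?n (-F) \<le> e\<^sup>2 / 2"
          using split[OF summable_coord[of f]] F(2) by (simp add: dist_real_def)
        also have "(\<Sum>w\<in>F. (norm (coord ?g w))\<^sup>2) < e\<^sup>2 / 2" unfolding g using elim by simp
        finally have "(norm ?g)\<^sup>2 < e\<^sup>2" by simp
        then show ?case using e by (simp add: power_less_imp_less_base)
      qed
    qed
  qed auto
qed simp

section \<open>The characteristic function of a row contraction\<close>

text \<open>The operator matrix \<open>[T\<^sup>*, D\<^sub>T; D\<^sub>*\<^sub>,\<^sub>T, -T]\<close> is isometric: the mixed terms cancel because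
  \<open>T\<^sup>* D\<^sub>*\<^sub>,\<^sub>T = D\<^sub>T T\<^sup>*\<close>.\<close>

lemma (in contraction_op) julia:
  assumes x: "x \<in> X" and y: "y \<in> Y"
  shows "(norm (Ta y + D x))\<^sup>2 + (norm (Ds y - T x))\<^sup>2 = (norm y)\<^sup>2 + (norm x)\<^sup>2"
proof -
  have cross: "inner (Ta y) (D x) = inner (Ds y) (T x)"
    using D_sym[OF Ta_in x, of y] Ta_Ds[OF y] Ta_inner_left[OF x, of "Ds y"] by simp
  have "(norm (Ta y + D x))\<^sup>2 = (norm (Ta y))\<^sup>2 + 2 * inner (Ta y) (D x) + (norm (D x))\<^sup>2"
    by (simp add: power2_norm_eq_inner inner_simps inner_commute)
  moreover have "(norm (Ds y - T x))\<^sup>2 = (norm (Ds y))\<^sup>2 - 2 * inner (Ds y) (T x) + (norm (T x))\<^sup>2"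
    by (simp add: power2_norm_eq_inner inner_simps inner_commute)
  ultimately show ?thesis using cross norm_D[OF x] norm_Ds[OF y] by simp
qed

locale row_tuple =
  fixes A :: "'d::finite \<Rightarrow> 'h \<Rightarrow> 'h::complex_hilbert"
  assumes ops: "bounded_op UNIV UNIV (A i)"
    and row_norm: "norm (row_op A x) \<le> norm x"
begin

lemma row_op_axis: "row_op A (axis j h) = A j h"
proof -
  have "row_op A (axis j h) = (\<Sum>i\<in>UNIV. if i = j then A j h else 0)"
    unfolding row_op_def
    by (rule sum.cong) (auto simp: axis_def op_0[OF closed_csubspace_UNIV ops])
  then show ?thesis by simp
qed

sublocale contraction_op UNIV UNIV "row_op A"
proof
  have "bounded_op UNIV UNIV (row_op A)"
    using row_norm op_add[OF ops] op_scaleC[OF ops]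
    by (auto simp: bounded_op_def row_op_def sum.distrib scaleC_vec_def
        complex_vector.scale_sum_right intro: exI[of _ 1])
  then show "contraction UNIV UNIV (row_op A)"
    by (simp add: contraction_def row_norm)
qed simp_all

lemma Ta_nth: "Ta y $ j = adj UNIV (A j) y"
proof (rule sym, rule adj_unique[OF closed_csubspace_UNIV ops])
  fix z
  show "inner (A j z) y = inner z (Ta y $ j)"
    using Ta_inner[of "axis j z" y] by (simp add: row_op_axis inner_axis')
qed simp

end

subsection \<open>The row of right creation operators\<close>

lemma right_create_eq_push: "right_create j f = push (\<lambda>w. w @ [j]) f"
proof -
  have inj: "inj (\<lambda>w. w @ [j])" by (simp add: inj_def)
  have inv: "inv (\<lambda>w. w @ [j]) (u @ [j]) = u" for u
    using inv_f_f[OF inj, of u] by simp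
  have "(\<lambda>w. if w \<noteq> [] \<and> last w = j then coord f (butlast w) else 0) =
      (\<lambda>w. if w \<in> range (\<lambda>w. w @ [j]) then coord f (inv (\<lambda>w. w @ [j]) w) else 0)"
  proof
    show "(if w \<noteq> [] \<and> last w = j then coord f (butlast w) else 0) =
      (if w \<in> range (\<lambda>w. w @ [j]) then coord f (inv (\<lambda>w. w @ [j]) w) else 0)" for w
      by (cases w rule: rev_cases) (auto simp: inv)
  qed
  then show ?thesis unfolding right_create_def push_def by simp
qed

lemma coord_right_create:
  "coord (right_create j f) w = (if w \<noteq> [] \<and> last w = j then coord f (butlast w) else 0)"
proof (cases w rule: rev_cases)
  case Nil
  then show ?thesis
    unfolding right_create_eq_push by (subst coord_push) (auto simp: inj_def)
next
  case (snoc u i)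
  have inj: "inj (\<lambda>w. w @ [j])" by (simp add: inj_def)
  show ?thesis
    using coord_push_image[OF inj, of f u] snoc
    by (auto simp: right_create_eq_push coord_push[OF inj])
qed

lemma norm_vec_square: "(norm x)\<^sup>2 = (\<Sum>j\<in>UNIV. (norm (x $ j))\<^sup>2)"
  for x :: "'h::real_inner ^ 'd"
  by (simp add: power2_norm_eq_inner inner_vec_def)

lemma coord_amp_nth: "coord (amp (\<lambda>x. x $ j) f) w = coord f w $ j"
  for f :: "('d, 'h::complex_inner ^ 'e) fock"
  by (rule coord_amp[where K=1]) (simp add: Finite_Cartesian_Product.norm_nth_le)

lemma coord_row_create_Nil: "coord (row_create f) [] = 0"
  by (simp add: row_create_def coord_sum coord_right_create)

lemma coord_row_create_snoc: "coord (row_create f) (u @ [j]) = coord f u $ j"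
  by (simp add: row_create_def coord_sum coord_right_create coord_amp_nth)

lemma row_create_add: "row_create (f + g) = row_create f + row_create g"
proof (rule ell2_eqI)
  show "coord (row_create (f + g)) w = coord (row_create f + row_create g) w" for w
    by (cases w rule: rev_cases)
      (simp_all add: coord_row_create_Nil coord_row_create_snoc coord_simps)
qed

lemma norm_row_create_le: "norm (row_create f) \<le> norm f"
proof (rule norm_ell2_le_finite)
  fix W :: "'a list set" assume W: "finite W"
  let ?W = "W - {[]}"
  have "(\<Sum>w\<in>W. (norm (coord (row_create f) w))\<^sup>2) = (\<Sum>w\<in>?W. (norm (coord f (butlast w) $ last w))\<^sup>2)"
    using W
    by (intro sum.mono_neutral_cong_right)
      (auto simp: coord_row_create_Nil coord_row_create_snoc
        dest!: append_butlast_last_id[symmetric] intro!: arg_cong[where f="\<lambda>x. (norm x)\<^sup>2"],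
        metis append_butlast_last_id coord_row_create_snoc)
  also have "\<dots> = (\<Sum>(u, j)\<in>(\<lambda>w. (butlast w, last w)) ` ?W. (norm (coord f u $ j))\<^sup>2)"
    by (subst sum.reindex) (auto simp: inj_on_def, metis append_butlast_last_id)
  also have "\<dots> \<le> (\<Sum>(u, j)\<in>butlast ` W \<times> UNIV. (norm (coord f u $ j))\<^sup>2)"
    using W by (intro sum_mono2) auto
  also have "\<dots> = (\<Sum>u\<in>butlast ` W. (norm (coord f u))\<^sup>2)"
    by (simp add: norm_vec_square sum.cartesian_product)
  also have "\<dots> \<le> (norm f)\<^sup>2" using W by (intro sum_coord_le) simp
  finally show "(\<Sum>w\<in>W. (norm (coord (row_create f) w))\<^sup>2) \<le> (norm f)\<^sup>2" .
qed simp

subsection \<open>State space realization\<close>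

text \<open>The recursion extends a word at its end, because the states are built by right creation operators;
  on the reversed word it becomes primitive recursion.\<close>

primrec rev_state ::
    "real \<Rightarrow> ('d::finite \<Rightarrow> 'h \<Rightarrow> 'h) \<Rightarrow> ('d list \<Rightarrow> 'h ^ 'd) \<Rightarrow> 'd list \<Rightarrow> 'h::complex_hilbert" where
  "rev_state r A f [] = 0"
| "rev_state r A f (j # v) =
     r *\<^sub>R (adj UNIV (row_op A) (rev_state r A f v) + row_defect A (f (rev v))) $ j"

definition state ::
    "real \<Rightarrow> ('d::finite \<Rightarrow> 'h \<Rightarrow> 'h) \<Rightarrow> ('d list \<Rightarrow> 'h ^ 'd) \<Rightarrow> 'd list \<Rightarrow> 'h::complex_hilbert" where
  "state r A f w = rev_state r A f (rev w)"

definition response ::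
    "real \<Rightarrow> ('d::finite \<Rightarrow> 'h \<Rightarrow> 'h) \<Rightarrow> ('d list \<Rightarrow> 'h ^ 'd) \<Rightarrow> 'd list \<Rightarrow> 'h::complex_hilbert" where
  "response r A f w = row_codefect A (state r A f w) - row_op A (f w)"

lemma state_Nil: "state r A f [] = 0"
  and state_snoc: "state r A f (u @ [j]) =
    r *\<^sub>R (adj UNIV (row_op A) (state r A f u) + row_defect A (f u)) $ j"
  by (simp_all add: state_def)

context row_tuple
begin

lemma bounded_linear_Ta: "bounded_linear Ta"
  and bounded_linear_D: "bounded_linear D"
  and bounded_linear_Ds: "bounded_linear Ds"
  and bounded_linear_T: "bounded_linear (row_op A)"
  using bounded_linear_op Ta_op D_op Ds_op op by blast+

lemmas lin = bounded_linear.linear[OF bounded_linear_Ta] bounded_linear.linear[OF bounded_linear_D]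
  bounded_linear.linear[OF bounded_linear_Ds] bounded_linear.linear[OF bounded_linear_T]

lemmas coord_amp_row = coord_amp_UNIV[OF Ta_op] coord_amp_UNIV[OF D_op] coord_amp_UNIV[OF Ds_op]
  coord_amp_UNIV[OF op] coord_amp_UNIV[OF adj_op[OF closed_csubspace_UNIV ops]]

lemma state_diff: "state r A (\<lambda>w. f w - g w) w = state r A f w - state r A g w"
proof (induction w rule: rev_induct)
  case (snoc j u)
  show ?case
    unfolding state_snoc snoc linear_diff[OF lin(1)] linear_diff[OF lin(2)]
    by (simp add: algebra_simps)
qed (simp add: state_Nil)

lemma response_diff: "response r A (\<lambda>w. f w - g w) w = response r A f w - response r A g w"
  by (simp add: response_def state_diff linear_diff[OF lin(3)] linear_diff[OF lin(4)])

text \<open>Homogeneity: damping the input by \<open>r\<close> to the word length makes up for the factor \<open>r\<close> in the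
  recursion.\<close>

lemma state_damp: "state r A (\<lambda>w. r ^ length w *\<^sub>R f w) w = r ^ length w *\<^sub>R state 1 A f w"
  by (induction w rule: rev_induct)
    (simp_all add: state_Nil state_snoc linear_scale[OF lin(1)] linear_scale[OF lin(2)]
      scaleR_add_right)

lemma response_damp: "response r A (\<lambda>w. r ^ length w *\<^sub>R f w) w = r ^ length w *\<^sub>R response 1 A f w"
  by (simp add: response_def state_damp linear_scale[OF lin(3)] linear_scale[OF lin(4)]
      scaleR_diff_right)

lemma response_tendsto: "((\<lambda>r. response r A f w) \<longlongrightarrow> response 1 A f w) (at_left 1)"
proof -
  have "((\<lambda>r. state r A f w) \<longlongrightarrow> state 1 A f w) (at_left 1)"
  proof (induction w rule: rev_induct)
    case (snoc j u)
    then show ?case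
      unfolding state_snoc
      by (intro tendsto_intros tendsto_vec_nth bounded_linear.tendsto[OF bounded_linear_Ta])
  qed (simp add: state_Nil)
  then show ?thesis
    unfolding response_def by (intro tendsto_intros bounded_linear.tendsto[OF bounded_linear_Ds])
qed

lemma norm_amp_Ta: "norm (amp Ta g) \<le> norm g"
proof (rule norm_ell2_le_finite)
  fix F :: "'a list set" assume "finite F"
  have "(\<Sum>w\<in>F. (norm (coord (amp Ta g) w))\<^sup>2) \<le> (\<Sum>w\<in>F. (norm (coord g w))\<^sup>2)"
    by (intro sum_mono power_mono) (simp_all add: coord_amp_row Ta_norm)
  also have "\<dots> \<le> (norm g)\<^sup>2" by (rule sum_coord_le) fact
  finally show "(\<Sum>w\<in>F. (norm (coord (amp Ta g) w))\<^sup>2) \<le> (norm g)\<^sup>2" .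
qed simp

context
  fixes r :: real
  assumes r: "0 \<le> r" "r < 1"
begin

text \<open>The state \<open>G\<close> solves \<open>G = r R (T\<^sup>* G + D f)\<close> with a contractive right-hand side, so it exists in the Fock
  space by Banach's fixed point theorem, and it is what the resolvent yields.\<close>

lemma char_fun_r_state:
  fixes f :: "('d, 'h ^ 'd) fock"
  obtains G where "char_fun_r r A f = amp Ds G - amp (row_op A) f"
    "G = r *\<^sub>R row_create (amp Ta G + amp D f)"
    "\<And>w. coord G w = state r A (coord f) w"
proof -
  have Ta_diff: "amp Ta g - amp Ta g' = amp Ta (g - g')" for g g' :: "('d, 'h) fock"
    by (rule ell2_eqI) (simp add: coord_simps coord_amp_row linear_diff[OF lin(1)])
  have rc_diff: "row_create f - row_create g = row_create (f - g)" for f g :: "('d, 'h ^ 'd) fock"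
    using row_create_add[of "f - g" g] by simp
  define \<Phi> where "\<Phi> g = r *\<^sub>R row_create (amp Ta g + amp D f)" for g
  have "\<exists>!G. \<Phi> G = G"
  proof (rule banach_fix_type[OF r])
    have "dist (\<Phi> g) (\<Phi> g') \<le> r * dist g g'" for g g'
    proof -
      have "\<Phi> g - \<Phi> g' = r *\<^sub>R row_create (amp Ta (g - g'))"
        by (simp add: \<Phi>_def rc_diff Ta_diff flip: scaleR_diff_right)
      then show ?thesis
        using order_trans[OF norm_row_create_le norm_amp_Ta, of "g - g'"] r
        by (simp add: dist_norm mult_left_mono)
    qed
    then show "\<forall>x y. dist (\<Phi> x) (\<Phi> y) \<le> r * dist x y" by blast
  qed
  then obtain G where G: "\<Phi> G = G" by blast
  have coordG: "coord G w = state r A (coord f) w" for w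
  proof (induction w rule: rev_induct)
    case Nil
    have "coord (\<Phi> G) [] = 0" by (simp add: \<Phi>_def coord_simps coord_row_create_Nil)
    then show ?case by (simp add: G state_Nil)
  next
    case (snoc j u)
    have "coord (\<Phi> G) (u @ [j]) = r *\<^sub>R (Ta (coord G u) + D (coord f u)) $ j"
      by (simp add: \<Phi>_def coord_simps coord_row_create_snoc coord_amp_row)
    then show ?case by (simp add: G state_snoc snoc)
  qed
  let ?F = "\<lambda>g. g - r *\<^sub>R (\<Sum>i\<in>UNIV. right_create i (amp (adj UNIV (A i)) g))"
  have F: "?F g = g - r *\<^sub>R row_create (amp Ta g)" for g
  proof -
    have "amp (\<lambda>x. x $ i) (amp Ta g) = amp (adj UNIV (A i)) g" for i
      by (rule ell2_eqI) (simp add: coord_amp_nth coord_amp_row Ta_nth)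
    then show ?thesis by (simp add: row_create_def)
  qed
  have "inj ?F"
  proof (rule injI)
    fix g g' assume "?F g = ?F g'"
    then have "g - g' = r *\<^sub>R row_create (amp Ta (g - g'))"
      unfolding F by (simp add: algebra_simps flip: rc_diff Ta_diff)
    then have "norm (g - g') = r * norm (row_create (amp Ta (g - g')))"
      using r by (metis abs_of_nonneg norm_scaleR)
    also have "\<dots> \<le> r * norm (g - g')"
      using order_trans[OF norm_row_create_le norm_amp_Ta, of "g - g'"] r
      by (simp add: mult_left_mono)
    finally have "(1 - r) * norm (g - g') \<le> 0" by (simp add: algebra_simps)
    then show "g = g'" using r by (simp add: mult_le_0_iff)
  qed
  moreover have "?F G = r *\<^sub>R row_create (amp D f)"
  proof -
    have "G = r *\<^sub>R row_create (amp Ta G) + r *\<^sub>R row_create (amp D f)"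
      using G by (simp add: \<Phi>_def row_create_add scaleR_add_right)
    then show ?thesis unfolding F by (metis add_diff_cancel_left')
  qed
  ultimately have "inv ?F (r *\<^sub>R row_create (amp D f)) = G" by (rule inv_f_eq)
  then have "char_fun_r r A f = amp Ds G - amp (row_op A) f"
    by (simp add: char_fun_r_def)
  then show thesis using that G coordG by (simp add: \<Phi>_def)
qed

lemma coord_char_fun_r: "coord (char_fun_r r A f) w = response r A (coord f) w"
proof -
  obtain G where "char_fun_r r A f = amp Ds G - amp (row_op A) f"
    "\<And>w. coord G w = state r A (coord f) w"
    using char_fun_r_state[of f] by metis
  then show ?thesis by (simp add: coord_simps coord_amp_row response_def)
qed

text \<open>Summing the identity for the Julia operator over all words: the state \<open>G = r R X\<close> is dominated
  by \<open>X\<close>.\<close>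

lemma norm_char_fun_r: "norm (char_fun_r r A f) \<le> norm f"
proof -
  obtain G where M: "char_fun_r r A f = amp Ds G - amp (row_op A) f"
    and G: "G = r *\<^sub>R row_create (amp Ta G + amp D f)"
    using char_fun_r_state[of f] by metis
  let ?X = "amp Ta G + amp D f" and ?M = "char_fun_r r A f"
  have "(norm ?X)\<^sup>2 + (norm ?M)\<^sup>2 = (\<Sum>\<^sub>\<infinity>w. (norm (coord ?X w))\<^sup>2 + (norm (coord ?M w))\<^sup>2)"
    unfolding norm_ell2_square by (intro infsum_add[symmetric] summable_coord)
  also have "\<dots> = (\<Sum>\<^sub>\<infinity>w. (norm (coord G w))\<^sup>2 + (norm (coord f w))\<^sup>2)"
    using julia by (intro infsum_cong) (simp add: M coord_simps coord_amp_row)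
  also have "\<dots> = (norm G)\<^sup>2 + (norm f)\<^sup>2"
    unfolding norm_ell2_square by (intro infsum_add summable_coord)
  finally have eq: "(norm ?X)\<^sup>2 + (norm ?M)\<^sup>2 = (norm G)\<^sup>2 + (norm f)\<^sup>2" .
  have "norm G = r * norm (row_create ?X)" using G r by (metis abs_of_nonneg norm_scaleR)
  also have "\<dots> \<le> 1 * norm ?X" using r norm_row_create_le[of ?X] by (intro mult_mono) auto
  finally have "(norm G)\<^sup>2 \<le> (norm ?X)\<^sup>2" by (simp add: power_mono)
  then have "(norm ?M)\<^sup>2 \<le> (norm f)\<^sup>2" using eq by linarith
  then show ?thesis by (rule power2_le_imp_le) simp
qed

end

text \<open>The contractions \<open>M\<^sub>r = M\<^sub>A(rR)\<close> satisfy \<open>M\<^sub>r \<rho>\<^sub>r = \<rho>\<^sub>r M\<close>, where \<open>\<rho>\<^sub>r\<close> is the damping by \<open>r\<close> to the word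
  length. Hence \<open>\<parallel>M\<^sub>r f - \<rho>\<^sub>r M f\<parallel> \<le> \<parallel>f - \<rho>\<^sub>r f\<parallel>\<close>, which tends to 0.\<close>

theorem coord_char_fun: "coord (char_fun A f) w = response 1 A (coord f) w"
proof -
  have near_1: "\<forall>\<^sub>F r in at_left (1::real). 0 \<le> r \<and> r < 1"
    using eventually_at_left_real[of 0 1] by (auto elim: eventually_mono)
  have bound: "(\<Sum>w\<in>F. (norm (response 1 A (coord f) w))\<^sup>2) \<le> (norm f)\<^sup>2" if "finite F" for F
  proof (rule tendsto_upperbound)
    show "((\<lambda>r. \<Sum>w\<in>F. (norm (response r A (coord f) w))\<^sup>2)
        \<longlongrightarrow> (\<Sum>w\<in>F. (norm (response 1 A (coord f) w))\<^sup>2)) (at_left 1)"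
      by (intro tendsto_intros response_tendsto)
    show "\<forall>\<^sub>F r in at_left 1. (\<Sum>w\<in>F. (norm (response r A (coord f) w))\<^sup>2) \<le> (norm f)\<^sup>2"
      using near_1
    proof eventually_elim
      case (elim r)
      have "(\<Sum>w\<in>F. (norm (response r A (coord f) w))\<^sup>2) \<le> (norm (char_fun_r r A f))\<^sup>2"
        using sum_coord_le[OF that, of "char_fun_r r A f"] elim by (simp add: coord_char_fun_r)
      also have "\<dots> \<le> (norm f)\<^sup>2" using norm_char_fun_r[of r f] elim by (simp add: power_mono)
      finally show ?case .
    qed
  qed simp
  define L where "L = Abs_ell2 (response 1 A (coord f))"
  have "(\<lambda>w. (norm (response 1 A (coord f) w))\<^sup>2) summable_on UNIV"
    using bound by (intro nonneg_bdd_above_summable_on) (auto intro!: bdd_aboveI)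
  then have L: "coord L w = response 1 A (coord f) w" for w
    by (simp add: L_def Abs_ell2_inverse)
  have "((\<lambda>r. char_fun_r r A f) \<longlongrightarrow> L) (at_left 1)"
  proof (rule Lim_transform)
    show "((\<lambda>r. damp r L) \<longlongrightarrow> L) (at_left 1)" by (rule damp_tendsto)
    have "((\<lambda>r. norm (f - damp r f)) \<longlongrightarrow> norm (f - f)) (at_left 1)"
      by (intro tendsto_intros damp_tendsto)
    then have lim: "((\<lambda>r. norm (f - damp r f)) \<longlongrightarrow> 0) (at_left 1)" by simp
    have "\<forall>\<^sub>F r in at_left 1. norm (char_fun_r r A f - damp r L) \<le> norm (f - damp r f)"
      using near_1
    proof eventually_elim
      case (elim r)
      have "coord (f - damp r f) = (\<lambda>w. coord f w - r ^ length w *\<^sub>R coord f w)"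
        using elim by (simp add: fun_eq_iff coord_simps coord_damp)
      then have "char_fun_r r A f - damp r L = char_fun_r r A (f - damp r f)"
        using elim by (intro ell2_eqI)
          (simp add: coord_diff coord_char_fun_r coord_damp L response_diff response_damp)
      then show ?case using norm_char_fun_r[of r "f - damp r f"] elim by simp
    qed
    then show "((\<lambda>r. char_fun_r r A f - damp r L) \<longlongrightarrow> 0) (at_left 1)"
      using lim by (rule Lim_null_comparison)
  qed
  then have "char_fun A f = L"
    unfolding char_fun_def by (intro tendsto_Lim) simp_all
  then show ?thesis by (simp add: L)
qed

end

section \<open>Isometries defined on generators\<close>

lemma closure_span_minimal:
  "S \<subseteq> X \<Longrightarrow> closed_csubspace X \<Longrightarrow> closure (complex_vector.span S) \<subseteq> X"
  by (simp add: closed_csubspace_def closure_minimal complex_vector.span_minimal)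

lemma closure_span_superset: "S \<subseteq> closure (complex_vector.span S)"
  using complex_vector.span_superset closure_subset by blast

lemma closed_csubspace_closure_span: "closed_csubspace (closure (complex_vector.span S))"
  by (rule closed_csubspace_closure) (rule complex_vector.subspace_span)

text \<open>Complex scaling of \<open>Y\<close> makes orthogonality with respect to the real inner product a complex linear
  condition.\<close>

lemma closed_csubspace_orthogonal:
  assumes "\<And>c y. y \<in> Y \<Longrightarrow> c *\<^sub>C y \<in> Y"
  shows "closed_csubspace {x. \<forall>y\<in>Y. inner x y = 0}"
proof -
  have "closed (\<Inter>y\<in>Y. {x. inner x y = 0})"
    by (intro closed_INT ballI closed_Collect_eq continuous_intros)
  also have "(\<Inter>y\<in>Y. {x. inner x y = 0}) = {x. \<forall>y\<in>Y. inner x y = 0}" by auto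
  finally show ?thesis
    using assms
    by (auto simp: closed_csubspace_def complex_vector.subspace_def inner_add_left
        inner_scaleC_left)
qed

lemma op_map_prod:
  assumes S: "bounded_op UNIV UNIV S" and T: "bounded_op UNIV UNIV T"
  shows "bounded_op UNIV UNIV (map_prod S T)"
proof -
  have "bounded_op (UNIV \<times> UNIV) UNIV (\<lambda>z. (S (fst z), T (snd z)))"
    by (intro op_Pair op_comp[OF op_fst S] op_comp[OF op_snd T])
  moreover have "(\<lambda>z. (S (fst z), T (snd z))) = map_prod S T" by (simp add: fun_eq_iff)
  ultimately show ?thesis by simp
qed

lemma closed_csubspace_vimage:
  assumes T: "bounded_op UNIV UNIV T" and X: "closed_csubspace X"
  shows "closed_csubspace (T -` X)"
proof -
  have "closed (T -` X)"
    using bounded_linear_op[OF T] csub_closed[OF X]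
    by (intro closed_vimage) (auto intro: linear_continuous_on)
  then show ?thesis
    using op_0[OF closed_csubspace_UNIV T]
    by (auto simp: closed_csubspace_def complex_vector.subspace_def op_add[OF T] op_scaleC[OF T]
        csub_0[OF X] csub_add[OF X] csub_scaleC[OF X])
qed

text \<open>A set \<open>S\<close> of pairs whose first components have the same Gram matrix as the second ones
  generates the graph of an isometry.\<close>

locale gram_equal =
  fixes S :: "('y::complex_hilbert \<times> 'z::complex_hilbert) set"
  assumes gram: "p \<in> S \<Longrightarrow> q \<in> S \<Longrightarrow> inner (fst p) (fst q) = inner (snd p) (snd q)"
    and scale: "p \<in> S \<Longrightarrow> c *\<^sub>C p \<in> S"
begin

definition "graph = closure (complex_vector.span S)"

lemma graph: "closed_csubspace graph" and S_graph: "S \<subseteq> graph"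
  by (simp_all add: graph_def closed_csubspace_closure_span closure_span_superset)

text \<open>The difference of the two inner products vanishes on the generators, hence on the closed span in
  either argument. The sign change \<open>?J\<close> turns it into a single inner product.\<close>

lemma graph_inner: "p \<in> graph \<Longrightarrow> q \<in> graph \<Longrightarrow> inner (fst p) (fst q) = inner (snd p) (snd q)"
proof -
  let ?J = "\<lambda>p :: 'y \<times> 'z. (fst p, - snd p)"
  have J: "bounded_op UNIV UNIV ?J"
    using op_fst[of UNIV UNIV] op_uminus[OF op_snd[of UNIV UNIV]] by (intro op_Pair) simp_all
  have form: "inner (?J p) q = inner (fst p) (fst q) - inner (snd p) (snd q)" for p q
    by (simp add: inner_prod_def)
  have vim: "closed_csubspace {p. \<forall>q\<in>T. inner (?J p) q = 0}"
    if T: "\<And>c q. q \<in> T \<Longrightarrow> c *\<^sub>C q \<in> T" for T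
    using closed_csubspace_vimage[OF J closed_csubspace_orthogonal[of T]] T by (simp add: vimage_def)
  have "graph \<subseteq> {p. \<forall>q\<in>S. inner (?J p) q = 0}"
    unfolding graph_def
    by (rule closure_span_minimal[OF _ vim]) (use gram scale in \<open>auto simp: inner_prod_def\<close>)
  then have 1: "inner (?J p) q = 0" if "p \<in> graph" "q \<in> S" for p q
    using that by blast
  have "S \<subseteq> {p. \<forall>q\<in>graph. inner (?J p) q = 0}"
  proof (intro subsetI CollectI ballI)
    fix p q assume "p \<in> S" "q \<in> graph"
    then have "inner (?J q) p = 0" by (rule 1[rotated])
    then show "inner (?J p) q = 0" unfolding form by (simp add: inner_commute)
  qed
  then have "graph \<subseteq> {p. \<forall>q\<in>graph. inner (?J p) q = 0}"
    unfolding graph_def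
    using vim[OF csub_scaleC[OF graph]] unfolding graph_def by (rule closure_span_minimal)
  moreover assume "p \<in> graph" "q \<in> graph"
  ultimately have "inner (?J p) q = 0" by blast
  then show ?thesis unfolding form by simp
qed

lemma graph_norm: "p \<in> graph \<Longrightarrow> norm (fst p) = norm (snd p)"
  by (simp add: norm_eq_sqrt_inner graph_inner)

lemma norm_graph: "p \<in> graph \<Longrightarrow> norm p = sqrt 2 * norm (fst p) \<and> norm p = sqrt 2 * norm (snd p)"
  using graph_norm[of p] by (simp add: norm_prod_def real_sqrt_mult flip: mult_2)

text \<open>On the graph the projections are multiples of isometries, so their ranges are complete.\<close>

lemma closed_image_graph:
  fixes \<pi> :: "'y \<times> 'z \<Rightarrow> 'w::complex_hilbert"
  assumes \<pi>: "bounded_op UNIV UNIV \<pi>" and norm: "\<And>p. p \<in> graph \<Longrightarrow> norm p = sqrt 2 * norm (\<pi> p)"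
  shows "closed_csubspace (\<pi> ` graph)"
  unfolding closed_csubspace_def
proof
  have op: "bounded_op graph UNIV \<pi>" using op_restrict[OF \<pi>] by blast
  show "complex_vector.subspace (\<pi> ` graph)" by (rule csubspace_range[OF graph op])
  show "closed (\<pi> ` graph)"
    unfolding closed_sequential_limits
  proof (intro allI impI, elim conjE)
    fix s l assume s: "\<forall>n. s n \<in> \<pi> ` graph" and lim: "s \<longlonglongrightarrow> l"
    then have "\<forall>n. \<exists>q. q \<in> graph \<and> s n = \<pi> q" by blast
    then obtain p where p: "\<And>n. p n \<in> graph" "\<And>n. s n = \<pi> (p n)" by metis
    have dist: "dist (p m) (p n) = sqrt 2 * dist (s m) (s n)" for m n
      unfolding dist_norm p(2) op_diff[OF closed_csubspace_UNIV \<pi> UNIV_I UNIV_I, symmetric]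
      by (rule norm[OF csub_diff[OF graph p(1) p(1)]])
    have "Cauchy p"
    proof (rule metric_CauchyI)
      fix e :: real assume "e > 0"
      then obtain N where "\<forall>m\<ge>N. \<forall>n\<ge>N. dist (s m) (s n) < e / sqrt 2"
        using metric_CauchyD[OF LIMSEQ_imp_Cauchy[OF lim], of "e / sqrt 2"] by auto
      then show "\<exists>N. \<forall>m\<ge>N. \<forall>n\<ge>N. dist (p m) (p n) < e"
        by (auto simp: dist field_simps intro!: exI[of _ N])
    qed
    then obtain q where q: "p \<longlonglongrightarrow> q" using Cauchy_convergent_iff convergent_def by blast
    have "q \<in> graph" using closed_sequentially[OF csub_closed[OF graph] _ q] p(1) by blast
    moreover have "s \<longlonglongrightarrow> \<pi> q"
      using bounded_linear.tendsto[OF bounded_linear_op[OF \<pi>] q] by (simp flip: p(2))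
    ultimately show "l \<in> \<pi> ` graph" using LIMSEQ_unique[OF lim] by blast
  qed
qed

lemma op_projections: "bounded_op UNIV UNIV (fst :: 'y \<times> 'z \<Rightarrow> 'y)"
    "bounded_op UNIV UNIV (snd :: 'y \<times> 'z \<Rightarrow> 'z)"
  using op_fst[of UNIV UNIV] op_snd[of UNIV UNIV] by simp_all

lemma closed_fst_graph: "closed_csubspace (fst ` graph)"
  and closed_snd_graph: "closed_csubspace (snd ` graph)"
  by (rule closed_image_graph[OF op_projections(1)], use norm_graph in blast)
    (rule closed_image_graph[OF op_projections(2)], use norm_graph in blast)

lemma fst_graph: "fst ` graph = closure (complex_vector.span (fst ` S))"
proof
  have "graph \<subseteq> fst -` closure (complex_vector.span (fst ` S))"
    unfolding graph_def
    by (rule closure_span_minimal[OF _ closed_csubspace_vimage[OF op_projections(1)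
            closed_csubspace_closure_span]])
      (use closure_span_superset[of "fst ` S"] in blast)
  then show "fst ` graph \<subseteq> closure (complex_vector.span (fst ` S))" by blast
  show "closure (complex_vector.span (fst ` S)) \<subseteq> fst ` graph"
    using S_graph by (intro closure_span_minimal closed_fst_graph) blast
qed

definition isometry :: "'y \<Rightarrow> 'z" where
  "isometry y = (SOME z. (y, z) \<in> graph)"

lemma isometry_unique: "(y, z) \<in> graph \<Longrightarrow> isometry y = z"
proof -
  assume yz: "(y, z) \<in> graph"
  then have "(y, isometry y) \<in> graph" unfolding isometry_def by (rule someI)
  then have "(y, isometry y) - (y, z) \<in> graph" using csub_diff[OF graph] yz by blast
  then have "norm (isometry y - z) = norm (y - y)" using graph_norm by fastforce
  then show ?thesis by simp
qed

lemma isometry_graph: "y \<in> fst ` graph \<Longrightarrow> (y, isometry y) \<in> graph"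
  using isometry_unique by fastforce

end

section \<open>The minimal isometric dilation\<close>

lemma word_op_Nil [simp]: "word_op S [] z = z"
  and word_op_Cons [simp]: "word_op S (j # v) z = S j (word_op S v z)"
  and word_op_append: "word_op S (u @ v) z = word_op S u (word_op S v z)"
  by (simp_all add: word_op_def)

lemma single_add: "single i (x + y) = single i x + single i y"
  and single_scaleC: "single i (c *\<^sub>C x) = c *\<^sub>C single i x"
  by (auto intro!: ell2_eqI simp: coord_single coord_simps)

lemma bounded_linear_single: "bounded_linear (single i :: 'a::complex_inner \<Rightarrow> _)"
  by (rule bounded_linear_intro[of _ 1])
    (auto intro!: ell2_eqI simp: coord_single coord_simps norm_single)

lemma inj_Cons: "inj ((#) j)"
  by simp

lemma coord_push_Cons:
  "coord (push ((#) j) f) w = (case w of [] \<Rightarrow> 0 | i # v \<Rightarrow> if i = j then coord f v else 0)"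
proof (cases w)
  case (Cons i v)
  show ?thesis
    using coord_push_image[OF inj_Cons[of j], of f v]
    by (auto simp: Cons coord_push[OF inj_Cons])
qed (auto simp: coord_push[OF inj_Cons])

lemma push_Cons_single: "push ((#) j) (single w x) = single (j # w) x"
  by (rule ell2_eqI) (auto simp: coord_push_Cons coord_single split: list.split)

lemma inner_push_Cons: "inner (push ((#) i) f) (push ((#) j) g) = (if i = j then inner f g else 0)"
proof -
  have "pull ((#) i) (push ((#) j) g) = (if i = j then g else 0)"
    by (rule ell2_eqI) (auto simp: coord_pull[OF inj_Cons] coord_push_Cons coord_simps)
  then show ?thesis by (simp add: inner_push[OF inj_Cons])
qed

context row_tuple
begin

lemma dilation_eq: "dilation A j (h, f) = (A j h, single [] (D (axis j h)) + push ((#) j) f)"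
proof -
  have "(\<lambda>w. case w of [] \<Rightarrow> D (axis j h) | i # v \<Rightarrow> if i = j then coord f v else 0)
      = coord (single [] (D (axis j h)) + push ((#) j) f)"
    by (auto simp: fun_eq_iff coord_simps coord_single coord_push_Cons split: list.split)
  then show ?thesis by (simp add: dilation_def coord_inverse)
qed

lemma axis_add: "axis j (x + y) = axis j x + axis j (y :: 'h)"
  and axis_scaleC: "axis j (c *\<^sub>C x) = c *\<^sub>C axis j (x :: 'h)"
  by (auto simp: axis_def vec_eq_iff scaleC_vec_def)

text \<open>The part in the defect space supplies exactly what \<open>A\<^sub>i\<^sup>*A\<^sub>j\<close> lacks to \<open>\<delta>\<^sub>i\<^sub>j I\<close>, so the \<open>V\<^sub>j\<close> are
  isometries with orthogonal ranges.\<close>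

lemma inner_dilation:
  "inner (dilation A i y) (dilation A j z) = (if i = j then inner y z else 0)"
proof -
  obtain h f where y: "y = (h, f)" by fastforce
  obtain k g where z: "z = (k, g)" by fastforce
  have "inner (D (axis i h)) (D (axis j k)) = inner (axis i h) (axis j k) - inner (A i h) (A j k)"
    by (simp add: D_sym D_square inner_diff_right Ta_inner[symmetric] row_op_axis)
  moreover have "inner (axis i h) (axis j k) = (if i = j then inner h k else 0)"
    by (simp add: inner_axis') (simp add: axis_def)
  ultimately show ?thesis
    by (auto simp: y z dilation_eq inner_add_left inner_add_right inner_single coord_single
        inner_push_Cons coord_push_Cons inner_commute[of "push _ _" "single _ _"])
qed

lemma norm_dilation: "norm (dilation A j z) = norm z"
  by (simp add: norm_eq_sqrt_inner inner_dilation)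

lemma dilation_op: "bounded_op UNIV UNIV (dilation A j)"
proof (rule op_intro[where K=1])
  fix y z :: "'h \<times> ('d, 'h ^ 'd) fock" and c
  obtain h f where y: "y = (h, f)" by fastforce
  obtain k g where z: "z = (k, g)" by fastforce
  show "dilation A j (y + z) = dilation A j y + dilation A j z"
    by (simp add: y z dilation_eq op_add[OF ops] axis_add op_add[OF D_op] single_add
        push_add[OF inj_Cons])
  show "dilation A j (c *\<^sub>C y) = c *\<^sub>C dilation A j y"
    by (simp add: y dilation_eq op_scaleC[OF ops] axis_scaleC op_scaleC[OF D_op] single_scaleC
        push_scaleC[OF inj_Cons] scaleC_prod_def scaleC_add_right)
qed (simp_all add: norm_dilation)

lemma word_dilation_op: "bounded_op UNIV UNIV (word_op (dilation A) w)"
  by (induction w) (simp_all add: inclusion_op word_op_def op_comp[OF _ dilation_op, unfolded comp_def]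
      comp_def)

lemma dilation_in: "z \<in> dilation_space A \<Longrightarrow> dilation A j z \<in> dilation_space A"
  using csub_0[OF DX] D_DX
  by (auto simp: dilation_space_def fock_sub_def dilation_eq coord_simps coord_single
      coord_push_Cons split: list.split)

lemma word_dilation_in: "z \<in> dilation_space A \<Longrightarrow> word_op (dilation A) w z \<in> dilation_space A"
  by (induction w) (simp_all add: dilation_in)

lemma vacuum_in: "(h, 0) \<in> dilation_space A"
  using csub_0[OF DX] by (simp add: dilation_space_def fock_sub_def coord_simps)

lemma closed_csubspace_dilation_space: "closed_csubspace (dilation_space A)"
  unfolding dilation_space_def
  by (intro closed_csubspace_Times closed_csubspace_fock_sub DX) simp

lemma fst_word_dilation: "fst (word_op (dilation A) w (h, f)) = word_op A w h"
  by (induction w) (simp_all add: dilation_def split: prod.split, metis fst_conv)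

lemma word_dilation_single:
  "word_op (dilation A) w (0, single [] x) = (0, single w x)"
  by (induction w)
    (simp_all add: dilation_eq op_0[OF closed_csubspace_UNIV ops] push_Cons_single axis_def
      zero_vec_def[symmetric] op_0[OF closed_csubspace_UNIV D_op]
      linear_0[OF bounded_linear.linear[OF bounded_linear_single]])

text \<open>Removing the last letter of a word in the dilation leaves a shorter word applied to \<open>A\<^sub>j h\<close> and one
  applied to \<open>e\<^sub>0 \<otimes> (D\<^sub>A)\<^sub>j h\<close>; the adjoint of this step is the recursion of the states.\<close>

lemma inner_word_dilation:
  "inner f (snd (word_op (dilation A) w (h, 0))) = inner (state 1 A (coord f) w) h"
proof (induction w arbitrary: h rule: rev_induct)
  case (snoc j u)
  have push0: "push ((#) j) 0 = (0 :: ('d, 'h ^ 'd) fock)"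
    by (rule ell2_eqI) (simp add: coord_push_Cons coord_simps split: list.split)
  have "word_op (dilation A) (u @ [j]) (h, 0)
      = word_op (dilation A) u ((A j h, 0) + (0, single [] (D (axis j h))))"
    by (simp add: word_op_append dilation_eq push0)
  also have "\<dots> = word_op (dilation A) u (A j h, 0) + (0, single u (D (axis j h)))"
    by (simp only: op_add[OF word_dilation_op UNIV_I UNIV_I] word_dilation_single)
  finally have "inner f (snd (word_op (dilation A) (u @ [j]) (h, 0)))
      = inner (state 1 A (coord f) u) (A j h) + inner (coord f u) (D (axis j h))"
    using inner_single[of u "D (axis j h)" f]
    by (simp add: inner_add_right snoc inner_commute[of f "single _ _"]
        inner_commute[of "coord f u"])
  also have "inner (coord f u) (D (axis j h)) = inner (D (coord f u) $ j) h"
    using D_sym[of "coord f u" "axis j h"] by (simp add: inner_axis)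
  also have "inner (state 1 A (coord f) u) (A j h) = inner (Ta (state 1 A (coord f) u) $ j) h"
    using Ta_inner_left[of "axis j h" "state 1 A (coord f) u"]
    by (simp add: row_op_axis inner_axis)
  finally show ?case by (simp add: state_snoc inner_add_left)
qed (simp add: state_Nil)

lemma sum_axis: "(\<Sum>j\<in>UNIV. axis j (x $ j)) = (x :: 'h ^ 'd)"
  by (simp add: vec_eq_iff axis_def)

text \<open>Subtracting a vector of the initial space leaves \<open>e\<^sub>0 \<otimes> D x\<close>: the dilation is minimal because the
  defect space is reached in this way.\<close>

lemma sum_dilation_diff:
  "(\<Sum>j\<in>UNIV. dilation A j (x $ j, 0)) = (row_op A x, single [] (D x))"
proof -
  have push0: "push ((#) j) 0 = (0 :: ('d, 'h ^ 'd) fock)" for j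
    by (rule ell2_eqI) (simp add: coord_push_Cons coord_simps split: list.split)
  have "(\<Sum>j\<in>UNIV. single [] (D (axis j (x $ j)))) = single [] (D (\<Sum>j\<in>UNIV. axis j (x $ j)))"
    by (simp add: linear_sum[OF bounded_linear.linear[OF bounded_linear_single]]
        linear_sum[OF lin(2)])
  then show ?thesis
    by (simp add: dilation_eq push0 prod_eq_iff fst_sum snd_sum row_op_def sum_axis)
qed

end

section \<open>The characteristic function of a lifting\<close>

definition vec_pair :: "'h ^ 'd \<Rightarrow> 'k ^ 'd \<Rightarrow> ('h \<times> 'k) ^ 'd::finite" where
  "vec_pair x y = (\<chi> i. (x $ i, y $ i))"

lemma vec_pair_nth [simp]: "vec_pair x y $ i = (x $ i, y $ i)"
  by (simp add: vec_pair_def)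

lemma scaleC_Pair: "c *\<^sub>C (x, y) = (c *\<^sub>C x, c *\<^sub>C y)"
  by (simp add: scaleC_prod_def)

lemma vec_split_vec_pair: "vec_split (vec_pair x y) = (x, y)"
  by (simp add: vec_split_def vec_eq_iff)

lemma inner_vec_pair: "inner (vec_pair x y) (vec_pair x' y') = inner x x' + inner y y'"
  by (simp add: inner_vec_def inner_prod_def sum.distrib)

lemma vec_pair_surj: obtains x y where "z = vec_pair x y"
  using that[of "\<chi> i. fst (z $ i)" "\<chi> i. snd (z $ i)"] by (simp add: vec_eq_iff)

lemma row_op_lifting:
  "row_op (lifting C B A) (vec_pair x y) = (row_op C x, row_op B x + row_op A y)"
  by (simp add: row_op_def lifting_def prod_eq_iff fst_sum snd_sum sum.distrib)

locale row_lifting = C: row_tuple C + A: row_tuple A + E: row_tuple "lifting C B A"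
  for C :: "'d::finite \<Rightarrow> 'c \<Rightarrow> 'c::complex_hilbert" and B
    and A :: "'d \<Rightarrow> 'a \<Rightarrow> 'a::complex_hilbert"
begin

abbreviation "E \<equiv> lifting C B A"
abbreviation "V \<equiv> dilation E"
abbreviation "VC \<equiv> dilation C"

definition "gens = {(word_op V w ((x, 0), 0), word_op VC w (x, 0)) | w x. True}"

lemma gensI: "(word_op V w ((x, 0), 0), word_op VC w (x, 0)) \<in> gens"
  by (auto simp: gens_def)

lemma gensE:
  assumes "p \<in> gens"
  obtains w x where "p = (word_op V w ((x, 0), 0), word_op VC w (x, 0))"
  using assms by (auto simp: gens_def)

lemma fst_word_lifting: "fst (word_op E w h) = word_op C w (fst h)"
  by (induction w) (simp_all add: lifting_def split: prod.split, metis fst_conv)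

text \<open>Common initial letters cancel. What remains is \<open>\<langle>x, E\<^sub>\<alpha> y\<rangle>\<close> for a word \<open>\<alpha>\<close>, which for \<open>x, y\<close> in \<open>H\<^sub>C\<close>
  only depends on \<open>C\<close>.\<close>

lemma gram_words:
  "inner (word_op V v ((x, 0), 0)) (word_op V w ((y, 0), 0))
    = inner (word_op VC v (x, 0)) (word_op VC w (y, 0))"
proof (induction v arbitrary: w)
  case Nil
  have "inner (((x, 0), 0) :: ('c \<times> 'a) \<times> ('d, ('c \<times> 'a) ^ 'd) fock) z = inner x (fst (fst z))" for z
    by (simp add: inner_prod_def)
  then show ?case
    by (simp add: E.fst_word_dilation fst_word_lifting inner_prod_def C.fst_word_dilation)
next
  case (Cons i v)
  show ?case
  proof (cases w)
    case Nil
    have "inner z (((y, 0), 0) :: ('c \<times> 'a) \<times> ('d, ('c \<times> 'a) ^ 'd) fock) = inner (fst (fst z)) y" for z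
      by (simp add: inner_prod_def)
    then show ?thesis
      unfolding Nil word_op_Nil E.fst_word_dilation fst_word_lifting
      by (simp add: E.fst_word_dilation fst_word_lifting inner_prod_def C.fst_word_dilation
          del: word_op_Cons)
  next
    case (Cons j u)
    then show ?thesis using Cons.IH by (simp add: E.inner_dilation C.inner_dilation)
  qed
qed

sublocale gram_equal gens
proof
  show "inner (fst p) (fst q) = inner (snd p) (snd q)" if "p \<in> gens" "q \<in> gens" for p q
    using that by (auto simp: gens_def gram_words)
  show "c *\<^sub>C p \<in> gens" if "p \<in> gens" for p c
  proof -
    obtain w x where p: "p = (word_op V w ((x, 0), 0), word_op VC w (x, 0))"
      using \<open>p \<in> gens\<close> by (rule gensE)
    have "c *\<^sub>C p = (word_op V w (c *\<^sub>C ((x, 0), 0)), word_op VC w (c *\<^sub>C (x, 0)))"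
      by (simp only: p scaleC_Pair[of c "word_op V w _"] op_scaleC[OF E.word_dilation_op UNIV_I]
          op_scaleC[OF C.word_dilation_op UNIV_I])
    then show ?thesis using gensI[of w "c *\<^sub>C x"] by (simp add: scaleC_Pair)
  qed
qed

abbreviation "L \<equiv> fst ` graph"

lemma L_eq: "L = closure (complex_vector.span {word_op V w ((x, 0), 0) | w x. True})"
proof -
  have "fst ` gens = {word_op V w ((x, 0), 0) | w x. True}"
    by (force simp: gens_def)
  then show ?thesis by (simp add: fst_graph)
qed

lemma graph_subset: "graph \<subseteq> dilation_space E \<times> dilation_space C"
  unfolding graph_def
  by (intro closure_span_minimal closed_csubspace_Times E.closed_csubspace_dilation_space
      C.closed_csubspace_dilation_space)
    (auto simp: gens_def E.word_dilation_in C.word_dilation_in E.vacuum_in C.vacuum_in)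

lemma graph_dilation: "p \<in> graph \<Longrightarrow> map_prod (V i) (VC i) p \<in> graph"
proof -
  assume p: "p \<in> graph"
  have "graph \<subseteq> map_prod (V i) (VC i) -` graph"
    unfolding graph_def
  proof (rule closure_span_minimal)
    show "gens \<subseteq> map_prod (V i) (VC i) -` closure (complex_vector.span gens)"
    proof
      fix q assume "q \<in> gens"
      then obtain w x where q: "q = (word_op V w ((x, 0), 0), word_op VC w (x, 0))" by (rule gensE)
      have "map_prod (V i) (VC i) q \<in> gens" using gensI[of "i # w" x] by (simp add: q)
      then show "q \<in> map_prod (V i) (VC i) -` closure (complex_vector.span gens)"
        using closure_span_superset by blast
    qed
  qed (intro closed_csubspace_vimage op_map_prod E.dilation_op C.dilation_op
      closed_csubspace_closure_span)
  then show ?thesis using p by blast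
qed

text \<open>The isometry from \<open>L\<close> to the dilation space of \<open>C\<close> takes the first vector to \<open>e\<^sub>w \<otimes> D\<^sub>C x\<close>.\<close>

definition defect_gen :: "'d list \<Rightarrow> 'c ^ 'd \<Rightarrow>
    (('c \<times> 'a) \<times> ('d, ('c \<times> 'a) ^ 'd) fock) \<times> 'c \<times> ('d, 'c ^ 'd) fock" where
  "defect_gen w x = (word_op V w ((0, row_op B x), single [] (E.D (vec_pair x 0))),
     (0, single w (C.D x)))"

lemma defect_gen_in: "defect_gen w x \<in> graph"
proof -
  have graph_sum: "(\<Sum>j\<in>F. p j) \<in> graph" if "\<And>j. p j \<in> graph" for p and F :: "'d set"
    using that by (induction F rule: infinite_finite_induct) (auto simp: csub_0[OF graph] csub_add[OF graph])
  have word: "(word_op V w ((y, 0), 0), word_op VC w (y, 0)) \<in> graph" for w y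
    using S_graph gensI by blast
  (* Subtracting the row of C in both components leaves the defect vectors and B x. *)
  let ?p = "(\<Sum>j\<in>UNIV. (V j ((x $ j, 0), 0), VC j (x $ j, 0)))
    - (((row_op C x, 0), 0), (row_op C x, 0))"
  have p_in: "map_prod (word_op V w) (word_op VC w) ?p \<in> graph"
  proof -
    have "?p \<in> graph"
      using word[of "[_]"] word[of "[]"] by (intro csub_diff[OF graph] graph_sum) simp_all
    then show ?thesis
    proof (induction w)
      case (Cons i w)
      then show ?case using graph_dilation by (fastforce simp: map_prod_def split: prod.split)
    qed (simp add: map_prod_def)
  qed
  have "(\<Sum>j\<in>UNIV. V j ((x $ j, 0), 0)) = (row_op E (vec_pair x 0), single [] (E.D (vec_pair x 0)))"
    using E.sum_dilation_diff[of "vec_pair x 0"] by simp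
  moreover have "row_op E (vec_pair x 0) = (row_op C x, row_op B x)"
    using op_0[OF closed_csubspace_UNIV A.op] by (simp add: row_op_lifting)
  ultimately have "?p = (((0, row_op B x), single [] (E.D (vec_pair x 0))), (0, single [] (C.D x)))"
    using C.sum_dilation_diff[of x]
    by (simp add: prod_eq_iff fst_sum snd_sum)
  then show ?thesis
    using p_in by (simp add: defect_gen_def C.word_dilation_single)
qed

text \<open>Minimality of the dilation of \<open>C\<close>: a vector orthogonal to all \<open>V\<^sup>C\<^sub>\<alpha> h\<close> has vanishing component in \<open>H\<^sub>C\<close>,
  and in every coordinate it is orthogonal to the range of \<open>D\<^sub>C\<close>.\<close>

lemma snd_graph: "snd ` graph = dilation_space C"
proof
  show "snd ` graph \<subseteq> dilation_space C" using graph_subset by auto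
  show "dilation_space C \<subseteq> snd ` graph"
  proof
    fix y assume y: "y \<in> dilation_space C"
    let ?P = "proj (snd ` graph)"
    obtain h f where hf: "y - ?P y = (h, f)" by fastforce
    have P: "?P y \<in> snd ` graph" by (rule proj_in[OF closed_snd_graph])
    then have "y - ?P y \<in> dilation_space C"
      using graph_subset by (intro csub_diff[OF C.closed_csubspace_dilation_space] y) auto
    then have f: "f \<in> fock_sub C.DX" by (simp add: hf dilation_space_def)
    have orth: "inner (snd p) (h, f) = 0" if "p \<in> graph" for p
      using proj_orth[OF closed_snd_graph, of "snd p" y] that by (simp add: hf)
    have "inner (k, 0) (h, f) = 0" for k
      using orth[of "(word_op V [] ((k, 0), 0), word_op VC [] (k, 0))"] S_graph gensI[of "[]" k]
      by auto
    from this[of h] have "h = 0" by simp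
    have "f = 0"
    proof (rule ell2_eqI)
      fix w
      show "coord f w = coord 0 w"
      proof (rule C.DX_eqI)
        show "inner (coord f w) (C.D x) = inner (coord 0 w) (C.D x)" for x
          using orth[OF defect_gen_in[of w x]]
          by (simp add: defect_gen_def inner_single coord_simps inner_commute[of "coord f w"])
      qed (use f csub_0[OF C.DX] in \<open>auto simp: fock_sub_def coord_simps\<close>)
    qed
    then have "y = ?P y" using hf \<open>h = 0\<close> by (simp add: prod_eq_iff)
    then show "y \<in> snd ` graph" using P by simp
  qed
qed

lemma L_in: "L \<subseteq> dilation_space E"
  using graph_subset by auto

lemma complement_iff:
  "k \<in> lifting_complement E \<longleftrightarrow> k \<in> dilation_space E \<and> (\<forall>l\<in>L. inner l k = 0)"
proof -
  have "cinner l k = 0" if orth: "\<forall>l\<in>L. inner l k = 0" and l: "l \<in> L" for l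
  proof -
    have "\<i> *\<^sub>C l \<in> L" by (rule csub_scaleC[OF closed_fst_graph l])
    then have "inner l k = 0" "inner (\<i> *\<^sub>C l) k = 0" using orth l by blast+
    then show ?thesis by (simp add: cinner_eq_Complex inner_scaleC_i complex_eq_iff)
  qed
  then have "(\<forall>l\<in>L. cinner l k = 0) \<longleftrightarrow> (\<forall>l\<in>L. inner l k = 0)"
    by (metis Re_cinner zero_complex.sel(1))
  then show ?thesis by (simp add: lifting_complement_def L_eq)
qed

text \<open>\<open>L\<close> reduces the dilation: \<open>V\<^sub>i k\<close> is orthogonal to the words by the isometry relations, and to
  \<open>H\<^sub>C\<close> because the upper component of \<open>E\<^sub>i\<close> only depends on the upper component of its argument,
  which is zero for \<open>k\<close>.\<close>

lemma complement_dilation: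
  assumes k: "k \<in> lifting_complement E"
  shows "V i k \<in> lifting_complement E"
proof -
  have orth: "inner (word_op V w ((x, 0), 0)) k = 0" for w x
  proof -
    have "word_op V w ((x, 0), 0) \<in> L" using S_graph gensI[of w x] by force
    then show ?thesis using k unfolding complement_iff by blast
  qed
  obtain a b f where kk: "k = ((a, b), f)" by (metis surj_pair)
  have "a = 0" using orth[of "[]" a] by (simp add: kk inner_prod_def)
  have "inner (V i k) (word_op V w ((x, 0), 0)) = 0" for w x
  proof (cases w)
    case Nil
    have "fst (fst (V i k)) = C i a" by (simp add: kk E.dilation_eq lifting_def)
    then show ?thesis
      using op_0[OF closed_csubspace_UNIV C.ops] by (simp add: Nil inner_prod_def \<open>a = 0\<close>)
  next
    case (Cons j v)
    then show ?thesis
      using orth[of v x] by (simp add: E.inner_dilation inner_commute)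
  qed
  then have gens: "inner l (V i k) = 0" if "l \<in> {word_op V w ((x, 0), 0) | w x. True}" for l
    using that by (auto simp: inner_commute)
  have scaled: "c *\<^sub>C (l :: ('c \<times> 'a) \<times> ('d, ('c \<times> 'a) ^ 'd) fock) \<in> range (\<lambda>c. c *\<^sub>C V i k)"
    if "l \<in> range (\<lambda>c. c *\<^sub>C V i k)" for c l
    using that by (auto simp: scaleC_scaleC)
  have "L \<subseteq> {l. \<forall>y\<in>range (\<lambda>c. c *\<^sub>C V i k). inner l y = 0}"
    unfolding L_eq
  proof (rule closure_span_minimal[OF _ closed_csubspace_orthogonal[OF scaled]])
    show "{word_op V w ((x, 0), 0) | w x. True} \<subseteq> {l. \<forall>y\<in>range (\<lambda>c. c *\<^sub>C V i k). inner l y = 0}"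
    proof (intro subsetI CollectI ballI)
      fix l y assume "l \<in> {word_op V w ((x, 0), 0) | w x. True}" "y \<in> range (\<lambda>c. c *\<^sub>C V i k)"
      then obtain w x c where l: "l = word_op V w ((x, 0), 0)" and y: "y = c *\<^sub>C V i k" by blast
      have "cnj c *\<^sub>C word_op V w ((x, 0), 0) = word_op V w ((cnj c *\<^sub>C x, 0), 0)"
        by (simp add: scaleC_Pair flip: op_scaleC[OF E.word_dilation_op UNIV_I])
      moreover have "inner (word_op V w ((cnj c *\<^sub>C x, 0), 0)) (V i k) = 0"
        by (rule gens) blast
      ultimately show "inner l y = 0"
        unfolding l y using inner_scaleC_left[of "cnj c" "word_op V w ((x, 0), 0)" "V i k"] by simp
    qed
  qed
  moreover have "V i k \<in> range (\<lambda>c. c *\<^sub>C V i k)"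
    by (rule image_eqI[of _ _ 1]) (simp_all add: scaleC_of_real[of 1, simplified])
  ultimately have "inner l (V i k) = 0" if "l \<in> L" for l using that by blast
  then show ?thesis
    using k E.dilation_in by (auto simp: complement_iff)
qed

abbreviation "P \<equiv> proj L"

lemma P_eqI: "l \<in> L \<Longrightarrow> k \<in> lifting_complement E \<Longrightarrow> P (l + k) = l"
  by (rule adj_unique[OF closed_fst_graph inclusion_op]) (auto simp: complement_iff inner_add_right)

lemma P_complement: "z \<in> dilation_space E \<Longrightarrow> z - P z \<in> lifting_complement E"
  using proj_in[OF closed_fst_graph, of z] L_in
  by (auto simp: complement_iff proj_orth[OF closed_fst_graph]
      intro!: csub_diff[OF E.closed_csubspace_dilation_space])

definition "wandering_unitary z = (isometry (P z), z - P z)"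

lemma isometry_P: "(P z, isometry (P z)) \<in> graph"
  by (rule isometry_graph) (rule proj_in[OF closed_fst_graph])

lemma isometry_add: "isometry (P (y + z)) = isometry (P y) + isometry (P z)"
  using csub_add[OF graph isometry_P isometry_P, of y z]
  by (intro isometry_unique) (simp add: op_add[OF proj_op[OF closed_fst_graph]])

lemma isometry_scaleC: "isometry (P (c *\<^sub>C z)) = c *\<^sub>C isometry (P z)"
  using csub_scaleC[OF graph isometry_P, of c z]
  by (intro isometry_unique) (simp add: op_scaleC[OF proj_op[OF closed_fst_graph]] scaleC_Pair)

lemma inner_wandering_unitary:
  "inner (wandering_unitary y) (wandering_unitary z) = inner y z"
proof -
  have "inner (P y) (z - P z) = 0" "inner (P z) (y - P y) = 0"
    using proj_orth[OF closed_fst_graph proj_in[OF closed_fst_graph]] by auto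
  moreover have "inner y z = inner (P y + (y - P y)) (P z + (z - P z))" by simp
  ultimately have "inner y z = inner (P y) (P z) + inner (y - P y) (z - P z)"
    by (simp only: inner_add_left inner_add_right) (simp add: inner_commute)
  then show ?thesis
    using graph_inner[OF isometry_P isometry_P, of y z] by (simp add: wandering_unitary_def)
qed

text \<open>Isometric on \<open>L\<close>, identical on the complement; the intertwining holds because \<open>L\<close> is reducing.\<close>

theorem lifting_unitary_exists: "lifting_unitary C E wandering_unitary"
  unfolding lifting_unitary_def
proof (intro conjI allI ballI)
  let ?W = wandering_unitary
  have add: "?W (y + z) = ?W y + ?W z" for y z
    by (simp only: wandering_unitary_def isometry_add)
      (simp add: op_add[OF proj_op[OF closed_fst_graph]])
  have scale: "?W (c *\<^sub>C z) = c *\<^sub>C ?W z" for c z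
    by (simp only: wandering_unitary_def isometry_scaleC)
      (simp add: op_scaleC[OF proj_op[OF closed_fst_graph]] scaleC_Pair
        complex_vector.scale_right_diff_distrib)
  have W_in: "?W z \<in> dilation_space C \<times> lifting_complement E" if "z \<in> dilation_space E" for z
    using P_complement[OF that] isometry_P[of z] graph_subset by (auto simp: wandering_unitary_def)
  have decompose: "?W (l + k) = (isometry l, k)" if "l \<in> L" "k \<in> lifting_complement E" for l k
    by (simp add: wandering_unitary_def P_eqI[OF that])
  show "unitary_op (dilation_space E) (dilation_space C \<times> lifting_complement E) ?W"
    unfolding unitary_op_def
  proof (intro conjI ballI)
    show "bounded_op (dilation_space E) (dilation_space C \<times> lifting_complement E) ?W"
      by (rule op_intro[where K=1])
        (simp_all only: W_in add scale, simp add: norm_eq_sqrt_inner inner_wandering_unitary)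
    show "cinner (?W y) (?W z) = cinner y z" for y z
      by (simp add: cinner_eq_Complex inner_wandering_unitary flip: scale)
    show "?W ` dilation_space E = dilation_space C \<times> lifting_complement E"
    proof
      show "?W ` dilation_space E \<subseteq> dilation_space C \<times> lifting_complement E" using W_in by blast
      show "dilation_space C \<times> lifting_complement E \<subseteq> ?W ` dilation_space E"
      proof safe
        fix h f k assume y: "(h, f) \<in> dilation_space C" and k: "k \<in> lifting_complement E"
        obtain l where l: "(l, (h, f)) \<in> graph" using y unfolding snd_graph[symmetric] by auto
        then have "l \<in> L" by force
        then have "?W (l + k) = ((h, f), k)" using decompose k isometry_unique[OF l] by simp
        moreover have "l + k \<in> dilation_space E"
          using \<open>l \<in> L\<close> L_in k
          by (intro csub_add[OF E.closed_csubspace_dilation_space]) (auto simp: complement_iff)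
        ultimately show "((h, f), k) \<in> ?W ` dilation_space E" by (metis imageI)
      qed
    qed
  qed
  have zero: "0 \<in> lifting_complement E"
    by (simp add: complement_iff csub_0[OF E.closed_csubspace_dilation_space])
  show "?W ((x, 0), 0) = ((x, 0), 0)" for x
  proof -
    have *: "(((x, 0), 0), (x, 0)) \<in> graph"
      using S_graph gensI[of "[]" x] by auto
    then have "((x, 0), 0) \<in> L" by force
    then show ?thesis using decompose[OF _ zero] isometry_unique[OF *] by simp
  qed
  fix i z assume z: "z \<in> dilation_space E"
  have *: "(V i (P z), VC i (isometry (P z))) \<in> graph"
    using graph_dilation[OF isometry_P] by simp
  then have "V i (P z) \<in> L" by force
  moreover have "V i (z - P z) \<in> lifting_complement E"
    by (intro complement_dilation P_complement z)
  moreover have "V i z = V i (P z) + V i (z - P z)"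
    by (simp flip: op_add[OF E.dilation_op])
  ultimately have "?W (V i z) = (VC i (isometry (P z)), V i (z - P z))"
    using decompose isometry_unique[OF *] by simp
  then show "?W (V i z) = map_prod (VC i) (V i) (?W z)"
    by (simp add: wandering_unitary_def)
qed

text \<open>Every admissible \<open>W\<close> maps \<open>V\<^sup>E\<^sub>\<alpha> h\<close> to \<open>V\<^sup>C\<^sub>\<alpha> h\<close>. So the inner product of \<open>W (0 \<oplus> f)\<close> with \<open>e\<^sub>w \<otimes> D\<^sub>C x\<close>
  is that of \<open>f\<close> with the preimage of \<open>e\<^sub>w \<otimes> D\<^sub>C x\<close>, which the states of \<open>E\<close> evaluate.\<close>

theorem char_lifting_weak:
  assumes f: "f \<in> fock_sub E.DX"
  shows "char_lifting C E f \<in> fock_sub C.DX"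
    and "inner (coord (char_lifting C E f) w) (C.D x)
      = inner (state 1 E (coord f) w) (0, row_op B x) + inner (coord f w) (E.D (vec_pair x 0))"
proof -
  define W where "W = (SOME W. lifting_unitary C E W)"
  have W: "lifting_unitary C E W"
    unfolding W_def by (rule someI[of _ wandering_unitary]) (rule lifting_unitary_exists)
  have unit: "unitary_op (dilation_space E) (dilation_space C \<times> lifting_complement E) W"
    and W_init: "W ((x, 0), 0) = ((x, 0), 0)"
    and W_dil: "z \<in> dilation_space E \<Longrightarrow> W (V i z) = map_prod (VC i) (V i) (W z)" for x i z
    using W by (auto simp: lifting_unitary_def)
  have op: "bounded_op (dilation_space E) (dilation_space C \<times> lifting_complement E) W"
    using unit by (simp add: unitary_op_def)
  have W_word: "W (word_op V w ((x, 0), 0)) = (word_op VC w (x, 0), 0)" for w x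
    by (induction w)
      (simp_all add: W_init zero_prod_def[symmetric] W_dil E.word_dilation_in E.vacuum_in
        op_0[OF closed_csubspace_UNIV E.dilation_op])
  have z: "(0, f) \<in> dilation_space E" using f by (simp add: dilation_space_def)
  define y where "y = fst (W (0, f))"
  have y: "y \<in> dilation_space C" using op_in[OF op z] by (auto simp: y_def)
  have char: "char_lifting C E f = snd y" by (simp add: char_lifting_def y_def W_def)
  show "char_lifting C E f \<in> fock_sub C.DX"
    using y by (auto simp: char dilation_space_def)
  define q0 :: "(('c \<times> 'a) \<times> ('d, ('c \<times> 'a) ^ 'd) fock) \<times> 'c \<times> ('d, 'c ^ 'd) fock"
    where "q0 = ((0, f), - y)"
  have gens: "inner q0 p = 0" if "p \<in> gens" for p
  proof -
    obtain v x where p: "p = (word_op V v ((x, 0), 0), word_op VC v (x, 0))"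
      using \<open>p \<in> gens\<close> by (rule gensE)
    have "cinner (W (0, f)) (W (word_op V v ((x, 0), 0))) = cinner (0, f) (word_op V v ((x, 0), 0))"
      using unit z E.word_dilation_in[OF E.vacuum_in] by (simp add: unitary_op_def)
    then have "inner (W (0, f)) (W (word_op V v ((x, 0), 0))) = inner (0, f) (word_op V v ((x, 0), 0))"
      by (metis Re_cinner)
    moreover have "inner (W (0, f)) (q, 0) = inner y q" for q
      by (simp add: y_def inner_prod_def)
    ultimately show ?thesis by (simp add: q0_def p W_word inner_minus_left)
  qed
  have scaled: "c *\<^sub>C q \<in> range (\<lambda>c. c *\<^sub>C q0)"
    if "q \<in> range (\<lambda>c. c *\<^sub>C q0)" for c q
    using that by (auto simp: scaleC_scaleC)
  have "graph \<subseteq> {p. \<forall>q\<in>range (\<lambda>c. c *\<^sub>C q0). inner p q = 0}"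
    unfolding graph_def
  proof (rule closure_span_minimal[OF _ closed_csubspace_orthogonal[OF scaled]])
    show "gens \<subseteq> {p. \<forall>q\<in>range (\<lambda>c. c *\<^sub>C q0). inner p q = 0}"
    proof (intro subsetI CollectI ballI)
      fix p q assume "p \<in> gens" and "q \<in> range (\<lambda>c. c *\<^sub>C q0)"
      then obtain c where q: "q = c *\<^sub>C q0" by blast
      have "inner q0 (cnj c *\<^sub>C p) = 0" using \<open>p \<in> gens\<close> by (intro gens scale)
      then show "inner p q = 0"
        unfolding q using inner_scaleC_left[of "cnj c" p "q0"]
        by (simp only: complex_cnj_cnj inner_commute)
    qed
  qed
  moreover have "q0 \<in> range (\<lambda>c. c *\<^sub>C q0)"
    by (rule image_eqI[of _ _ 1]) (simp_all add: scaleC_of_real[of 1, simplified])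
  ultimately have "inner (defect_gen w x) q0 = 0"
    using defect_gen_in[of w x] by blast
  then have "inner (snd y) (single w (C.D x))
      = inner f (snd (word_op V w ((0, row_op B x), single [] (E.D (vec_pair x 0)))))"
    by (simp add: q0_def defect_gen_def inner_prod_def inner_commute)
  also have "((0 :: 'c, row_op B x), single [] (E.D (vec_pair x 0)))
      = ((0 :: 'c, row_op B x), 0) + (0, single [] (E.D (vec_pair x 0)))"
    by simp
  finally have "inner (snd y) (single w (C.D x))
      = inner (state 1 E (coord f) w) (0, row_op B x) + inner f (single w (E.D (vec_pair x 0)))"
    by (simp only: op_add[OF E.word_dilation_op UNIV_I UNIV_I] E.word_dilation_single snd_add
        snd_conv inner_add_right E.inner_word_dilation)
  then show "inner (coord (char_lifting C E f) w) (C.D x)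
      = inner (state 1 E (coord f) w) (0, row_op B x) + inner (coord f w) (E.D (vec_pair x 0))"
    using inner_single[of w "C.D x" "snd y"] inner_single[of w "E.D (vec_pair x 0)" f]
    by (simp only: char inner_commute[of _ "single _ _"]) (simp only: inner_commute)
qed

end

lemma unitary_inner: "unitary_op X Y U \<Longrightarrow> x \<in> X \<Longrightarrow> y \<in> X \<Longrightarrow> inner (U x) (U y) = inner x y"
  unfolding unitary_op_def by (metis Re_cinner)

text \<open>The theorem involves two liftings of this kind: of \<open>A\<close> by \<open>A'\<close>, and of \<open>C\<close> by the tuple of block
  operators obtained from the first.\<close>

locale defect_lifting = row_lifting C B A
  for C :: "'d::finite \<Rightarrow> 'c \<Rightarrow> 'c::complex_hilbert" and B
    and A :: "'d \<Rightarrow> 'a \<Rightarrow> 'a::complex_hilbert" +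
  fixes \<gamma> :: "'a \<Rightarrow> 'c ^ 'd" and \<sigma> :: "('c \<times> 'a) ^ 'd \<Rightarrow> ('c ^ 'd) \<times> ('a ^ 'd)"
  assumes \<gamma>: "contraction (row_codefect_space A) (row_defect_space C) \<gamma>"
    and B_eq: "row_op B x = row_codefect A (adj (row_codefect_space A) \<gamma> (row_defect C x))"
    and \<sigma>: "unitary_op (row_defect_space (lifting C B A))
      (codefect_space (row_codefect_space A) (row_defect_space C) \<gamma> \<times> row_defect_space A) \<sigma>"
    and \<sigma>_eq: "\<sigma> (row_defect (lifting C B A) (vec_pair x y)) =
      (codefect (row_codefect_space A) (row_defect_space C) \<gamma> (row_defect C x),
       - adj UNIV (row_op A) (adj (row_codefect_space A) \<gamma> (row_defect C x)) + row_defect A y)"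
begin

sublocale G: contraction_op "row_codefect_space A" "row_defect_space C" \<gamma>
  by unfold_locales (rule A.DY C.DX \<gamma>)+

lemma \<sigma>_op: "bounded_op E.DX (G.DY \<times> A.DX) \<sigma>"
  using \<sigma> by (simp add: unitary_op_def)

lemma \<sigma>_in: "f \<in> E.DX \<Longrightarrow> fst (\<sigma> f) \<in> G.DY" "f \<in> E.DX \<Longrightarrow> snd (\<sigma> f) \<in> A.DX"
  using op_in[OF \<sigma>_op] by (auto simp: mem_Times_iff)

lemma \<sigma>_in_C: "f \<in> E.DX \<Longrightarrow> fst (\<sigma> f) \<in> C.DX"
  using \<sigma>_in G.DY_subset by blast

lemma Ds_A: "A.Ds s \<in> A.DY"
  by (rule A.Ds_DY) simp

lemma E_Ta: "E.Ta s = vec_pair (C.Ta (fst s) + C.D (\<gamma> (A.Ds (snd s)))) (A.Ta (snd s))"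
proof (rule adj_unique[OF closed_csubspace_UNIV E.op])
  fix z :: "('c \<times> 'a) ^ 'd"
  obtain x y where z: "z = vec_pair x y" by (rule vec_pair_surj)
  have "inner (row_op B x) (snd s) = inner (G.Ta (C.D x)) (A.Ds (snd s))"
    by (simp add: B_eq A.Ds_sym)
  also have "\<dots> = inner (C.D x) (\<gamma> (A.Ds (snd s)))"
    by (rule G.Ta_inner_left[OF Ds_A])
  also have "\<dots> = inner x (C.D (\<gamma> (A.Ds (snd s))))" by (simp add: C.D_sym)
  finally show "inner (row_op E z) s
      = inner z (vec_pair (C.Ta (fst s) + C.D (\<gamma> (A.Ds (snd s)))) (A.Ta (snd s)))"
    by (cases s) (simp add: z row_op_lifting inner_vec_pair inner_add_left inner_add_right
        C.Ta_inner A.Ta_inner)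
qed simp

text \<open>The adjoint of the formula for \<open>\<sigma> D\<^sub>E\<close>.\<close>

lemma E_D:
  assumes f: "f \<in> E.DX" and pq: "\<sigma> f = (p, q)"
  shows "E.D f = vec_pair (C.D (G.Ds p) - C.D (\<gamma> (row_op A q))) (A.D q)"
proof -
  have p: "p \<in> C.DX" and q: "q \<in> A.DX" using \<sigma>_in_C[OF f] \<sigma>_in(2)[OF f] by (simp_all add: pq)
  have "inner (E.D f) z = inner (vec_pair (C.D (G.Ds p) - C.D (\<gamma> (row_op A q))) (A.D q)) z" for z
  proof -
    obtain x y where z: "z = vec_pair x y" by (rule vec_pair_surj)
    define d where "d = C.D x"
    have d: "d \<in> C.DX" by (simp add: d_def C.D_DX)
    have "inner (E.D f) z = inner f (E.D z)" by (simp add: E.D_sym)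
    also have "\<dots> = inner (\<sigma> f) (\<sigma> (E.D z))"
      using unitary_inner[OF \<sigma> f E.D_DX[OF UNIV_I]] by simp
    also have "\<dots> = inner p (G.Ds d) - inner q (A.Ta (G.Ta d)) + inner q (A.D y)"
      by (simp add: z \<sigma>_eq pq d_def inner_add_right inner_minus_right inner_diff_right)
    also have "inner p (G.Ds d) = inner (C.D (G.Ds p)) x"
      using G.Ds_sym[OF p d] by (simp add: d_def C.D_sym)
    also have "inner q (A.Ta (G.Ta d)) = inner (row_op A q) (G.Ta d)"
      by (simp add: A.Ta_inner)
    also have "\<dots> = inner (C.D (\<gamma> (row_op A q))) x"
      by (simp add: G.Ta_inner[OF A.T_DX[OF q], symmetric] d_def C.D_sym)
    finally show ?thesis
      by (simp add: z inner_vec_pair inner_diff_left A.D_sym)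
  qed
  then show ?thesis using vector_eq_rdot by blast
qed

context
  fixes f :: "'d list \<Rightarrow> ('c \<times> 'a) ^ 'd"
  assumes f: "f w \<in> E.DX"
begin

abbreviation "lower_response \<equiv> response 1 A (\<lambda>w. snd (\<sigma> (f w)))"

lemma lower_response: "lower_response w \<in> A.DY"
  unfolding response_def
  by (intro csub_diff[OF A.DY] Ds_A A.T_DX \<sigma>_in f)

lemma \<gamma>_lower_response:
  "\<gamma> (lower_response w) = \<gamma> (A.Ds (state 1 A (\<lambda>w. snd (\<sigma> (f w))) w)) - \<gamma> (row_op A (snd (\<sigma> (f w))))"
  unfolding response_def
  by (intro op_diff[OF A.DY G.op] Ds_A A.T_DX \<sigma>_in f)

text \<open>The system of \<open>A\<close> runs by itself, and its response feeds the system of \<open>C\<close>: in the upper component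
  of the recursion for \<open>E\<close> the terms with \<open>\<gamma>\<close> combine to the response of \<open>A\<close>.\<close>

lemma state_lifting:
  "state 1 E f w =
    (state 1 C (\<lambda>w. G.Ds (fst (\<sigma> (f w))) + \<gamma> (lower_response w)) w,
     state 1 A (\<lambda>w. snd (\<sigma> (f w))) w)"
proof (induction w rule: rev_induct)
  case (snoc j u)
  let ?p = "fst (\<sigma> (f u))" and ?q = "snd (\<sigma> (f u))" and ?s = "A.Ds (state 1 A (\<lambda>w. snd (\<sigma> (f w))) u)"
  have "C.D (\<gamma> ?s) + (C.D (G.Ds ?p) - C.D (\<gamma> (row_op A ?q))) = C.D (G.Ds ?p + \<gamma> (lower_response u))"
    by (simp add: \<gamma>_lower_response linear_add[OF C.lin(2)] linear_diff[OF C.lin(2)])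
  from arg_cong[OF this, of "\<lambda>v. v $ j"] show ?case
    unfolding state_snoc snoc E_Ta E_D[OF f prod.collapse[symmetric]]
    by (simp add: add.assoc)
qed (simp add: state_Nil zero_prod_def)

end

text \<open>Both sides have the same inner products with all \<open>D\<^sub>C x\<close>, by the weak formula and the splitting of
  the lower component of the state.\<close>

theorem coord_char_lifting:
  assumes f: "f \<in> fock_sub E.DX"
  shows "coord (char_lifting C E f) w =
    G.Ds (fst (\<sigma> (coord f w))) + \<gamma> (response 1 A (\<lambda>w. snd (\<sigma> (coord f w))) w)"
proof (rule C.DX_eqI)
  have f_in: "\<And>w. coord f w \<in> E.DX" using f by (simp add: fock_sub_def)
  let ?p = "fst (\<sigma> (coord f w))" and ?q = "snd (\<sigma> (coord f w))"
  let ?s = "state 1 A (\<lambda>w. snd (\<sigma> (coord f w))) w"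
  let ?m = "response 1 A (\<lambda>w. snd (\<sigma> (coord f w))) w"
  have m: "?m \<in> A.DY" by (rule lower_response) (rule f_in)
  show "coord (char_lifting C E f) w \<in> C.DX"
    using char_lifting_weak(1)[OF f] by (simp add: fock_sub_def)
  show "G.Ds ?p + \<gamma> ?m \<in> C.DX"
    by (intro csub_add[OF C.DX] op_in[OF G.Ds_op] op_in[OF G.op] m \<sigma>_in_C f_in)
  fix x
  define d where "d = C.D x"
  have d: "d \<in> C.DX" by (simp add: d_def C.D_DX)
  have "inner (coord f w) (E.D (vec_pair x 0)) = inner (\<sigma> (coord f w)) (\<sigma> (E.D (vec_pair x 0)))"
    using unitary_inner[OF \<sigma> f_in E.D_DX[OF UNIV_I]] by simp
  also have "\<dots> = inner ?p (G.Ds d) - inner ?q (A.Ta (G.Ta d))"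
    by (simp add: \<sigma>_eq d_def inner_prod_def linear_0[OF A.lin(2)])
  also have "\<dots> = inner (G.Ds ?p) d - inner (row_op A ?q) (G.Ta d)"
    by (simp add: G.Ds_sym[OF \<sigma>_in_C[OF f_in] d] A.Ta_inner)
  finally have 1: "inner (coord f w) (E.D (vec_pair x 0))
    = inner (G.Ds ?p) d - inner (row_op A ?q) (G.Ta d)" .
  have "inner (state 1 E (coord f) w) (0, row_op B x) = inner ?s (A.Ds (G.Ta d))"
    by (simp add: state_lifting[OF f_in] B_eq d_def)
  also have "\<dots> = inner (A.Ds ?s) (G.Ta d)" by (simp add: A.Ds_sym)
  finally have 2: "inner (state 1 E (coord f) w) (0, row_op B x) = inner (A.Ds ?s) (G.Ta d)" .
  have "inner (\<gamma> ?m) d = inner ?m (G.Ta d)" by (rule G.Ta_inner[OF m])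
  also have "\<dots> = inner (A.Ds ?s) (G.Ta d) - inner (row_op A ?q) (G.Ta d)"
    by (simp add: response_def inner_diff_left)
  finally show "inner (coord (char_lifting C E f) w) (C.D x) = inner (G.Ds ?p + \<gamma> ?m) (C.D x)"
    using 1 2 char_lifting_weak(2)[OF f, of w x] by (simp add: inner_add_left d_def)
qed

section \<open>Factorization along a lifting\<close>

context
  fixes \<sigma>' :: "'c \<times> 'a \<Rightarrow> 'c \<times> 'a"
  assumes \<sigma>': "unitary_op E.DY (C.DY \<times> G.DX) \<sigma>'"
    and \<sigma>'_eq: "\<And>x y. \<sigma>' (E.Ds (x, y)) = (C.Ds x - row_op C (\<gamma> (A.Ds y)), G.D (A.Ds y))"
begin

lemma \<sigma>'_op: "bounded_op E.DY (C.DY \<times> G.DX) \<sigma>'"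
  using \<sigma>' by (simp add: unitary_op_def)

text \<open>The row of \<open>E\<close> takes \<open>D\<^sub>E z\<close> into the range of \<open>D\<^sub>*\<^sub>,\<^sub>E\<close>, where \<open>\<sigma>'\<close> is given.\<close>

lemma \<sigma>'_row_dense:
  assumes pq: "\<sigma> (E.D z) = (p, q)"
  shows "\<sigma>' (row_op E (E.D z)) =
    (row_op C (G.Ds p) - row_op C (\<gamma> (row_op A q)), G.D (row_op A q) + G.Ta p)"
proof -
  obtain x y where z: "z = vec_pair x y" by (rule vec_pair_surj)
  define d b where "d = C.D x" and "b = G.Ta d"
  have d: "d \<in> C.DX" by (simp add: d_def C.D_DX)
  have b: "b \<in> A.DY" by (simp add: b_def G.Ta_in)
  have p: "p = G.Ds d" and q: "q = - A.Ta b + A.D y"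
    using pq by (simp_all add: z \<sigma>_eq d_def b_def)
  have "q \<in> A.DX" using \<sigma>_in(2)[OF E.D_DX[OF UNIV_I], of z] by (simp add: pq)
  then have Aq: "row_op A q \<in> A.DY" by (rule A.T_DX)
  define y' where "y' = A.Ds b + row_op A y"
  have "A.Ds y' = A.Ds (A.Ds b) + A.Ds (row_op A y)"
    by (simp add: y'_def linear_add[OF A.lin(3)])
  also have "\<dots> = b + row_op A q"
    by (simp add: A.Ds_square q linear_diff[OF A.lin(4)] A.T_D)
  finally have y': "A.Ds y' = b + row_op A q" .
  have "row_op E (E.D z) = E.Ds (row_op C x, y')"
    by (simp add: E.T_D z row_op_lifting B_eq y'_def b_def d_def)
  then have "\<sigma>' (row_op E (E.D z)) = (C.Ds (row_op C x) - row_op C (\<gamma> (A.Ds y')), G.D (A.Ds y'))"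
    by (simp add: \<sigma>'_eq)
  also have "\<dots> = (row_op C d - row_op C (\<gamma> b) - row_op C (\<gamma> (row_op A q)), G.D b + G.D (row_op A q))"
    by (simp add: y' C.T_D[symmetric] d_def[symmetric] op_add[OF G.op b Aq] op_add[OF G.D_op b Aq]
        linear_add[OF C.lin(4)])
  also have "row_op C d - row_op C (\<gamma> b) = row_op C (G.Ds p)"
    by (simp add: p b_def G.Ds_square[OF d] linear_diff[OF C.lin(4)])
  also have "G.D b = G.Ta p" by (simp add: b_def p G.Ta_Ds[OF d])
  finally show ?thesis by (simp add: add.commute)
qed

lemma \<sigma>'_row:
  assumes f: "f \<in> E.DX"
  shows "\<sigma>' (row_op E f) =
    (row_op C (G.Ds (fst (\<sigma> f))) - row_op C (\<gamma> (row_op A (snd (\<sigma> f)))),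
     G.D (row_op A (snd (\<sigma> f))) + G.Ta (fst (\<sigma> f)))"
proof (rule eq_on_closure[of E.DX _ _ "range E.D"])
  show "f \<in> closure (range E.D)" using f by (simp add: defect_space_def)
  show "closure (range E.D) \<subseteq> E.DX" by (simp add: defect_space_def)
  show "\<sigma>' (row_op E x) = (row_op C (G.Ds (fst (\<sigma> x))) - row_op C (\<gamma> (row_op A (snd (\<sigma> x)))),
     G.D (row_op A (snd (\<sigma> x))) + G.Ta (fst (\<sigma> x)))" if "x \<in> range E.D" for x
    using that \<sigma>'_row_dense[OF prod.collapse[symmetric]] by blast
  have row_A: "bounded_op A.DX A.DY (row_op A)"
    using A.T_DX op_restrict[OF A.op, of A.DX] by (simp add: bounded_op_def)
  have row_E: "bounded_op E.DX E.DY (row_op E)"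
    using E.T_DX op_restrict[OF E.op, of E.DX] by (simp add: bounded_op_def)
  note fst_op = op_comp[OF \<sigma>_op op_fst] and snd_op = op_comp[OF op_comp[OF \<sigma>_op op_snd] row_A]
  show "continuous_on E.DX (\<lambda>x. \<sigma>' (row_op E x))"
    by (rule op_continuous[OF E.DX op_comp[OF row_E \<sigma>'_op]])
  have 1: "bounded_op E.DX UNIV (\<lambda>x. row_op C (G.Ds (fst (\<sigma> x))) + - row_op C (\<gamma> (row_op A (snd (\<sigma> x)))))"
    by (intro op_plus op_uminus
        op_comp[OF op_comp[OF fst_op op_restrict[OF G.Ds_op G.DY_subset]] op_restrict[OF C.op]]
        op_comp[OF op_comp[OF snd_op G.op] op_restrict[OF C.op]]) auto
  have 2: "bounded_op E.DX UNIV (\<lambda>x. G.D (row_op A (snd (\<sigma> x))) + G.Ta (fst (\<sigma> x)))"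
    by (intro op_plus op_mono[OF op_comp[OF snd_op G.D_op]]
        op_mono[OF op_comp[OF fst_op op_restrict[OF G.Ta_op]]]) auto
  show "continuous_on E.DX (\<lambda>x. (row_op C (G.Ds (fst (\<sigma> x))) - row_op C (\<gamma> (row_op A (snd (\<sigma> x)))),
     G.D (row_op A (snd (\<sigma> x))) + G.Ta (fst (\<sigma> x))))"
    using op_continuous[OF E.DX op_Pair[OF 1 2]] by simp
qed

context
  fixes f :: "'d list \<Rightarrow> ('c \<times> 'a) ^ 'd" and m and w :: "'d list"
  assumes f: "\<And>w. f w \<in> E.DX"
    and m: "m = response 1 A (\<lambda>w. snd (\<sigma> (f w)))"
begin

lemma \<sigma>'_response: "\<sigma>' (response 1 E f w) =
  (response 1 C (\<lambda>w. G.Ds (fst (\<sigma> (f w))) + \<gamma> (m w)) w, - G.Ta (fst (\<sigma> (f w))) + G.D (m w))"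
proof -
  let ?p = "fst (\<sigma> (f w))" and ?q = "snd (\<sigma> (f w))"
  let ?s2 = "state 1 A (\<lambda>w. snd (\<sigma> (f w))) w"
  let ?u = "\<lambda>w. G.Ds (fst (\<sigma> (f w))) + \<gamma> (m w)"
  have in_DY: "E.Ds (state 1 E f w) \<in> E.DY" "row_op E (f w) \<in> E.DY"
    using E.Ds_DY E.T_DX f by auto
  have Gm: "G.D (m w) = G.D (A.Ds ?s2) - G.D (row_op A ?q)"
    unfolding m response_def
    by (intro op_diff[OF A.DY G.D_op] Ds_A A.T_DX \<sigma>_in f)
  have "\<sigma>' (response 1 E f w) = \<sigma>' (E.Ds (state 1 E f w)) - \<sigma>' (row_op E (f w))"
    unfolding response_def by (rule op_diff[OF E.DY \<sigma>'_op in_DY])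
  also have "\<dots> = (C.Ds (state 1 C ?u w) - row_op C (\<gamma> (A.Ds ?s2))
      - (row_op C (G.Ds ?p) - row_op C (\<gamma> (row_op A ?q))),
      G.D (A.Ds ?s2) - (G.D (row_op A ?q) + G.Ta ?p))"
    unfolding \<sigma>'_row[OF f] state_lifting[of f, OF f] m[symmetric] \<sigma>'_eq by simp
  also have "\<dots> = (response 1 C ?u w, - G.Ta ?p + G.D (m w))"
    using \<gamma>_lower_response[of f w, OF f, folded m]
    by (simp add: response_def[of 1 C] Gm linear_add[OF C.lin(4)] linear_diff[OF C.lin(4)])
  finally show ?thesis .
qed

text \<open>This is the factorization of the characteristic function of \<open>E\<close> through those of \<open>A\<close> and \<open>C\<close> in
  coordinates.\<close>

theorem response_lifting:
  "inv_into E.DY \<sigma>' (response 1 C (\<lambda>w. G.Ds (fst (\<sigma> (f w))) + \<gamma> (m w)) w,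
     - G.Ta (fst (\<sigma> (f w))) + G.D (m w)) = response 1 E f w"
proof -
  have "inj_on \<sigma>' E.DY"
  proof (rule inj_onI)
    fix x y assume x: "x \<in> E.DY" and y: "y \<in> E.DY" and "\<sigma>' x = \<sigma>' y"
    then have "\<sigma>' (x - y) = 0" by (simp add: op_diff[OF E.DY \<sigma>'_op])
    then have "inner (x - y) (x - y) = 0"
      using unitary_inner[OF \<sigma>' csub_diff[OF E.DY x y] csub_diff[OF E.DY x y]] by simp
    then show "x = y" by simp
  qed
  moreover have "response 1 E f w \<in> E.DY"
    unfolding response_def by (intro csub_diff[OF E.DY] E.Ds_DY E.T_DX f) simp
  ultimately show ?thesis
    unfolding \<sigma>'_response[symmetric] by (rule inv_into_f_f)
qed

end

end

end

text \<open>The families \<open>g1\<close> to \<open>g6\<close> are the intermediate results on the right-hand side, from right to left.\<close>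

lemma char_lifting_factorization:
  fixes C :: "'d::finite \<Rightarrow> 'c::complex_hilbert \<Rightarrow> 'c"
    and A :: "'d \<Rightarrow> 'a::complex_hilbert \<Rightarrow> 'a"
    and A' :: "'d \<Rightarrow> 'b::complex_hilbert \<Rightarrow> 'b"
    and B2 :: "'d \<Rightarrow> 'a \<Rightarrow> 'b"
    and Bhat :: "'d \<Rightarrow> 'c \<Rightarrow> 'a \<times> 'b"
  defines "Ahat \<equiv> lifting A B2 A'" and "E' \<equiv> lifting C Bhat (lifting A B2 A')"
  assumes outer: "defect_lifting C Bhat (lifting A B2 A') \<gamma> \<sigma>E"
    and inner: "defect_lifting A B2 A' \<delta> \<sigma>"
    and \<sigma>': "unitary_op (row_codefect_space Ahat)
      (row_codefect_space A \<times> defect_space (row_codefect_space A') \<delta>) \<sigma>'"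
    and \<sigma>'_eq: "\<And>x y. \<sigma>' (row_codefect Ahat (x, y)) =
      (row_codefect A x - row_op A (\<delta> (row_codefect A' y)),
       defect (row_codefect_space A') \<delta> (row_codefect A' y))"
  shows "char_lifting C E' \<circ> amp (row_defect E') =
      amp (\<lambda>(u, v). codefect (row_codefect_space Ahat) (row_defect_space C) \<gamma> u + \<gamma> v)
      \<circ> fock_diag id (amp (inv_into (row_codefect_space Ahat) \<sigma>'))
      \<circ> fock_diag id (fock_diag (char_fun A) id)
      \<circ> amp (\<lambda>(u, p, q).
          (u,
           codefect (row_codefect_space A') (row_defect_space A) \<delta> p + \<delta> q,
           - adj (row_codefect_space A') \<delta> p + defect (row_codefect_space A') \<delta> q))
      \<circ> fock_diag id (fock_diag id (char_fun A'))
      \<circ> fock_diag id (amp \<sigma>)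
      \<circ> amp (\<sigma>E \<circ> row_defect E')"
proof (rule ext)
  fix g :: "('d, ('c \<times> 'a \<times> 'b) ^ 'd) fock"
  interpret K: defect_lifting C Bhat "lifting A B2 A'" \<gamma> \<sigma>E by (rule outer)
  interpret H: defect_lifting A B2 A' \<delta> \<sigma> by (rule inner)
  note [simp] = Ahat_def E'_def coord_fock_diag coord_amp_fst coord_amp_snd
  define f where "f = amp K.E.D g"
  have f: "coord f w = K.E.D (coord g w)" for w
    unfolding f_def by (rule K.E.coord_amp_row)
  have f_in: "coord f w \<in> K.E.DX" for w by (simp add: f K.E.D_DX)
  define p q where "p w = fst (\<sigma>E (coord f w))" and "q w = snd (\<sigma>E (coord f w))" for w
  have p_in: "p w \<in> K.C.DX" and q_in: "q w \<in> K.A.DX" for w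
    using K.\<sigma>_in_C[OF f_in] K.\<sigma>_in(2)[OF f_in] by (simp_all add: p_def q_def)
  define s t where "s w = fst (\<sigma> (q w))" and "t w = snd (\<sigma> (q w))" for w
  have s_in: "s w \<in> H.C.DX" for w
    using H.\<sigma>_in_C[OF q_in] by (simp add: s_def)
  define m where "m = response 1 A' t"
  then have m_eq: "m = response 1 A' (\<lambda>w. snd (\<sigma> (q w)))" by (simp add: t_def[abs_def])
  have m_in: "m w \<in> H.A.DY" for w
    using H.lower_response[of q, OF q_in] by (simp add: m_def t_def[abs_def])
  let ?a = "\<lambda>w. H.G.Ds (s w) + \<delta> (m w)"
  define g1 where "g1 = amp (\<sigma>E \<circ> K.E.D) g"
  have g1: "coord g1 w = (p w, q w)" for w
  proof -
    have "bounded_op UNIV K.E.DX K.E.D"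
      using K.E.D_op K.E.D_DX by (simp add: bounded_op_def)
    then have "bounded_op UNIV (K.G.DY \<times> K.A.DX) (\<sigma>E \<circ> K.E.D)"
      unfolding comp_def by (rule op_comp[OF _ K.\<sigma>_op])
    then show ?thesis
      unfolding g1_def by (simp add: coord_amp_UNIV p_def q_def f)
  qed
  define g2 where "g2 = fock_diag id (amp \<sigma>) g1"
  have g2: "coord g2 w = (p w, s w, t w)" for w
  proof -
    have "coord (amp \<sigma> (amp snd g1)) w = \<sigma> (coord (amp snd g1) w)"
      by (rule coord_amp_op[OF H.\<sigma>_op]) (simp add: fock_sub_def g1 q_in)
    then show ?thesis by (simp add: g2_def g1 s_def t_def)
  qed
  define g3 where "g3 = fock_diag id (fock_diag id (char_fun A')) g2"
  have g3: "coord g3 w = (p w, s w, m w)" for w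
  proof -
    have "coord (amp snd (amp snd g2)) = t" by (simp add: fun_eq_iff g2)
    then show ?thesis by (simp add: g3_def g2 H.A.coord_char_fun m_def)
  qed
  define T where "T = (\<lambda>(u :: 'c ^ 'd, p, q). (u, H.G.Ds p + \<delta> q, - H.G.Ta p + H.G.D q))"
  define g4 where "g4 = amp T g3"
  have g4: "coord g4 w = (p w, ?a w, - H.G.Ta (s w) + H.G.D (m w))" for w
  proof -
    let ?X = "UNIV \<times> H.C.DX \<times> H.A.DY"
    have 1: "bounded_op ?X H.C.DX (\<lambda>z. fst (snd z))" and 2: "bounded_op ?X H.A.DY (\<lambda>z. snd (snd z))"
      by (rule op_comp[OF op_snd op_fst], rule op_comp[OF op_snd op_snd])
    have "bounded_op ?X UNIV (\<lambda>z. (fst z, H.G.Ds (fst (snd z)) + \<delta> (snd (snd z)),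
        - H.G.Ta (fst (snd z)) + H.G.D (snd (snd z))))"
      by (intro op_Pair op_plus op_uminus op_fst op_mono[OF op_comp[OF 1 H.G.Ds_op]]
          op_mono[OF op_comp[OF 2 H.G.op]] op_mono[OF op_comp[OF 1 op_restrict[OF H.G.Ta_op]]]
          op_mono[OF op_comp[OF 2 H.G.D_op]]) auto
    then have "bounded_op ?X UNIV T" by (simp add: T_def case_prod_beta')
    then have "coord (amp T g3) w = T (coord g3 w)"
      by (rule coord_amp_op) (simp add: fock_sub_def g3 s_in m_in)
    then show ?thesis by (simp add: g4_def g3 T_def)
  qed
  define g5 where "g5 = fock_diag id (fock_diag (char_fun A) id) g4"
  have g5: "coord g5 w = (p w, response 1 A ?a w, - H.G.Ta (s w) + H.G.D (m w))" for w
  proof -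
    have "coord (amp fst (amp snd g4)) = ?a" by (simp add: fun_eq_iff g4)
    then show ?thesis by (simp add: g5_def g4 H.C.coord_char_fun)
  qed
  let ?inv = "inv_into K.A.DY \<sigma>'"
  define g6 where "g6 = fock_diag id (amp ?inv) g5"
  note \<sigma>'_facts = \<sigma>'[unfolded Ahat_def] \<sigma>'_eq[unfolded Ahat_def]
  have inv: "?inv (response 1 A ?a w, - H.G.Ta (s w) + H.G.D (m w)) = response 1 H.E q w" for w
    using H.response_lifting[OF \<sigma>'_facts q_in m_eq, of w] by (simp add: s_def)
  have response_in: "response 1 H.E q w \<in> K.A.DY" for w
    using K.lower_response[of "coord f", OF f_in] by (simp add: q_def[abs_def])
  have g6: "coord g6 w = (p w, response 1 H.E q w)" for w
  proof -
    have "coord (amp ?inv (amp snd g5)) w = ?inv (coord (amp snd g5) w)"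
    proof (rule coord_amp[where K=1])
      fix w
      let ?y = "coord (amp snd g5) w"
      have y: "?y = (response 1 A ?a w, - H.G.Ta (s w) + H.G.D (m w))" by (simp add: g5)
      have "\<sigma>' (?inv ?y) = ?y"
        using H.\<sigma>'_response[OF \<sigma>'_facts q_in m_eq, of w] unfolding y inv by (simp add: s_def)
      moreover have "inner (\<sigma>' (?inv ?y)) (\<sigma>' (?inv ?y)) = inner (?inv ?y) (?inv ?y)"
        using response_in[of w] by (intro unitary_inner[OF \<sigma>'_facts(1)]) (simp_all only: y inv)
      ultimately show "norm (?inv ?y) \<le> 1 * norm ?y" by (simp add: norm_eq_sqrt_inner)
    qed
    then show ?thesis using inv[of w] by (simp add: g6_def g5)
  qed
  let ?S = "\<lambda>(u, v). K.G.Ds u + \<gamma> v"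
  have "char_lifting C E' f = amp ?S g6"
  proof (rule ell2_eqI)
    fix w
    have 1: "bounded_op (K.C.DX \<times> K.A.DY) UNIV (\<lambda>z. K.G.Ds (fst z) + \<gamma> (snd z))"
      by (intro op_plus op_mono[OF op_comp[OF op_fst K.G.Ds_op]] op_mono[OF op_comp[OF op_snd K.G.op]])
        auto
    then have "coord (amp ?S g6) w = ?S (coord g6 w)"
      by (intro coord_amp_op[of "K.C.DX \<times> K.A.DY" UNIV])
        (simp_all add: case_prod_beta' fock_sub_def g6 p_in response_in)
    also have "\<dots> = coord (char_lifting C E' f) w"
      using K.coord_char_lifting[of f w] f_in by (simp add: g6 p_def q_def[abs_def] fock_sub_def)
    finally show "coord (char_lifting C E' f) w = coord (amp ?S g6) w" by simp
  qed
  then show "(char_lifting C E' \<circ> amp (row_defect E')) g = (amp (\<lambda>(u, v). codefect (row_codefect_space Ahat) (row_defect_space C) \<gamma> u + \<gamma> v)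
      \<circ> fock_diag id (amp (inv_into (row_codefect_space Ahat) \<sigma>'))
      \<circ> fock_diag id (fock_diag (char_fun A) id)
      \<circ> amp (\<lambda>(u, p, q).
          (u,
           codefect (row_codefect_space A') (row_defect_space A) \<delta> p + \<delta> q,
           - adj (row_codefect_space A') \<delta> p + defect (row_codefect_space A') \<delta> q))
      \<circ> fock_diag id (fock_diag id (char_fun A'))
      \<circ> fock_diag id (amp \<sigma>)
      \<circ> amp (\<sigma>E \<circ> row_defect E')) g"
    by (simp add: f_def g1_def g2_def g3_def g4_def g5_def g6_def T_def)
qed

section \<open>Reduction to tuples of bounded operators\<close>

text \<open>The positivity of \<open>I - \<Sum>S\<^sub>i S\<^sub>i\<^sup>*\<close> bounds the adjoint of the row, and hence the row.\<close>

lemma row_tuple_of_row_contraction: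
  fixes S :: "'d::finite \<Rightarrow> 'h::complex_hilbert \<Rightarrow> 'h"
  assumes S: "row_contraction S"
  shows "row_tuple S"
proof
  show ops: "bounded_op UNIV UNIV (S i)" for i
    using S by (simp add: row_contraction_def)
  fix x :: "'h ^ 'd"
  let ?y = "row_op S x" and ?v = "\<chi> i. adj UNIV (S i) (row_op S x)"
  have sums: "inner (row_op S z) y = inner z (\<chi> i. adj UNIV (S i) y)" for z y
    by (simp add: row_op_def inner_sum_left inner_vec_def adj_inner[OF closed_csubspace_UNIV ops])
  have pos: "0 \<le> inner (?y - (\<Sum>i\<in>UNIV. S i (adj UNIV (S i) ?y))) ?y"
    using S by (simp add: row_contraction_def positive_op_def Re_cinner)
  have "inner (\<Sum>i\<in>UNIV. S i (adj UNIV (S i) ?y)) ?y = inner ?v ?v"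
    using sums[of ?v ?y] by (simp add: row_op_def)
  then have "(norm ?v)\<^sup>2 \<le> (norm ?y)\<^sup>2"
    using pos by (simp add: inner_diff_left power2_norm_eq_inner)
  then have v: "norm ?v \<le> norm ?y" by (rule power2_le_imp_le) simp
  have "norm ?y * norm ?y = inner x ?v"
    using sums[of x ?y] by (simp add: dot_square_norm power2_eq_square)
  also have "\<dots> \<le> norm x * norm ?v" by (rule norm_cauchy_schwarz)
  also have "\<dots> \<le> norm x * norm ?y" using v by (simp add: mult_left_mono)
  finally show "norm ?y \<le> norm x" by (cases "?y = 0") (simp_all add: mult_le_cancel_right)
qed

lemma lifting_op:
  assumes "bounded_op UNIV UNIV (C i)" "bounded_op UNIV UNIV (B i)" "bounded_op UNIV UNIV (A i)"
  shows "bounded_op UNIV UNIV (lifting C B A i)"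
proof -
  have "bounded_op (UNIV \<times> UNIV) UNIV (\<lambda>z. (C i (fst z), B i (fst z) + A i (snd z)))"
    by (intro op_Pair op_plus op_comp[OF op_fst] op_comp[OF op_snd] assms)
  moreover have "(\<lambda>z. (C i (fst z), B i (fst z) + A i (snd z))) = lifting C B A i"
    by (simp add: lifting_def case_prod_beta')
  ultimately show ?thesis by simp
qed

lemma row_op_0:
  assumes "\<And>i. bounded_op UNIV UNIV (S i)"
  shows "row_op S 0 = 0"
  using op_0[OF closed_csubspace_UNIV assms] by (simp add: row_op_def)

lemma row_tuple_lower:
  fixes C :: "'d::finite \<Rightarrow> 'c::complex_hilbert \<Rightarrow> 'c" and B
    and A :: "'d \<Rightarrow> 'a::complex_hilbert \<Rightarrow> 'a"
  assumes E: "row_tuple (lifting C B A)" and ops: "\<And>i. bounded_op UNIV UNIV (C i)"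
    "\<And>i. bounded_op UNIV UNIV (B i)" "\<And>i. bounded_op UNIV UNIV (A i)"
  shows "row_tuple A"
proof
  fix y
  have "norm (row_op (lifting C B A) (vec_pair 0 y)) \<le> norm (vec_pair (0 :: 'c ^ 'd) y)"
    using E by (simp add: row_tuple_def)
  moreover have "norm (vec_pair (0 :: 'c ^ 'd) y) = norm y"
    by (simp add: norm_eq_sqrt_inner inner_vec_pair)
  ultimately show "norm (row_op A y) \<le> norm y"
    by (simp add: row_op_lifting row_op_0[OF ops(1)] row_op_0[OF ops(2)])
qed (rule ops)

theorem theorem3p6:
  fixes C :: "'d::finite \<Rightarrow> 'c::complex_hilbert \<Rightarrow> 'c"
    and A :: "'d \<Rightarrow> 'a::complex_hilbert \<Rightarrow> 'a"
    and A' :: "'d \<Rightarrow> 'b::complex_hilbert \<Rightarrow> 'b"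
    and B :: "'d \<Rightarrow> 'c \<Rightarrow> 'a"
    and B1' :: "'d \<Rightarrow> 'c \<Rightarrow> 'b"
    and B2' :: "'d \<Rightarrow> 'a \<Rightarrow> 'b"
    and Ahat :: "'d \<Rightarrow> 'a \<times> 'b \<Rightarrow> 'a \<times> 'b"
    and Bhat :: "'d \<Rightarrow> 'c \<Rightarrow> 'a \<times> 'b"
    and E' :: "'d \<Rightarrow> 'c \<times> 'a \<times> 'b \<Rightarrow> 'c \<times> 'a \<times> 'b"
    and \<delta> :: "'b \<Rightarrow> 'a ^ 'd"
    and \<gamma> :: "'a \<times> 'b \<Rightarrow> 'c ^ 'd"
    and \<sigma> :: "('a \<times> 'b) ^ 'd \<Rightarrow> ('a ^ 'd) \<times> ('b ^ 'd)"
    and \<sigma>' :: "'a \<times> 'b \<Rightarrow> 'a \<times> 'b"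
    and \<sigma>E :: "('c \<times> 'a \<times> 'b) ^ 'd \<Rightarrow> ('c ^ 'd) \<times> (('a \<times> 'b) ^ 'd)"
  assumes d: "CARD('d) \<ge> 2"
    and C: "row_contraction C"
    and E: "minimal_lifting C B A"
    and E'_minimal: "minimal_lifting (lifting C B A) (\<lambda>i (x, y). B1' i x + B2' i y) A'"
    and Ahat: "Ahat = lifting A B2' A'"
    and Bhat: "Bhat = (\<lambda>i x. (B i x, B1' i x))"
    and E': "E' = lifting C Bhat Ahat"
    and \<delta>: "contraction (row_codefect_space A') (row_defect_space A) \<delta>"
    and B2'_eq: "\<And>x. row_op B2' x =
      row_codefect A' (adj (row_codefect_space A') \<delta> (row_defect A x))"
    and \<gamma>: "contraction (row_codefect_space Ahat) (row_defect_space C) \<gamma>"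
    and Bhat_eq: "\<And>x. row_op Bhat x =
      row_codefect Ahat (adj (row_codefect_space Ahat) \<gamma> (row_defect C x))"
    and \<sigma>: "unitary_op (row_defect_space Ahat)
      (codefect_space (row_codefect_space A') (row_defect_space A) \<delta> \<times> row_defect_space A') \<sigma>"
    and \<sigma>_eq: "\<And>x y z. vec_split z = (x, y) \<Longrightarrow> \<sigma> (row_defect Ahat z) =
      (codefect (row_codefect_space A') (row_defect_space A) \<delta> (row_defect A x),
       - adj UNIV (row_op A') (adj (row_codefect_space A') \<delta> (row_defect A x)) + row_defect A' y)"
    and \<sigma>': "unitary_op (row_codefect_space Ahat)
      (row_codefect_space A \<times> defect_space (row_codefect_space A') \<delta>) \<sigma>'"
    and \<sigma>'_eq: "\<And>x y. \<sigma>' (row_codefect Ahat (x, y)) =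
      (row_codefect A x - row_op A (\<delta> (row_codefect A' y)),
       defect (row_codefect_space A') \<delta> (row_codefect A' y))"
    and \<sigma>E: "unitary_op (row_defect_space E')
      (codefect_space (row_codefect_space Ahat) (row_defect_space C) \<gamma> \<times> row_defect_space Ahat) \<sigma>E"
    and \<sigma>E_eq: "\<And>x y z. vec_split z = (x, y) \<Longrightarrow> \<sigma>E (row_defect E' z) =
      (codefect (row_codefect_space Ahat) (row_defect_space C) \<gamma> (row_defect C x),
       - adj UNIV (row_op Ahat) (adj (row_codefect_space Ahat) \<gamma> (row_defect C x)) + row_defect Ahat y)"
  shows "char_lifting C E' \<circ> amp (row_defect E') =
      amp (\<lambda>(u, v). codefect (row_codefect_space Ahat) (row_defect_space C) \<gamma> u + \<gamma> v)
      \<circ> fock_diag id (amp (inv_into (row_codefect_space Ahat) \<sigma>'))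
      \<circ> fock_diag id (fock_diag (char_fun A) id)
      \<circ> amp (\<lambda>(u, p, q).
          (u,
           codefect (row_codefect_space A') (row_defect_space A) \<delta> p + \<delta> q,
           - adj (row_codefect_space A') \<delta> p + defect (row_codefect_space A') \<delta> q))
      \<circ> fock_diag id (fock_diag id (char_fun A'))
      \<circ> fock_diag id (amp \<sigma>)
      \<circ> amp (\<sigma>E \<circ> row_defect E')"
proof -
  let ?F = "\<lambda>i (x, y). B1' i x + B2' i y"
  note lower = E[unfolded minimal_lifting_def contractive_lifting_def, THEN conjunct1]
  note upper = E'_minimal[unfolded minimal_lifting_def contractive_lifting_def, THEN conjunct1]
  have ops: "bounded_op UNIV UNIV (C i)" "bounded_op UNIV UNIV (B i)" "bounded_op UNIV UNIV (A i)"
    "bounded_op UNIV UNIV (A' i)" "bounded_op UNIV UNIV (?F i)" for i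
    using lower upper by blast+
  have rC: "row_tuple C" by (rule row_tuple_of_row_contraction[OF C])
  have rE: "row_tuple (lifting C B A)" and rEE: "row_tuple (lifting (lifting C B A) ?F A')"
    using lower upper row_tuple_of_row_contraction by blast+
  have rA: "row_tuple A" by (rule row_tuple_lower[OF rE ops(1-3)])
  have rA': "row_tuple A'" by (rule row_tuple_lower[OF rEE lifting_op[OF ops(1-3)] ops(5,4)])
  (* Only the sum of B1' i and B2' i is known to be linear: a constant vector may be added to the
     one and subtracted from the other. The constants sum to zero over i and cancel in E', so the
     linear parts b1 and b2 have the same rows and give the same E'. *)
  have shift: "B1' i 0 + B2' i 0 = 0" for i
    using op_0[OF closed_csubspace_UNIV ops(5)[of i]] by (simp add: zero_prod_def)
  define b1 where "b1 i x = B1' i x + B2' i 0" for i x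
  define b2 where "b2 i y = B1' i 0 + B2' i y" for i y
  have F: "?F i (x, y) = b1 i x + b2 i y" for i x y
    using shift[of i] by (simp add: b1_def b2_def algebra_simps)
  interpret A: row_tuple A by (rule rA)
  interpret A': row_tuple A' by (rule rA')
  interpret C: row_tuple C by (rule rC)
  interpret \<delta>: contraction_op "row_codefect_space A'" "row_defect_space A" \<delta>
    by unfold_locales (rule A'.DY A.DX \<delta>)+
  have sum_B2': "(\<Sum>i\<in>UNIV. B2' i 0) = 0"
    using B2'_eq[of 0] op_0[OF closed_csubspace_UNIV \<delta>.Ta_op]
    by (simp add: row_op_def linear_0[OF A.lin(2)] linear_0[OF A'.lin(3)])
  then have sum_B1': "(\<Sum>i\<in>UNIV. B1' i 0) = 0"
    using sum.distrib[of "\<lambda>i. B1' i 0" "\<lambda>i. B2' i 0" UNIV] by (simp add: shift)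
  have row_b1: "row_op b1 = row_op B1'" and row_b2: "row_op b2 = row_op B2'"
    by (simp_all add: fun_eq_iff row_op_def b1_def b2_def sum.distrib sum_B1' sum_B2')
  let ?Ahat = "lifting A b2 A'" and ?Bhat = "\<lambda>i x. (B i x, b1 i x)"
  have row_Ahat: "row_op Ahat = row_op ?Ahat"
  proof
    show "row_op Ahat z = row_op ?Ahat z" for z
      by (rule vec_pair_surj[of z]) (simp add: Ahat row_op_lifting row_b2)
  qed
  have row_Bhat: "row_op Bhat = row_op ?Bhat"
    using row_b1 by (simp add: Bhat fun_eq_iff row_op_def prod_eq_iff fst_sum snd_sum)
  have E'_eq: "E' = lifting C ?Bhat ?Ahat"
  proof (intro ext)
    fix i and z :: "'c \<times> 'a \<times> 'b"
    obtain x y y' where z: "z = (x, y, y')" by (metis surj_pair)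
    show "E' i z = lifting C ?Bhat ?Ahat i z"
      using F[of i x y] by (simp add: z E' Ahat Bhat lifting_def flip: add.assoc)
  qed
  have ops_b: "bounded_op UNIV UNIV (b1 i)" "bounded_op UNIV UNIV (b2 i)" for i
  proof -
    have "bounded_op UNIV UNIV (\<lambda>x :: 'c. (x, 0 :: 'a))" "bounded_op UNIV UNIV (\<lambda>y :: 'a. (0 :: 'c, y))"
      by (rule op_intro[where K=1]; simp add: scaleC_prod_def norm_Pair)+
    from op_comp[OF this(1) ops(5)] op_comp[OF this(2) ops(5)]
    show "bounded_op UNIV UNIV (b1 i)" "bounded_op UNIV UNIV (b2 i)" by (simp_all add: b1_def[abs_def] b2_def[abs_def])
  qed
  have row_F: "row_op ?F (vec_pair x y) = row_op b1 x + row_op b2 y" for x y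
    using F by (simp add: row_op_def sum.distrib)
  have norm_EE: "norm (row_op (lifting (lifting C B A) ?F A') z) \<le> norm z" for z
    using rEE by (simp add: row_tuple_def)
  have rAhat: "row_tuple ?Ahat"
  proof
    show "bounded_op UNIV UNIV (?Ahat i)" for i by (intro lifting_op ops ops_b)
    fix v :: "('a \<times> 'b) ^ 'd"
    obtain y z where v: "v = vec_pair y z" by (rule vec_pair_surj)
    have "norm (row_op ?Ahat v) = norm (row_op (lifting (lifting C B A) ?F A') (vec_pair (vec_pair 0 y) z))"
      by (simp add: row_F v row_op_lifting row_op_0[OF ops(1)] row_op_0[OF ops(2)]
          row_op_0[OF ops_b(1)] norm_Pair)
    also have "\<dots> \<le> norm (vec_pair (vec_pair (0 :: 'c ^ 'd) y) z)" by (rule norm_EE)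
    also have "\<dots> = norm v" by (simp add: v norm_eq_sqrt_inner inner_vec_pair)
    finally show "norm (row_op ?Ahat v) \<le> norm v" .
  qed
  have rE': "row_tuple (lifting C ?Bhat ?Ahat)"
  proof
    show "bounded_op UNIV UNIV (lifting C ?Bhat ?Ahat i)" for i
      by (intro lifting_op ops ops_b op_Pair)
    fix v :: "('c \<times> 'a \<times> 'b) ^ 'd"
    obtain x u where v: "v = vec_pair x u" by (rule vec_pair_surj)
    obtain y z where u: "u = vec_pair y z" by (rule vec_pair_surj)
    have "row_op ?Bhat x = (row_op B x, row_op b1 x)"
      by (simp add: row_op_def prod_eq_iff fst_sum snd_sum)
    then have "norm (row_op (lifting C ?Bhat ?Ahat) v)
        = norm (row_op (lifting (lifting C B A) ?F A') (vec_pair (vec_pair x y) z))"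
      by (simp add: row_F v u row_op_lifting norm_Pair add.assoc)
    also have "\<dots> \<le> norm (vec_pair (vec_pair x y) z)" by (rule norm_EE)
    also have "\<dots> = norm v" by (simp add: v u norm_eq_sqrt_inner inner_vec_pair add.assoc)
    finally show "norm (row_op (lifting C ?Bhat ?Ahat) v) \<le> norm v" .
  qed
  have inner: "defect_lifting A b2 A' \<delta> \<sigma>"
  proof -
    interpret row_tuple ?Ahat by (rule rAhat)
    show ?thesis
      by unfold_locales
        (use \<delta> B2'_eq \<sigma> \<sigma>_eq[OF vec_split_vec_pair] in \<open>simp_all add: row_Ahat row_b2\<close>)
  qed
  have outer: "defect_lifting C ?Bhat ?Ahat \<gamma> \<sigma>E"
  proof -
    interpret Ah: row_tuple ?Ahat by (rule rAhat)
    interpret Ep: row_tuple "lifting C ?Bhat ?Ahat" by (rule rE')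
    show ?thesis
      by unfold_locales
        (use \<gamma> Bhat_eq \<sigma>E \<sigma>E_eq[OF vec_split_vec_pair] in
          \<open>simp_all add: row_Ahat row_Bhat[symmetric] E'_eq[symmetric]\<close>)
  qed
  show ?thesis
    using char_lifting_factorization[OF outer inner \<sigma>'[unfolded row_Ahat] \<sigma>'_eq[unfolded row_Ahat]]
    by (simp only: row_Ahat E'_eq)
qed

end
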